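(* Let $\mathcal N_{A\to B}$ be an arbitrary $s$-sender quantum multiple-access channel, where $A=\bigotimes_{k=1}^s A_k$. Then the entanglement-assisted classical capacity of the total communication rate is additive: $$C_{{\rm E},U}(\mathcal N)=C^{(1)}_{{\rm E},U}(\mathcal N).$$
   Context: A quantum multiple-access channel (MAC) with $s\ge 1$ senders is a completely positive trace-preserving map $\mathcal N_{A\to B}$ from the composite input system $A=\bigotimes_{k=1}^s A_k$ (sender $k$ controls $A_k$) to a single output system $B$ held by one receiver. In entanglement-assisted communication each sender $k$ shares with the receiver a reference system $A'_k$, and the joint input is a pure product state $\hat\phi_{AA'}=\bigotimes_{k=1}^s\hat\phi_{A_kA'_k}$ with $A'=\bigotimes_k A'_k$. For such $\hat\phi$ put $\hat\rho_{BA'}=(\mathcal N_{A\to B}\otimes\mathcal I_{A'})(\hat\phi_{AA'})$ and $\tilde C_{{\rm E},U}(\mathcal N,\hat\phi)=I(A';B)_{\hat\rho}$ (quantum mutual information, $U=\{1,\dots,s\}$). Define $C^{(1)}_{{\rm E},U}(\mathcal N)=\sup_{\hat\phi}\tilde C_{{\rm E},U}(\mathcal N,\hat\phi)$, the supremum over all pure states that are products across the senders, and $C_{{\rm E},U}(\mathcal N)=\lim_{n\to\infty}\frac1n C^{(1)}_{{\rm E},U}(\mathcal N^{\otimes n})$, where $\mathcal N^{\otimes n}$ is regarded as an $s$-sender MAC whose $k$th sender controls $A_k^{\otimes n}$ (so inputs may be entangled across the $n$ channel uses within each sender, but the state is still a product across senders). *)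

theory Defs
  imports "HOL-Analysis.Analysis" "Jordan_Normal_Form.Char_Poly"
begin

text \<open>Finite-dimensional quantum systems are described by a finite set of basis labels
(a carrier).  An operator on a system with carrier X is a function of two labels giving
its matrix entries; only entries on X x X are relevant.  Composite systems have
composite labels (pairs, or functions from a finite index set).\<close>

type_synonym 'x qop = "'x \<Rightarrow> 'x \<Rightarrow> complex"

definition psd_on :: "'x set \<Rightarrow> 'x qop \<Rightarrow> bool" where
  "psd_on X \<rho> \<longleftrightarrow> (\<forall>v :: 'x \<Rightarrow> complex.
      Im (\<Sum>z\<in>X. \<Sum>z'\<in>X. cnj (v z) * \<rho> z z' * v z') = 0 \<and>
      Re (\<Sum>z\<in>X. \<Sum>z'\<in>X. cnj (v z) * \<rho> z z' * v z') \<ge> 0)"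

definition enum_of :: "'x set \<Rightarrow> nat \<Rightarrow> 'x" where
  "enum_of X = (SOME f. bij_betw f {..<card X} X)"

definition mat_of_qop :: "'x set \<Rightarrow> 'x qop \<Rightarrow> complex mat" where
  "mat_of_qop X \<rho> = mat (card X) (card X) (\<lambda>(i,j). \<rho> (enum_of X i) (enum_of X j))"

definition eigenvalues_qop :: "'x set \<Rightarrow> 'x qop \<Rightarrow> complex multiset" where
  "eigenvalues_qop X \<rho> = proots (char_poly (mat_of_qop X \<rho>))"

text \<open>von Neumann entropy -Tr(rho log rho) (base 2; note log 2 0 = 0, so 0 log 0 = 0).\<close>
definition vn_entropy :: "'x set \<Rightarrow> 'x qop \<Rightarrow> real" where
  "vn_entropy X \<rho> = (\<Sum>\<^sub># (image_mset (\<lambda>e. - Re e * log 2 (Re e)) (eigenvalues_qop X \<rho>)))"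

text \<open>A linear map N from operators on X to operators on Y is given by its action on
matrix units: J x x' = N(|x><x'|), so that N(rho) = sum rho x x' * J x x'.\<close>

definition apply_map_ref ::
  "'x set \<Rightarrow> ('x \<Rightarrow> 'x \<Rightarrow> 'y qop) \<Rightarrow> ('x \<times> 'r) qop \<Rightarrow> ('y \<times> 'r) qop" where
  "apply_map_ref X J \<sigma> = (\<lambda>(y,r) (y',r'). \<Sum>x\<in>X. \<Sum>x'\<in>X. \<sigma> (x,r) (x',r') * J x x' y y')"

definition completely_positive :: "'x set \<Rightarrow> 'y set \<Rightarrow> ('x \<Rightarrow> 'x \<Rightarrow> 'y qop) \<Rightarrow> bool" where
  "completely_positive X Y J \<longleftrightarrow>
     (\<forall>(R :: nat set) (\<sigma> :: ('x \<times> nat) qop). finite R \<longrightarrow> psd_on (X \<times> R) \<sigma> \<longrightarrow>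
        psd_on (Y \<times> R) (apply_map_ref X J \<sigma>))"

definition trace_preserving :: "'x set \<Rightarrow> 'y set \<Rightarrow> ('x \<Rightarrow> 'x \<Rightarrow> 'y qop) \<Rightarrow> bool" where
  "trace_preserving X Y J \<longleftrightarrow>
     (\<forall>x\<in>X. \<forall>x'\<in>X. (\<Sum>y\<in>Y. J x x' y y) = (if x = x' then 1 else 0))"

definition cptp :: "'x set \<Rightarrow> 'y set \<Rightarrow> ('x \<Rightarrow> 'x \<Rightarrow> 'y qop) \<Rightarrow> bool" where
  "cptp X Y J \<longleftrightarrow> completely_positive X Y J \<and> trace_preserving X Y J"

text \<open>An s-sender quantum MAC: sender k (k < s) controls system A_k with finite nonempty
carrier Ak k; the joint input A = A_0 x ... x A_{s-1} has labels x \<in> PiE {..<s} Ak;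
the output B has finite nonempty carrier Bs; J describes the CPTP map N_{A->B}.\<close>

definition is_MAC :: "nat \<Rightarrow> (nat \<Rightarrow> 'a set) \<Rightarrow> 'b set \<Rightarrow>
    ((nat \<Rightarrow> 'a) \<Rightarrow> (nat \<Rightarrow> 'a) \<Rightarrow> 'b qop) \<Rightarrow> bool" where
  "is_MAC s Ak Bs J \<longleftrightarrow> s \<ge> 1 \<and> (\<forall>k<s. finite (Ak k) \<and> Ak k \<noteq> {}) \<and>
     finite Bs \<and> Bs \<noteq> {} \<and> cptp (PiE {..<s} Ak) Bs J"

text \<open>Admissible inputs: sender k holds a pure state phi k on A_k A'_k, where the reference
A'_k has an arbitrary finite carrier R k of natural numbers.\<close>
definition admissible_input :: "nat \<Rightarrow> (nat \<Rightarrow> 'a set) \<Rightarrow> (nat \<Rightarrow> nat set) \<Rightarrow>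
    (nat \<Rightarrow> 'a \<times> nat \<Rightarrow> complex) \<Rightarrow> bool" where
  "admissible_input s Ak R \<phi> \<longleftrightarrow> (\<forall>k<s. finite (R k) \<and>
      (\<Sum>a\<in>Ak k. \<Sum>r\<in>R k. (cmod (\<phi> k (a, r)))\<^sup>2) = 1)"

definition product_state :: "nat \<Rightarrow> (nat \<Rightarrow> 'a \<times> nat \<Rightarrow> complex) \<Rightarrow>
    (nat \<Rightarrow> 'a) \<times> (nat \<Rightarrow> nat) \<Rightarrow> complex" where
  "product_state s \<phi> = (\<lambda>(x, r). \<Prod>k<s. \<phi> k (x k, r k))"

definition output_state :: "nat \<Rightarrow> (nat \<Rightarrow> 'a set) \<Rightarrow>
    ((nat \<Rightarrow> 'a) \<Rightarrow> (nat \<Rightarrow> 'a) \<Rightarrow> 'b qop) \<Rightarrow> (nat \<Rightarrow> 'a \<times> nat \<Rightarrow> complex) \<Rightarrow>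
    ('b \<times> (nat \<Rightarrow> nat)) qop" where
  "output_state s Ak J \<phi> = apply_map_ref (PiE {..<s} Ak) J
      (\<lambda>(x, r) (x', r'). product_state s \<phi> (x, r) * cnj (product_state s \<phi> (x', r')))"

definition ptrace_ref :: "'r set \<Rightarrow> ('b \<times> 'r) qop \<Rightarrow> 'b qop" where
  "ptrace_ref R \<rho> = (\<lambda>y y'. \<Sum>r\<in>R. \<rho> (y, r) (y', r))"

definition ptrace_out :: "'b set \<Rightarrow> ('b \<times> 'r) qop \<Rightarrow> 'r qop" where
  "ptrace_out Y \<rho> = (\<lambda>r r'. \<Sum>y\<in>Y. \<rho> (y, r) (y, r'))"

definition mutual_info :: "'b set \<Rightarrow> 'r set \<Rightarrow> ('b \<times> 'r) qop \<Rightarrow> real" where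
  "mutual_info Y R \<rho> = vn_entropy R (ptrace_out Y \<rho>) + vn_entropy Y (ptrace_ref R \<rho>)
      - vn_entropy (Y \<times> R) \<rho>"

definition C_tilde_EU :: "nat \<Rightarrow> (nat \<Rightarrow> 'a set) \<Rightarrow> 'b set \<Rightarrow>
    ((nat \<Rightarrow> 'a) \<Rightarrow> (nat \<Rightarrow> 'a) \<Rightarrow> 'b qop) \<Rightarrow> (nat \<Rightarrow> nat set) \<Rightarrow>
    (nat \<Rightarrow> 'a \<times> nat \<Rightarrow> complex) \<Rightarrow> real" where
  "C_tilde_EU s Ak Bs J R \<phi> = mutual_info Bs (PiE {..<s} R) (output_state s Ak J \<phi>)"

definition C1_EU :: "nat \<Rightarrow> (nat \<Rightarrow> 'a set) \<Rightarrow> 'b set \<Rightarrow>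
    ((nat \<Rightarrow> 'a) \<Rightarrow> (nat \<Rightarrow> 'a) \<Rightarrow> 'b qop) \<Rightarrow> real" where
  "C1_EU s Ak Bs J = (SUP (R, \<phi>) \<in> {(R, \<phi>). admissible_input s Ak R \<phi>}. C_tilde_EU s Ak Bs J R \<phi>)"

text \<open>n-fold tensor power N^{\<otimes>n} as an s-sender MAC: sender k controls A_k^{\<otimes>n}, with labels
i \<mapsto> a (i < n); the output B^{\<otimes>n} has labels i \<mapsto> b.\<close>
definition Ak_pow :: "(nat \<Rightarrow> 'a set) \<Rightarrow> nat \<Rightarrow> nat \<Rightarrow> (nat \<Rightarrow> 'a) set" where
  "Ak_pow Ak n = (\<lambda>k. PiE {..<n} (\<lambda>_. Ak k))"

definition Bs_pow :: "'b set \<Rightarrow> nat \<Rightarrow> (nat \<Rightarrow> 'b) set" where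
  "Bs_pow Bs n = PiE {..<n} (\<lambda>_. Bs)"

definition J_pow :: "nat \<Rightarrow> ((nat \<Rightarrow> 'a) \<Rightarrow> (nat \<Rightarrow> 'a) \<Rightarrow> 'b qop) \<Rightarrow> nat \<Rightarrow>
    (nat \<Rightarrow> nat \<Rightarrow> 'a) \<Rightarrow> (nat \<Rightarrow> nat \<Rightarrow> 'a) \<Rightarrow> (nat \<Rightarrow> 'b) qop" where
  "J_pow s J n = (\<lambda>x x' y y'. \<Prod>i<n.
      J (\<lambda>k\<in>{..<s}. x k i) (\<lambda>k\<in>{..<s}. x' k i) (y i) (y' i))"

definition C_EU :: "nat \<Rightarrow> (nat \<Rightarrow> 'a set) \<Rightarrow> 'b set \<Rightarrow>
    ((nat \<Rightarrow> 'a) \<Rightarrow> (nat \<Rightarrow> 'a) \<Rightarrow> 'b qop) \<Rightarrow> real" where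
  "C_EU s Ak Bs J = lim (\<lambda>n. C1_EU s (Ak_pow Ak n) (Bs_pow Bs n) (J_pow s J n) / real n)"

end

theory Submission
  imports Defs "Jordan_Normal_Form.Schur_Decomposition"
begin

text \<open>For channel uses 1 and 2 and an input with reference R, the chain rule and I(B1;B2) \<ge> 0 give
I(R;B1B2) \<le> I(R;B1) + I(RB1;B2), and by data processing this is at most I(RA2;B1) + I(RA1;B2).
In each term the untouched inputs of the other use join the reference, sender by sender, so both are
admissible values for a smaller number of uses.  Together with product inputs this yields
C1(n+1) = C1(n) + C1(1) for the n-use quantities, hence the limit.

Data processing is monotonicity of relative entropy under trace-preserving Kraus maps.  It follows from the
integral representation of the logarithm: the integrand is the supremum over operators W of an expression
that can only grow when W is pulled back along the map.\<close>

section \<open>Spectral theory on finite carriers\<close>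

lemma sum_delta_mult:
  fixes f :: "'x \<Rightarrow> 'c :: semiring_1"
  assumes "finite X"
  shows "(\<Sum>y\<in>X. f y * (if y = x then 1 else 0)) = (if x \<in> X then f x else 0)"
    and "(\<Sum>y\<in>X. f y * (if x = y then 1 else 0)) = (if x \<in> X then f x else 0)"
    and "(\<Sum>y\<in>X. (if y = x then 1 else 0) * f y) = (if x \<in> X then f x else 0)"
    and "(\<Sum>y\<in>X. (if x = y then 1 else 0) * f y) = (if x \<in> X then f x else 0)"
proof -
  have "f y * (if y = x then 1 else 0) = (if y = x then f y else 0)"
    "f y * (if x = y then 1 else 0) = (if x = y then f y else 0)"
    "(if y = x then 1 else 0) * f y = (if y = x then f y else 0)"
    "(if x = y then 1 else 0) * f y = (if x = y then f y else 0)" for y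
    by auto
  with assms show "(\<Sum>y\<in>X. f y * (if y = x then 1 else 0)) = (if x \<in> X then f x else 0)"
    "(\<Sum>y\<in>X. f y * (if x = y then 1 else 0)) = (if x \<in> X then f x else 0)"
    "(\<Sum>y\<in>X. (if y = x then 1 else 0) * f y) = (if x \<in> X then f x else 0)"
    "(\<Sum>y\<in>X. (if x = y then 1 else 0) * f y) = (if x \<in> X then f x else 0)"
    by (simp_all only: sum.delta sum.delta')
qed

lemma sum_rotate: "(\<Sum>a\<in>A. \<Sum>b\<in>B. \<Sum>c\<in>C. f a b c) = (\<Sum>b\<in>B. \<Sum>c\<in>C. \<Sum>a\<in>A. f a b c)"
  by (subst sum.swap) (intro sum.cong refl sum.swap)

definition ip_on :: "'x set \<Rightarrow> ('x \<Rightarrow> complex) \<Rightarrow> ('x \<Rightarrow> complex) \<Rightarrow> complex" where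
  "ip_on X f g = (\<Sum>x\<in>X. cnj (f x) * g x)"

definition norm_sq :: "'x set \<Rightarrow> ('x \<Rightarrow> complex) \<Rightarrow> real" where
  "norm_sq X f = (\<Sum>x\<in>X. (cmod (f x))\<^sup>2)"

definition op_app :: "'x set \<Rightarrow> ('y \<Rightarrow> 'x \<Rightarrow> complex) \<Rightarrow> ('x \<Rightarrow> complex) \<Rightarrow> 'y \<Rightarrow> complex" where
  "op_app X A f = (\<lambda>y. \<Sum>x\<in>X. A y x * f x)"

definition op_adj :: "('y \<Rightarrow> 'x \<Rightarrow> complex) \<Rightarrow> 'x \<Rightarrow> 'y \<Rightarrow> complex" where
  "op_adj A = (\<lambda>x y. cnj (A y x))"

lemma op_adj_op_adj [simp]: "op_adj (op_adj A) = A"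
  by (simp add: op_adj_def)

lemma ip_on_self: "ip_on X f f = of_real (norm_sq X f)"
  unfolding ip_on_def norm_sq_def of_real_sum
  by (intro sum.cong refl, metis complex_norm_square mult.commute)

lemma norm_sq_nonneg [simp]: "norm_sq X f \<ge> 0"
  by (simp add: norm_sq_def sum_nonneg)

lemma cnj_ip_on: "cnj (ip_on X f g) = ip_on X g f"
  by (simp add: ip_on_def mult.commute)

lemma ip_on_op_app: "ip_on Y g (op_app X A f) = ip_on X (op_app Y (op_adj A) g) f"
proof -
  have "ip_on Y g (op_app X A f) = (\<Sum>y\<in>Y. \<Sum>x\<in>X. cnj (g y) * (A y x * f x))"
    by (simp add: ip_on_def op_app_def sum_distrib_left)
  also have "\<dots> = (\<Sum>x\<in>X. \<Sum>y\<in>Y. cnj (g y) * (A y x * f x))"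
    by (rule sum.swap)
  also have "\<dots> = ip_on X (op_app Y (op_adj A) g) f"
    by (simp add: ip_on_def op_app_def op_adj_def sum_distrib_left sum_distrib_right mult_ac)
  finally show ?thesis .
qed

lemma ip_on_diff_right: "ip_on X f (\<lambda>x. g x - h x) = ip_on X f g - ip_on X f h"
  by (simp add: ip_on_def ring_distribs sum_subtractf)

lemma ip_on_scale_right: "ip_on X f (\<lambda>x. c * g x) = c * ip_on X f g"
  by (simp add: ip_on_def sum_distrib_left mult_ac)

lemma ip_on_scale_left: "ip_on X (\<lambda>x. c * g x) f = cnj c * ip_on X g f"
  by (simp add: ip_on_def sum_distrib_left mult_ac)

lemma ip_on_sum_right: "ip_on X f (\<lambda>x. \<Sum>i\<in>I. g i x) = (\<Sum>i\<in>I. ip_on X f (g i))"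
  unfolding ip_on_def sum_distrib_left by (rule sum.swap)

lemma ip_on_sum_left: "ip_on X (\<lambda>x. \<Sum>i\<in>I. g i x) f = (\<Sum>i\<in>I. ip_on X (g i) f)"
  unfolding ip_on_def cnj_sum sum_distrib_right by (rule sum.swap)

lemma ip_on_cong: "(\<And>x. x \<in> X \<Longrightarrow> f x = f' x) \<Longrightarrow> (\<And>x. x \<in> X \<Longrightarrow> g x = g' x) \<Longrightarrow> ip_on X f g = ip_on X f' g'"
  by (simp add: ip_on_def)

lemma norm_sq_eq_0: "finite X \<Longrightarrow> norm_sq X f = 0 \<longleftrightarrow> (\<forall>x\<in>X. f x = 0)"
  by (simp add: norm_sq_def sum_nonneg_eq_0_iff)

lemma cmod2: "complex_of_real ((cmod z)\<^sup>2) = cnj z * z"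
  by (simp only: complex_norm_square mult.commute)

definition orthonormal :: "'x set \<Rightarrow> 'i set \<Rightarrow> ('i \<Rightarrow> 'x \<Rightarrow> complex) \<Rightarrow> bool" where
  "orthonormal X I u \<longleftrightarrow> finite X \<and> finite I \<and> (\<forall>i\<in>I. \<forall>j\<in>I. ip_on X (u i) (u j) = (if i = j then 1 else 0))"

definition onb :: "'x set \<Rightarrow> 'i set \<Rightarrow> ('i \<Rightarrow> 'x \<Rightarrow> complex) \<Rightarrow> bool" where
  "onb X I u \<longleftrightarrow> orthonormal X I u \<and>
     (\<forall>x\<in>X. \<forall>x'\<in>X. (\<Sum>i\<in>I. u i x * cnj (u i x')) = (if x = x' then 1 else 0))"

definition spectral :: "'x set \<Rightarrow> 'i set \<Rightarrow> ('i \<Rightarrow> 'x \<Rightarrow> complex) \<Rightarrow> ('i \<Rightarrow> real) \<Rightarrow> 'x qop \<Rightarrow> bool" where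
  "spectral X I u p \<rho> \<longleftrightarrow> onb X I u \<and>
     (\<forall>x\<in>X. \<forall>x'\<in>X. \<rho> x x' = (\<Sum>i\<in>I. of_real (p i) * u i x * cnj (u i x')))"

lemma orthonormal_norm_sq:
  assumes "orthonormal X I u" "i \<in> I"
  shows "norm_sq X (u i) = 1"
proof -
  have "complex_of_real (norm_sq X (u i)) = 1"
    using assms unfolding ip_on_self[symmetric] orthonormal_def by auto
  then show ?thesis by (simp only: of_real_eq_1_iff)
qed

lemma onb_finite: "onb X I u \<Longrightarrow> finite X" "onb X I u \<Longrightarrow> finite I"
  by (auto simp: onb_def orthonormal_def)

lemma onb_norm_sq: "onb X I u \<Longrightarrow> i \<in> I \<Longrightarrow> norm_sq X (u i) = 1"
  unfolding onb_def by (elim conjE orthonormal_norm_sq)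

lemma onb_expand:
  assumes "onb X I u" "x \<in> X"
  shows "(\<Sum>i\<in>I. u i x * ip_on X (u i) f) = f x"
proof -
  have "(\<Sum>i\<in>I. u i x * ip_on X (u i) f) = (\<Sum>i\<in>I. \<Sum>x'\<in>X. u i x * cnj (u i x') * f x')"
    by (simp add: ip_on_def sum_distrib_left mult_ac)
  also have "\<dots> = (\<Sum>x'\<in>X. (\<Sum>i\<in>I. u i x * cnj (u i x')) * f x')"
    by (subst sum.swap) (simp add: sum_distrib_right)
  also have "\<dots> = (\<Sum>x'\<in>X. (if x = x' then 1 else 0) * f x')"
    using assms by (intro sum.cong refl) (simp add: onb_def)
  also have "\<dots> = f x"
    using assms(2) by (simp add: sum_delta_mult onb_finite[OF assms(1)])
  finally show ?thesis .
qed

lemma parseval: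
  assumes "onb X I u"
  shows "(\<Sum>i\<in>I. ip_on X f (u i) * ip_on X (u i) g) = ip_on X f g"
proof -
  have "ip_on X f g = ip_on X f (\<lambda>x. \<Sum>i\<in>I. ip_on X (u i) g * u i x)"
    by (rule ip_on_cong) (auto simp: onb_expand[OF assms] mult.commute[of "ip_on X (u _) g"])
  also have "\<dots> = (\<Sum>i\<in>I. ip_on X f (u i) * ip_on X (u i) g)"
    by (simp add: ip_on_sum_right ip_on_scale_right) (simp add: mult.commute)
  finally show ?thesis by simp
qed

lemma norm_sq_onb:
  assumes "onb X I u"
  shows "norm_sq X f = (\<Sum>i\<in>I. (cmod (ip_on X (u i) f))\<^sup>2)"
proof -
  have "complex_of_real (norm_sq X f) = (\<Sum>i\<in>I. ip_on X f (u i) * ip_on X (u i) f)"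
    by (simp add: parseval[OF assms] ip_on_self)
  also have "\<dots> = of_real (\<Sum>i\<in>I. (cmod (ip_on X (u i) f))\<^sup>2)"
    unfolding of_real_sum cmod2 cnj_ip_on ..
  finally show ?thesis by (simp only: of_real_eq_iff)
qed

lemma onb_card:
  assumes "onb X I u"
  shows "card I = card X"
proof -
  have "of_nat (card I) = (\<Sum>i\<in>I. \<Sum>x\<in>X. u i x * cnj (u i x))"
    using assms by (simp add: onb_def orthonormal_def ip_on_def mult.commute)
  also have "\<dots> = (\<Sum>x\<in>X. \<Sum>i\<in>I. u i x * cnj (u i x))"
    by (rule sum.swap)
  also have "\<dots> = of_nat (card X)"
    using assms by (simp add: onb_def)
  finally show ?thesis by (simp only: of_nat_eq_iff)
qed

lemma bessel:
  assumes "orthonormal X I u"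
  shows "(\<Sum>i\<in>I. (cmod (ip_on X (u i) f))\<^sup>2) \<le> norm_sq X f"
proof -
  define g where "g = (\<lambda>x. \<Sum>i\<in>I. ip_on X (u i) f * u i x)"
  define s where "s = (\<Sum>i\<in>I. (cmod (ip_on X (u i) f))\<^sup>2)"
  have fin: "finite I" using assms by (simp add: orthonormal_def)
  have fg: "ip_on X f g = of_real s"
    unfolding g_def s_def of_real_sum cmod2
    by (simp add: ip_on_sum_right ip_on_scale_right cnj_ip_on) (simp add: mult.commute)
  have ug: "ip_on X (u i) g = ip_on X (u i) f" if "i \<in> I" for i
  proof -
    have "ip_on X (u i) g = (\<Sum>j\<in>I. ip_on X (u j) f * (if i = j then 1 else 0))"
      using assms that by (simp add: g_def ip_on_sum_right ip_on_scale_right orthonormal_def)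
    then show ?thesis using that fin by (simp add: sum_delta_mult)
  qed
  have "ip_on X g g = (\<Sum>i\<in>I. cnj (ip_on X (u i) f) * ip_on X (u i) g)"
    unfolding ip_on_sum_left[of X "\<lambda>i x. ip_on X (u i) f * u i x" I g, folded g_def]
    by (simp only: ip_on_scale_left)
  then have gg: "ip_on X g g = of_real s"
    unfolding s_def of_real_sum cmod2 by (simp add: ug)
  have "ip_on X (\<lambda>x. f x - g x) (\<lambda>x. f x - g x) = ip_on X f f - ip_on X f g - (ip_on X g f - ip_on X g g)"
    by (simp add: ip_on_def ring_distribs sum_subtractf)
  also have "ip_on X g f = of_real s" using cnj_ip_on[of X f g] fg by simp
  finally have "complex_of_real (norm_sq X (\<lambda>x. f x - g x)) = of_real (norm_sq X f - s)"
    by (simp add: ip_on_self fg gg[unfolded ip_on_self])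
  then have "norm_sq X f - s \<ge> 0"
    using norm_sq_nonneg[of X "\<lambda>x. f x - g x"] by (simp only: of_real_eq_iff)
  then show ?thesis by (simp add: s_def)
qed

lemma orthonormal_card_le:
  assumes "orthonormal X I u"
  shows "card I \<le> card X"
proof -
  have fin: "finite X" using assms by (simp add: orthonormal_def)
  have "real (card I) = (\<Sum>i\<in>I. norm_sq X (u i))"
    using assms by (simp add: orthonormal_norm_sq)
  also have "\<dots> = (\<Sum>x\<in>X. \<Sum>i\<in>I. (cmod (u i x))\<^sup>2)"
    unfolding norm_sq_def by (rule sum.swap)
  also have "\<dots> \<le> (\<Sum>x\<in>X. 1)"
  proof (rule sum_mono)
    fix x assume x: "x \<in> X"
    define e where "e = (\<lambda>y. if y = x then 1 else 0 :: complex)"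
    have "(\<Sum>i\<in>I. (cmod (ip_on X (u i) e))\<^sup>2) \<le> norm_sq X e"
      by (rule bessel[OF assms])
    also have "norm_sq X e = 1" using x fin
      by (simp add: norm_sq_def e_def if_distrib[of cmod] if_distrib[of "\<lambda>z. z^2"] cong: if_cong)
    finally show "(\<Sum>i\<in>I. (cmod (u i x))\<^sup>2) \<le> 1"
      using x fin by (simp add: ip_on_def e_def sum_delta_mult)
  qed
  finally show ?thesis by simp
qed


lemma bij_enum_of: "finite X \<Longrightarrow> bij_betw (enum_of X) {..<card X} X"
  unfolding enum_of_def atLeast0LessThan[symmetric]
  by (rule someI_ex[of "\<lambda>f. bij_betw f {0..<card X} X", OF ex_bij_betw_nat_finite])

lemma vn_entropy_spectral:
  assumes "spectral X I u p \<rho>"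
  shows "vn_entropy X \<rho> = (\<Sum>i\<in>I. - p i * log 2 (p i))"
proof -
  define n where "n = card X"
  have onb: "onb X I u" and rho: "\<And>x x'. x \<in> X \<Longrightarrow> x' \<in> X \<Longrightarrow>
      \<rho> x x' = (\<Sum>i\<in>I. of_real (p i) * u i x * cnj (u i x'))"
    using assms unfolding spectral_def by blast+
  have fin: "finite X" "finite I" using onb_finite[OF onb] .
  have cI: "card I = n" using onb_card[OF onb] by (simp add: n_def)
  define e where "e = enum_of X"
  define g where "g = enum_of I"
  have be: "bij_betw e {0..<n} X" and bg: "bij_betw g {0..<n} I"
    using bij_enum_of[OF fin(1)] bij_enum_of[OF fin(2), unfolded cI]
    by (simp_all only: e_def g_def n_def atLeast0LessThan)
  have eX: "e a \<in> X" and gI: "g a \<in> I" if "a < n" for a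
    using bij_betwE[OF be] bij_betwE[OF bg] that by auto
  have einj: "e a = e b \<longleftrightarrow> a = b" and ginj: "g a = g b \<longleftrightarrow> a = b" if "a < n" "b < n" for a b
    using inj_on_eq_iff[OF bij_betw_imp_inj_on[OF be], of a b]
      inj_on_eq_iff[OF bij_betw_imp_inj_on[OF bg], of a b] that by auto
  define A where "A = mat_of_qop X \<rho>"
  define U where "U = mat n n (\<lambda>(a, i). u (g i) (e a))"
  define V where "V = mat n n (\<lambda>(i, a). cnj (u (g i) (e a)))"
  define D where "D = mat n n (\<lambda>(i, j). if i = j then complex_of_real (p (g i)) else 0)"
  have carr: "A \<in> carrier_mat n n" "U \<in> carrier_mat n n" "V \<in> carrier_mat n n" "D \<in> carrier_mat n n"
    by (auto simp: A_def U_def V_def D_def mat_of_qop_def n_def)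
  have UV: "U * V = 1\<^sub>m n"
  proof (rule eq_matI)
    fix a b assume ab: "a < dim_row (1\<^sub>m n :: complex mat)" "b < dim_col (1\<^sub>m n :: complex mat)"
    have "(U * V) $$ (a, b) = (\<Sum>i\<in>{0..<n}. u (g i) (e a) * cnj (u (g i) (e b)))"
      using ab by (simp add: U_def V_def times_mat_def scalar_prod_def)
    also have "\<dots> = (\<Sum>i\<in>I. u i (e a) * cnj (u i (e b)))"
      by (rule sum.reindex_bij_betw[OF bg])
    finally show "(U * V) $$ (a, b) = 1\<^sub>m n $$ (a, b)"
      using onb ab eX by (simp add: onb_def einj)
  qed (use carr in auto)
  have VU: "V * U = 1\<^sub>m n"
  proof (rule eq_matI)
    fix i j assume ij: "i < dim_row (1\<^sub>m n :: complex mat)" "j < dim_col (1\<^sub>m n :: complex mat)"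
    have "(V * U) $$ (i, j) = (\<Sum>a\<in>{0..<n}. cnj (u (g i) (e a)) * u (g j) (e a))"
      using ij by (simp add: U_def V_def times_mat_def scalar_prod_def)
    also have "\<dots> = ip_on X (u (g i)) (u (g j))"
      unfolding ip_on_def by (rule sum.reindex_bij_betw[OF be])
    finally show "(V * U) $$ (i, j) = 1\<^sub>m n $$ (i, j)"
      using onb ij gI by (simp add: onb_def orthonormal_def ginj)
  qed (use carr in auto)
  have UD: "U * D = mat n n (\<lambda>(a, i). u (g i) (e a) * of_real (p (g i)))"
  proof (rule eq_matI)
    fix a i assume "a < dim_row (mat n n (\<lambda>(a, i). u (g i) (e a) * complex_of_real (p (g i))))"
      "i < dim_col (mat n n (\<lambda>(a, i). u (g i) (e a) * complex_of_real (p (g i))))"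
    then have ai: "a < n" "i < n" by auto
    have "(U * D) $$ (a, i) = (\<Sum>j\<in>{0..<n}. u (g j) (e a) * (if j = i then complex_of_real (p (g j)) else 0))"
      using ai by (simp add: U_def D_def times_mat_def scalar_prod_def)
    also have "\<dots> = (\<Sum>j\<in>{0..<n}. if j = i then u (g i) (e a) * of_real (p (g i)) else 0)"
      by (intro sum.cong refl) auto
    also have "\<dots> = u (g i) (e a) * of_real (p (g i))" using ai by simp
    finally show "(U * D) $$ (a, i) = mat n n (\<lambda>(a, i). u (g i) (e a) * complex_of_real (p (g i))) $$ (a, i)"
      using ai by simp
  qed (use carr in auto)
  have A: "A = U * D * V"
  proof (rule eq_matI)
    fix a b assume ab': "a < dim_row (U * D * V)" "b < dim_col (U * D * V)"
    then have ab: "a < n" "b < n" using carr by auto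
    have "(U * D * V) $$ (a, b) = (\<Sum>i\<in>{0..<n}. u (g i) (e a) * of_real (p (g i)) * cnj (u (g i) (e b)))"
      unfolding UD using ab by (simp add: V_def times_mat_def scalar_prod_def)
    also have "\<dots> = (\<Sum>i\<in>I. u i (e a) * of_real (p i) * cnj (u i (e b)))"
      by (rule sum.reindex_bij_betw[OF bg])
    also have "\<dots> = \<rho> (e a) (e b)" using rho[OF eX[OF ab(1)] eX[OF ab(2)]] by (simp add: mult_ac)
    finally show "A $$ (a, b) = (U * D * V) $$ (a, b)"
      using ab by (simp add: A_def mat_of_qop_def n_def e_def)
  qed (use carr in auto)
  have "similar_mat_wit A D U V"
    by (rule similar_mat_witI[OF UV VU A]) (use carr in auto)
  then have "char_poly A = char_poly D"
    by (intro char_poly_similar) (auto simp: similar_mat_def)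
  also have "\<dots> = (\<Prod>a\<leftarrow>diag_mat D. [:- a, 1:])"
    by (rule char_poly_upper_triangular[OF carr(4)]) (auto simp: D_def)
  also have "diag_mat D = map (\<lambda>i. complex_of_real (p (g i))) [0..<n]"
    by (simp add: diag_mat_def D_def)
  finally have cp: "char_poly A = (\<Prod>i\<leftarrow>[0..<n]. [:- complex_of_real (p (g i)), 1:])"
    by (simp add: comp_def)
  also have "\<dots> = (\<Prod>i\<in>{0..<n}. [:- complex_of_real (p (g i)), 1:])"
    using prod.distinct_set_conv_list[of "[0..<n]" "\<lambda>i. [:- complex_of_real (p (g i)), 1:]"] by simp
  finally have "eigenvalues_qop X \<rho> = proots (\<Prod>i\<in>{0..<n}. [:- complex_of_real (p (g i)), 1:])"
    unfolding eigenvalues_qop_def A_def[symmetric] by simp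
  also have "\<dots> = (\<Sum>i\<in>{0..<n}. {#complex_of_real (p (g i))#})"
    by (subst proots_prod) auto
  finally have ev: "eigenvalues_qop X \<rho> = (\<Sum>i\<in>{0..<n}. {#complex_of_real (p (g i))#})" .
  have "\<Sum>\<^sub># (image_mset (\<lambda>e. - Re e * log 2 (Re e)) (\<Sum>i\<in>{0..<m}. {#complex_of_real (p (g i))#}))
      = (\<Sum>i\<in>{0..<m}. - p (g i) * log 2 (p (g i)))" for m
    by (induction m) auto
  then have "vn_entropy X \<rho> = (\<Sum>i\<in>{0..<n}. - p (g i) * log 2 (p (g i)))"
    unfolding vn_entropy_def ev .
  also have "\<dots> = (\<Sum>i\<in>I. - p i * log 2 (p i))"
    by (rule sum.reindex_bij_betw[OF bg])
  finally show ?thesis .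
qed


definition herm_on :: "'x set \<Rightarrow> 'x qop \<Rightarrow> bool" where
  "herm_on X \<rho> \<longleftrightarrow> (\<forall>x\<in>X. \<forall>x'\<in>X. \<rho> x' x = cnj (\<rho> x x'))"

lemma herm_onD: "herm_on X \<rho> \<Longrightarrow> x \<in> X \<Longrightarrow> x' \<in> X \<Longrightarrow> cnj (\<rho> x' x) = \<rho> x x'"
  unfolding herm_on_def by (metis complex_cnj_cnj)

lemma herm_onI: "(\<And>x x'. x \<in> X \<Longrightarrow> x' \<in> X \<Longrightarrow> \<rho> x x' = cnj (\<rho> x' x)) \<Longrightarrow> herm_on X \<rho>"
  unfolding herm_on_def by blast

lemma trace_mult_comm:
  fixes A B :: "complex mat"
  assumes "A \<in> carrier_mat n n" "B \<in> carrier_mat n n"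
  shows "(\<Sum>i<n. (A * B) $$ (i, i)) = (\<Sum>i<n. (B * A) $$ (i, i))"
proof -
  have "(\<Sum>i<n. (A * B) $$ (i, i)) = (\<Sum>i<n. \<Sum>j<n. A $$ (i, j) * B $$ (j, i))"
    using assms by (auto simp: scalar_prod_def atLeast0LessThan intro!: sum.cong)
  also have "\<dots> = (\<Sum>j<n. \<Sum>i<n. B $$ (j, i) * A $$ (i, j))"
    by (subst sum.swap) (simp add: mult.commute)
  also have "\<dots> = (\<Sum>i<n. (B * A) $$ (i, i))"
    using assms by (auto simp: scalar_prod_def atLeast0LessThan intro!: sum.cong)
  finally show ?thesis .
qed

text \<open>If all eigenvalues vanished, then A^2 would have trace 0 by Schur triangularisation, but tr(A^2) is the sum of the |A_{ij}|^2.\<close>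
lemma nonzero_eigenvalue:
  fixes A :: "complex mat"
  assumes A: "A \<in> carrier_mat n n"
    and herm: "\<And>i j. i < n \<Longrightarrow> j < n \<Longrightarrow> A $$ (j, i) = cnj (A $$ (i, j))"
    and nz: "a < n" "b < n" "A $$ (a, b) \<noteq> 0"
  shows "\<exists>e. e \<noteq> 0 \<and> eigenvalue A e"
proof (rule ccontr)
  assume no: "\<not> ?thesis"
  obtain es where es: "char_poly A = (\<Prod>a\<leftarrow>es. [:- a, 1:])"
    using char_poly_factorized[OF A] by blast
  obtain B where B: "B \<in> carrier_mat n n" "upper_triangular B" and sim: "similar_mat A B"
    using schur_decomposition_exists[OF A es] by blast
  obtain P Q where "similar_mat_wit A B P Q" using sim unfolding similar_mat_def by blast
  from similar_mat_witD2[OF A this] have PQ: "Q * P = 1\<^sub>m n" "A = P * B * Q"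
    and carr: "P \<in> carrier_mat n n" "Q \<in> carrier_mat n n" by auto
  have diag: "B $$ (i, i) = 0" if "i < n" for i
  proof (rule ccontr)
    assume nz: "B $$ (i, i) \<noteq> 0"
    have "char_poly A = (\<Prod>a\<leftarrow>diag_mat B. [:- a, 1:])"
      using char_poly_similar[OF sim] char_poly_upper_triangular[OF B] by simp
    moreover have "B $$ (i, i) \<in> set (diag_mat B)"
      using that B by (auto simp: diag_mat_def)
    ultimately have "poly (char_poly A) (B $$ (i, i)) = 0"
      by (auto simp: poly_prod_list prod_list_zero_iff intro!: image_eqI)
    then show False using no nz eigenvalue_root_char_poly[OF A] by blast
  qed
  have BB: "(B * B) $$ (i, i) = 0" if i: "i < n" for i
  proof -
    have "(B * B) $$ (i, i) = (\<Sum>j\<in>{0..<n}. B $$ (i, j) * B $$ (j, i))"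
      using B i by (auto simp: scalar_prod_def intro!: sum.cong)
    also have "\<dots> = 0"
    proof (rule sum.neutral, rule ballI)
      fix j assume j: "j \<in> {0..<n}"
      consider "j < i" | "i < j" | "j = i" by linarith
      then show "B $$ (i, j) * B $$ (j, i) = 0"
        using upper_triangularD[OF B(2), of j i] upper_triangularD[OF B(2), of i j] B(1) i j diag
        by cases auto
    qed
    finally show ?thesis .
  qed
  define C where "C = B * Q"
  have C: "C \<in> carrier_mat n n" and BC: "B * C \<in> carrier_mat n n"
    using carr B by (simp_all add: C_def)
  have CP: "C * P = B"
    unfolding C_def assoc_mult_mat[OF B(1) carr(2) carr(1)] PQ(1) by (rule right_mult_one_mat[OF B(1)])
  have "A * A = P * C * (P * C)"
    unfolding PQ(2) C_def assoc_mult_mat[OF carr(1) B(1) carr(2)] ..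
  also have "\<dots> = P * (C * (P * C))"
    by (rule assoc_mult_mat[OF carr(1) C mult_carrier_mat[OF carr(1) C]])
  also have "C * (P * C) = B * C"
    unfolding assoc_mult_mat[OF C carr(1) C, symmetric] CP ..
  finally have AA: "A * A = P * (B * C)" .
  have "(\<Sum>i<n. (A * A) $$ (i, i)) = (\<Sum>i<n. (B * C * P) $$ (i, i))"
    unfolding AA by (rule trace_mult_comm[OF carr(1) BC])
  also have "B * C * P = B * B"
    unfolding assoc_mult_mat[OF B(1) C carr(1)] CP ..
  finally have tr0: "(\<Sum>i<n. (A * A) $$ (i, i)) = 0" using BB by simp
  have "(A * A) $$ (i, i) = of_real (\<Sum>j<n. (cmod (A $$ (i, j)))\<^sup>2)" if "i < n" for i
  proof -
    have "(A * A) $$ (i, i) = (\<Sum>j<n. A $$ (i, j) * A $$ (j, i))"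
      using A that by (auto simp: scalar_prod_def atLeast0LessThan intro!: sum.cong)
    also have "\<dots> = (\<Sum>j<n. of_real ((cmod (A $$ (i, j)))\<^sup>2))"
      by (intro sum.cong refl) (metis cmod2 herm that lessThan_iff mult.commute)
    finally show ?thesis by simp
  qed
  with tr0 have "of_real (\<Sum>i<n. \<Sum>j<n. (cmod (A $$ (i, j)))\<^sup>2) = (0 :: complex)"
    by simp
  then have "(\<Sum>i<n. \<Sum>j<n. (cmod (A $$ (i, j)))\<^sup>2) = 0"
    by (simp only: of_real_eq_0_iff)
  then have "\<forall>i<n. (\<Sum>j<n. (cmod (A $$ (i, j)))\<^sup>2) = 0"
    by (subst (asm) sum_nonneg_eq_0_iff) (auto intro: sum_nonneg)
  with nz(1) have "(\<Sum>j<n. (cmod (A $$ (a, j)))\<^sup>2) = 0" by blast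
  then have "\<forall>j<n. (cmod (A $$ (a, j)))\<^sup>2 = 0"
    by (subst (asm) sum_nonneg_eq_0_iff) auto
  with nz show False by simp
qed

lemma hermitian_ip:
  assumes "herm_on X \<rho>"
  shows "ip_on X f (op_app X \<rho> g) = ip_on X (op_app X \<rho> f) g"
proof -
  have "ip_on X f (op_app X \<rho> g) = ip_on X (op_app X (op_adj \<rho>) f) g" by (rule ip_on_op_app)
  also have "\<dots> = ip_on X (op_app X \<rho> f) g"
    by (intro ip_on_cong) (auto simp: op_app_def op_adj_def herm_onD[OF assms] intro!: sum.cong)
  finally show ?thesis .
qed

lemma herm_eigenvalue_real:
  assumes "herm_on X \<rho>" "\<And>x. x \<in> X \<Longrightarrow> op_app X \<rho> v x = e * v x" "norm_sq X v \<noteq> 0"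
  shows "e = of_real (Re e)"
proof -
  have 1: "ip_on X v (op_app X \<rho> v) = e * of_real (norm_sq X v)"
    using assms(2) by (simp add: ip_on_self[symmetric] ip_on_scale_right[symmetric] cong: ip_on_cong)
  have "cnj (ip_on X v (op_app X \<rho> v)) = ip_on X v (op_app X \<rho> v)"
    unfolding cnj_ip_on hermitian_ip[OF assms(1)] ..
  then have "cnj e = e" using assms(3) unfolding 1 by simp
  then show ?thesis by (simp add: complex_eq_iff)
qed

lemma herm_nonzero_eigenvector:
  assumes fin: "finite X" and herm: "herm_on X \<rho>" and nz: "x0 \<in> X" "x1 \<in> X" "\<rho> x0 x1 \<noteq> 0"
  shows "\<exists>v e. e \<noteq> 0 \<and> norm_sq X v = 1 \<and> (\<forall>x\<in>X. op_app X \<rho> v x = of_real e * v x)"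
proof -
  define n where "n = card X"
  define e where "e = enum_of X"
  have be: "bij_betw e {0..<n} X"
    using bij_enum_of[OF fin] by (simp only: e_def n_def atLeast0LessThan)
  define d where "d = inv_into {0..<n} e"
  have ed: "e (d x) = x" "d x < n" if "x \<in> X" for x
    using bij_betw_inv_into_right[OF be that] bij_betwE[OF bij_betw_inv_into[OF be]] that
    by (auto simp: d_def)
  have de: "d (e a) = a" if "a < n" for a
    using bij_betw_inv_into_left[OF be] that by (auto simp: d_def)
  have eX: "e a \<in> X" if "a < n" for a using bij_betwE[OF be] that by auto
  define A where "A = mat_of_qop X \<rho>"
  have A: "A \<in> carrier_mat n n" and Aij: "\<And>i j. i < n \<Longrightarrow> j < n \<Longrightarrow> A $$ (i, j) = \<rho> (e i) (e j)"
    by (auto simp: A_def mat_of_qop_def n_def e_def)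
  have "\<exists>l. l \<noteq> 0 \<and> eigenvalue A l"
    by (rule nonzero_eigenvalue[OF A, of "d x0" "d x1"])
       (use ed nz in \<open>simp_all add: Aij eX herm_onD[OF herm]\<close>)
  then obtain l w where l: "l \<noteq> 0" and w: "w \<in> carrier_vec n" "w \<noteq> 0\<^sub>v n" "A *\<^sub>v w = l \<cdot>\<^sub>v w"
    using A unfolding eigenvalue_def eigenvector_def by auto
  define v where "v = (\<lambda>x. w $ d x)"
  have ev: "op_app X \<rho> v x = l * v x" if x: "x \<in> X" for x
  proof -
    have "op_app X \<rho> v x = (\<Sum>j\<in>{0..<n}. \<rho> x (e j) * v (e j))"
      unfolding op_app_def by (rule sum.reindex_bij_betw[OF be, symmetric])
    also have "\<dots> = (\<Sum>j\<in>{0..<n}. A $$ (d x, j) * w $ j)"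
      by (intro sum.cong refl) (use ed[OF x] de Aij in \<open>auto simp: v_def\<close>)
    also have "\<dots> = (A *\<^sub>v w) $ d x"
      using A w(1) ed[OF x] by (auto simp: scalar_prod_def intro!: sum.cong)
    also have "\<dots> = l * v x" unfolding w(3) using w(1) ed[OF x] by (simp add: v_def)
    finally show ?thesis .
  qed
  have nv: "norm_sq X v \<noteq> 0"
  proof
    assume "norm_sq X v = 0"
    then have v0: "\<forall>x\<in>X. v x = 0" using norm_sq_eq_0[OF fin] by blast
    have "w = 0\<^sub>v n"
    proof (rule eq_vecI)
      fix i assume "i < dim_vec (0\<^sub>v n :: complex vec)"
      then have i: "i < n" by simp
      then show "w $ i = 0\<^sub>v n $ i" using v0 eX[OF i] de[OF i] by (auto simp: v_def)
    qed (use w in simp)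
    with w(2) show False by simp
  qed
  define c where "c = 1 / sqrt (norm_sq X v)"
  have lr: "l = of_real (Re l)" by (rule herm_eigenvalue_real[OF herm ev nv])
  have "norm_sq X (\<lambda>x. of_real c * v x) = c\<^sup>2 * norm_sq X v"
    by (simp add: norm_sq_def norm_mult power_mult_distrib sum_distrib_left)
  also have "\<dots> = 1" using nv norm_sq_nonneg[of X v] by (simp add: c_def power_divide)
  finally have "norm_sq X (\<lambda>x. of_real c * v x) = 1" .
  moreover have "op_app X \<rho> (\<lambda>x. of_real c * v x) x = of_real (Re l) * (of_real c * v x)" if "x \<in> X" for x
  proof -
    have "op_app X \<rho> (\<lambda>x. of_real c * v x) x = of_real c * op_app X \<rho> v x"
      by (simp add: op_app_def sum_distrib_left mult_ac)
    also have "\<dots> = of_real c * (of_real (Re l) * v x)" using ev[OF that] lr by simp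
    finally show ?thesis by (simp add: mult_ac)
  qed
  moreover have "Re l \<noteq> 0" using l lr by (metis of_real_0)
  ultimately show ?thesis by blast
qed

text \<open>A maximal orthonormal family of eigenvectors is complete: otherwise the deflated operator \<open>\<tau>\<close> yields one more eigenvector orthogonal to all of them.\<close>
lemma hermitian_spectral:
  assumes fin: "finite X" and herm: "herm_on X \<rho>"
  shows "\<exists>(I :: nat set) u p. spectral X I u p \<rho>"
proof -
  define F where "F = (\<lambda>m (u :: nat \<Rightarrow> 'a \<Rightarrow> complex) (p :: nat \<Rightarrow> real). orthonormal X {..<m} u \<and>
     (\<forall>i<m. \<forall>x\<in>X. op_app X \<rho> (u i) x = of_real (p i) * u i x))"
  have F0: "\<exists>u p. F 0 u p" using fin by (auto simp: F_def orthonormal_def)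
  have Fb: "m \<le> card X" if "\<exists>u p. F m u p" for m
    using that orthonormal_card_le[of X "{..<m}"] by (auto simp: F_def)
  define G where "G = (\<lambda>m. \<exists>u p. F m u p)"
  have "\<exists>m. G m \<and> (\<forall>m'. G m' \<longrightarrow> m' \<le> m)"
    by (rule ex_has_greatest_nat[of G 0 "\<lambda>m. m" "Suc (card X)"])
      (use F0 Fb in \<open>auto simp: G_def less_Suc_eq_le\<close>)
  then obtain m where m: "G m" and max: "\<And>m'. G m' \<Longrightarrow> m' \<le> m" by blast
  obtain u p where F: "F m u p" using m unfolding G_def by blast
  then have on: "orthonormal X {..<m} u" and eig: "\<And>i x. i < m \<Longrightarrow> x \<in> X \<Longrightarrow> op_app X \<rho> (u i) x = of_real (p i) * u i x"
    unfolding F_def by blast+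
  have ext: False if v: "norm_sq X v = 1" "\<And>i. i < m \<Longrightarrow> ip_on X (u i) v = 0"
    "\<And>x. x \<in> X \<Longrightarrow> op_app X \<rho> v x = of_real e * v x" for v and e :: real
  proof -
    have "ip_on X v v = 1" using v(1) by (simp add: ip_on_self)
    moreover have "ip_on X v (u i) = 0" if "i < m" for i
      using v(2)[OF that] cnj_ip_on[of X "u i" v] by simp
    ultimately have "orthonormal X {..<Suc m} (u(m := v))"
      using on v(2) by (auto simp: orthonormal_def less_Suc_eq)
    then have "F (Suc m) (u(m := v)) (p(m := e))"
      using eig v(3) by (auto simp: F_def less_Suc_eq)
    then have "G (Suc m)" unfolding G_def by blast
    then show False using max[of "Suc m"] by simp
  qed
  have fam: "ip_on X (u i) (u j) = (if i = j then 1 else 0)" if "i < m" "j < m" for i j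
    using on that by (auto simp: orthonormal_def)
  define \<tau> where "\<tau> = (\<lambda>x x'. \<rho> x x' - (\<Sum>i<m. of_real (p i) * u i x * cnj (u i x')))"
  have app_\<tau>: "op_app X \<tau> v x = op_app X \<rho> v x - (\<Sum>i<m. of_real (p i) * ip_on X (u i) v * u i x)" for v x
  proof -
    have "op_app X \<tau> v x = op_app X \<rho> v x - (\<Sum>x'\<in>X. \<Sum>i<m. of_real (p i) * u i x * cnj (u i x') * v x')"
      by (simp add: op_app_def \<tau>_def left_diff_distrib sum_subtractf sum_distrib_right)
    also have "(\<Sum>x'\<in>X. \<Sum>i<m. of_real (p i) * u i x * cnj (u i x') * v x')
        = (\<Sum>i<m. of_real (p i) * ip_on X (u i) v * u i x)"
      by (subst sum.swap) (simp add: ip_on_def sum_distrib_left sum_distrib_right mult_ac)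
    finally show ?thesis .
  qed
  have herm_\<tau>: "herm_on X \<tau>"
    by (rule herm_onI) (simp add: \<tau>_def herm_onD[OF herm], simp add: mult_ac)
  have \<tau>u: "op_app X \<tau> (u i) x = 0" if "i < m" "x \<in> X" for i x
  proof -
    have "op_app X \<tau> (u i) x = of_real (p i) * u i x - (\<Sum>j<m. (of_real (p j) * u j x) * (if j = i then 1 else 0))"
      unfolding app_\<tau> eig[OF that] by (intro arg_cong2[of _ _ _ _ minus] refl sum.cong) (use that fam in auto)
    then show ?thesis using that by (simp add: sum_delta_mult)
  qed
  have \<tau>0: "\<tau> x x' = 0" if xx: "x \<in> X" "x' \<in> X" for x x'
  proof (rule ccontr)
    assume "\<tau> x x' \<noteq> 0"
    from herm_nonzero_eigenvector[OF fin herm_\<tau> xx this] obtain v e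
      where v: "e \<noteq> 0" "norm_sq X v = 1" "\<And>x. x \<in> X \<Longrightarrow> op_app X \<tau> v x = of_real e * v x" by blast
    have orth: "ip_on X (u i) v = 0" if "i < m" for i
    proof -
      have "of_real e * ip_on X (u i) v = ip_on X (u i) (op_app X \<tau> v)"
        using v(3) by (simp add: ip_on_scale_right[symmetric] cong: ip_on_cong)
      also have "\<dots> = ip_on X (op_app X \<tau> (u i)) v" by (rule hermitian_ip[OF herm_\<tau>])
      also have "\<dots> = 0" using \<tau>u[OF that] by (simp add: ip_on_def)
      finally show ?thesis using v(1) by simp
    qed
    show False
      by (rule ext[OF v(2) orth, of e]) (use v(3) orth in \<open>auto simp: app_\<tau>\<close>)
  qed
  have complete: "(\<Sum>i<m. u i x * cnj (u i x')) = (if x = x' then 1 else 0)"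
    if xx: "x \<in> X" "x' \<in> X" for x x'
  proof -
    define w where "w = (\<lambda>x. (if x = x' then 1 else 0) - (\<Sum>i<m. u i x * cnj (u i x')))"
    have uw: "ip_on X (u i) w = 0" if "i < m" for i
    proof -
      have "ip_on X (u i) w = cnj (u i x') - ip_on X (u i) (\<lambda>x. \<Sum>j<m. cnj (u j x') * u j x)"
        unfolding w_def ip_on_diff_right by (simp add: ip_on_def sum_delta_mult fin xx mult_ac)
      also have "ip_on X (u i) (\<lambda>x. \<Sum>j<m. cnj (u j x') * u j x) = (\<Sum>j<m. cnj (u j x') * (if i = j then 1 else 0))"
        unfolding ip_on_sum_right ip_on_scale_right by (intro sum.cong refl) (use that fam in auto)
      finally show ?thesis using that by (simp add: sum_delta_mult)
    qed
    have "norm_sq X w = 0"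
    proof (rule ccontr)
      assume nw: "norm_sq X w \<noteq> 0"
      define c where "c = 1 / sqrt (norm_sq X w)"
      have "norm_sq X (\<lambda>x. of_real c * w x) = c\<^sup>2 * norm_sq X w"
        by (simp add: norm_sq_def norm_mult power_mult_distrib sum_distrib_left)
      also have "\<dots> = 1" using nw norm_sq_nonneg[of X w] by (simp add: c_def power_divide)
      finally have 1: "norm_sq X (\<lambda>x. of_real c * w x) = 1" .
      have 2: "ip_on X (u i) (\<lambda>x. of_real c * w x) = 0" if "i < m" for i
        by (simp add: ip_on_scale_right uw[OF that])
      have "op_app X \<tau> v x = 0" if "x \<in> X" for v x using \<tau>0 that by (simp add: op_app_def)
      then have "op_app X \<rho> (\<lambda>x. of_real c * w x) x = of_real 0 * (of_real c * w x)" if "x \<in> X" for x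
        using app_\<tau>[of "\<lambda>x. of_real c * w x" x] that 2 by simp
      from ext[OF 1 2 this] show False .
    qed
    then have "w x = 0" using norm_sq_eq_0[OF fin] xx by blast
    then show ?thesis by (simp add: w_def)
  qed
  have "spectral X {..<m} u p \<rho>"
    using on complete \<tau>0 by (simp add: spectral_def onb_def \<tau>_def)
  then show ?thesis by blast
qed

section \<open>Positive operators, Kraus maps and a variational formula\<close>

definition quad_form :: "'x set \<Rightarrow> 'x qop \<Rightarrow> ('x \<Rightarrow> complex) \<Rightarrow> complex" where
  "quad_form X \<rho> v = (\<Sum>z\<in>X. \<Sum>z'\<in>X. cnj (v z) * \<rho> z z' * v z')"

lemma psd_on_iff_quad_form: "psd_on X \<rho> \<longleftrightarrow> (\<forall>v. Im (quad_form X \<rho> v) = 0 \<and> Re (quad_form X \<rho> v) \<ge> 0)"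
  by (simp add: psd_on_def quad_form_def)

lemma quad_form_cong: "(\<And>x x'. x \<in> X \<Longrightarrow> x' \<in> X \<Longrightarrow> \<rho> x x' = \<rho>' x x') \<Longrightarrow> (\<And>x. x \<in> X \<Longrightarrow> v x = v' x) \<Longrightarrow> quad_form X \<rho> v = quad_form X \<rho>' v'"
  unfolding quad_form_def by (intro sum.cong refl) simp

definition psd_decomp :: "'x set \<Rightarrow> 'i set \<Rightarrow> ('i \<Rightarrow> 'x \<Rightarrow> complex) \<Rightarrow> ('i \<Rightarrow> real) \<Rightarrow> 'x qop \<Rightarrow> bool" where
  "psd_decomp X M s r \<rho> \<longleftrightarrow> finite M \<and> (\<forall>m\<in>M. r m \<ge> 0) \<and>
     (\<forall>x\<in>X. \<forall>x'\<in>X. \<rho> x x' = (\<Sum>m\<in>M. of_real (r m) * s m x * cnj (s m x')))"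

definition psd_eig :: "'x set \<Rightarrow> 'i set \<Rightarrow> ('i \<Rightarrow> 'x \<Rightarrow> complex) \<Rightarrow> ('i \<Rightarrow> real) \<Rightarrow> 'x qop \<Rightarrow> bool" where
  "psd_eig X I u p \<rho> \<longleftrightarrow> onb X I u \<and> psd_decomp X I u p \<rho>"

lemma psd_eig_spectral: "psd_eig X I u p \<rho> \<Longrightarrow> spectral X I u p \<rho>"
  unfolding psd_eig_def psd_decomp_def spectral_def by blast

lemma psd_eig_nonneg: "psd_eig X I u p \<rho> \<Longrightarrow> i \<in> I \<Longrightarrow> 0 \<le> p i"
  unfolding psd_eig_def psd_decomp_def by blast

lemma psd_decomp_eq:
  "psd_decomp X M s r \<rho> \<Longrightarrow> x \<in> X \<Longrightarrow> x' \<in> X \<Longrightarrow> \<rho> x x' = (\<Sum>m\<in>M. of_real (r m) * s m x * cnj (s m x'))"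
  unfolding psd_decomp_def by blast

lemma quad_form_decomp:
  assumes "psd_decomp X M s r \<rho>"
  shows "quad_form X \<rho> v = of_real (\<Sum>m\<in>M. r m * (cmod (ip_on X (s m) v))\<^sup>2)"
proof -
  have "quad_form X \<rho> v = (\<Sum>z\<in>X. \<Sum>z'\<in>X. \<Sum>m\<in>M. of_real (r m) * (cnj (v z) * s m z) * (cnj (s m z') * v z'))"
    unfolding quad_form_def
    by (intro sum.cong refl) (simp add: psd_decomp_eq[OF assms] sum_distrib_left sum_distrib_right mult_ac)
  also have "\<dots> = (\<Sum>m\<in>M. \<Sum>z\<in>X. \<Sum>z'\<in>X. of_real (r m) * (cnj (v z) * s m z) * (cnj (s m z') * v z'))"
    by (rule sum_rotate[symmetric])
  also have "\<dots> = (\<Sum>m\<in>M. of_real (r m) * (ip_on X v (s m) * ip_on X (s m) v))"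
    unfolding ip_on_def sum_product by (simp only: sum_distrib_left mult.assoc)
  also have "\<dots> = of_real (\<Sum>m\<in>M. r m * (cmod (ip_on X (s m) v))\<^sup>2)"
    by (simp add: cmod2[symmetric] cnj_ip_on[of X "s _" v, symmetric] del: of_real_power)
  finally show ?thesis .
qed

lemma psd_decomp_psd_on:
  assumes "psd_decomp X M s r \<rho>"
  shows "psd_on X \<rho>"
proof -
  have "0 \<le> r m" if "m \<in> M" for m using assms that unfolding psd_decomp_def by blast
  then show ?thesis
    unfolding psd_on_iff_quad_form quad_form_decomp[OF assms] by (auto intro!: sum_nonneg mult_nonneg_nonneg)
qed

lemma psd_on_hermitian:
  assumes fin: "finite X" and psd: "psd_on X \<rho>"
  shows "herm_on X \<rho>"
proof (rule herm_onI)
  fix a b assume ab: "a \<in> X" "b \<in> X"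
  have q: "quad_form X \<rho> (\<lambda>x. c * (if x = a then 1 else 0) + d * (if x = b then 1 else 0))
      = cnj c * c * \<rho> a a + cnj c * d * \<rho> a b + cnj d * c * \<rho> b a + cnj d * d * \<rho> b b" for c d
  proof -
    have "quad_form X \<rho> (\<lambda>x. c * (if x = a then 1 else 0) + d * (if x = b then 1 else 0)) =
      (\<Sum>z\<in>X. (\<Sum>z'\<in>X. (cnj c * \<rho> z z' * c * (if z' = a then 1 else 0) + cnj c * \<rho> z z' * d * (if z' = b then 1 else 0))) * (if z = a then 1 else 0)
        + (\<Sum>z'\<in>X. (cnj d * \<rho> z z' * c * (if z' = a then 1 else 0) + cnj d * \<rho> z z' * d * (if z' = b then 1 else 0))) * (if z = b then 1 else 0))"
      unfolding quad_form_def sum_distrib_right sum.distrib[symmetric]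
      by (intro sum.cong refl) (simp add: algebra_simps)
    also have "\<dots> = cnj c * c * \<rho> a a + cnj c * d * \<rho> a b + cnj d * c * \<rho> b a + cnj d * d * \<rho> b b"
      unfolding sum.distrib sum_delta_mult[OF fin] using ab by (simp add: mult_ac)
    finally show ?thesis .
  qed
  have im: "Im (cnj c * c * \<rho> a a + cnj c * d * \<rho> a b + cnj d * c * \<rho> b a + cnj d * d * \<rho> b b) = 0" for c d
    unfolding q[symmetric] using psd by (simp only: psd_on_iff_quad_form)
  have "Im (\<rho> a a) = 0" using im[of 1 0] by simp
  moreover have "Im (\<rho> b b) = 0" using im[of 0 1] by simp
  moreover have "Im (\<rho> a a + \<rho> a b + \<rho> b a + \<rho> b b) = 0" using im[of 1 1] by simp
  moreover have "Im (\<rho> a a + \<i> * \<rho> a b - \<i> * \<rho> b a + \<rho> b b) = 0" using im[of 1 \<i>] by simp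
  ultimately show "\<rho> a b = cnj (\<rho> b a)" by (simp add: complex_eq_iff)
qed

lemma psd_on_spectral:
  assumes fin: "finite X" and psd: "psd_on X \<rho>"
  obtains I :: "nat set" and u p where "psd_eig X I u p \<rho>"
proof -
  obtain I :: "nat set" and u p where sp: "spectral X I u p \<rho>"
    using hermitian_spectral[OF fin psd_on_hermitian[OF fin psd]] by blast
  have onb: "onb X I u" and eq: "\<forall>x\<in>X. \<forall>x'\<in>X. \<rho> x x' = (\<Sum>i\<in>I. of_real (p i) * u i x * cnj (u i x'))"
    using sp unfolding spectral_def by blast+
  have fI: "finite I" using onb_finite[OF onb] by blast
  have "0 \<le> p j" if j: "j \<in> I" for j
  proof -
    have "op_app X \<rho> (u j) x = of_real (p j) * u j x" if x: "x \<in> X" for x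
    proof -
      have "op_app X \<rho> (u j) x = (\<Sum>x'\<in>X. \<Sum>i\<in>I. of_real (p i) * u i x * (cnj (u i x') * u j x'))"
        unfolding op_app_def using eq x by (intro sum.cong refl) (simp add: sum_distrib_left sum_distrib_right mult_ac)
      also have "\<dots> = (\<Sum>i\<in>I. of_real (p i) * u i x * ip_on X (u i) (u j))"
        by (subst sum.swap) (simp add: ip_on_def sum_distrib_left)
      also have "\<dots> = (\<Sum>i\<in>I. of_real (p i) * u i x * (if i = j then 1 else 0))"
        using onb j by (intro sum.cong refl) (simp add: onb_def orthonormal_def)
      finally show ?thesis using j fI by (simp add: sum_delta_mult)
    qed
    then have "ip_on X (u j) (op_app X \<rho> (u j)) = of_real (p j) * ip_on X (u j) (u j)"
      by (simp add: ip_on_scale_right[symmetric] cong: ip_on_cong)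
    also have "\<dots> = of_real (p j)" using onb_norm_sq[OF onb j] by (simp add: ip_on_self)
    also have "ip_on X (u j) (op_app X \<rho> (u j)) = quad_form X \<rho> (u j)"
      by (simp add: ip_on_def op_app_def quad_form_def sum_distrib_left mult_ac)
    finally have "Re (quad_form X \<rho> (u j)) = p j" by simp
    then show ?thesis using psd by (metis psd_on_iff_quad_form)
  qed
  then have "psd_eig X I u p \<rho>" using onb eq fI unfolding psd_eig_def psd_decomp_def by blast
  then show ?thesis by (rule that)
qed

lemma psd_eig_trace:
  assumes "psd_eig X I u p \<rho>"
  shows "of_real (\<Sum>i\<in>I. p i) = (\<Sum>x\<in>X. \<rho> x x)"
proof -
  have dc: "psd_decomp X I u p \<rho>" and onb: "onb X I u" using assms by (auto simp: psd_eig_def)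
  have "(\<Sum>x\<in>X. \<rho> x x) = (\<Sum>x\<in>X. \<Sum>i\<in>I. of_real (p i) * (cnj (u i x) * u i x))"
    by (intro sum.cong refl) (simp add: psd_decomp_eq[OF dc] mult_ac)
  also have "\<dots> = (\<Sum>i\<in>I. of_real (p i) * ip_on X (u i) (u i))"
    by (subst sum.swap) (simp add: ip_on_def sum_distrib_left)
  also have "\<dots> = (\<Sum>i\<in>I. of_real (p i))"
    by (intro sum.cong refl) (simp add: ip_on_self onb_norm_sq[OF onb])
  finally show ?thesis by simp
qed

definition lin_term :: "'x set \<Rightarrow> 'x qop \<Rightarrow> 'x qop \<Rightarrow> complex" where
  "lin_term X \<rho> W = (\<Sum>x\<in>X. \<Sum>x'\<in>X. cnj (W x x') * \<rho> x x')"

definition quad_term :: "'x set \<Rightarrow> 'x qop \<Rightarrow> 'x qop \<Rightarrow> real" where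
  "quad_term X \<sigma> W = (\<Sum>z\<in>X. Re (quad_form X \<sigma> (\<lambda>x. W x z)))"

text \<open>In operator terms \<open>var_fun\<close> is 2 Re tr(W* \<rho>) - tr(W* \<sigma> W) - t tr(W \<rho> W*).  Its maximum over W is the quadratic form of the inverse of (left multiplication by \<open>\<sigma>\<close> + t right multiplication by \<open>\<rho>\<close>) at \<open>\<rho>\<close>, which in eigenbases is \<open>resolvent_sum\<close> below.\<close>
definition var_fun :: "'x set \<Rightarrow> 'x qop \<Rightarrow> 'x qop \<Rightarrow> real \<Rightarrow> 'x qop \<Rightarrow> real" where
  "var_fun X \<rho> \<sigma> t W = 2 * Re (lin_term X \<rho> W) - quad_term X \<sigma> W - t * quad_term X \<rho> (op_adj W)"

lemma lin_term_decomp: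
  assumes "psd_decomp X M s r \<rho>"
  shows "lin_term X \<rho> W = (\<Sum>m\<in>M. of_real (r m) * ip_on X (op_app X W (s m)) (s m))"
proof -
  have "lin_term X \<rho> W = (\<Sum>x\<in>X. \<Sum>x'\<in>X. \<Sum>m\<in>M. of_real (r m) * (cnj (W x x' * s m x') * s m x))"
    unfolding lin_term_def
    by (intro sum.cong refl) (simp add: psd_decomp_eq[OF assms] sum_distrib_left mult_ac)
  also have "\<dots> = (\<Sum>m\<in>M. \<Sum>x\<in>X. \<Sum>x'\<in>X. of_real (r m) * (cnj (W x x' * s m x') * s m x))"
    by (rule sum_rotate[symmetric])
  also have "\<dots> = (\<Sum>m\<in>M. of_real (r m) * ip_on X (op_app X W (s m)) (s m))"
    by (simp add: ip_on_def op_app_def sum_distrib_left sum_distrib_right)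
  finally show ?thesis .
qed

lemma quad_term_decomp:
  assumes "psd_decomp X M s r \<rho>"
  shows "quad_term X \<rho> W = (\<Sum>m\<in>M. r m * norm_sq X (op_app X (op_adj W) (s m)))"
proof -
  have "cmod (ip_on X (s m) (\<lambda>x. W x z)) = cmod (op_app X (op_adj W) (s m) z)" for m z
    unfolding cnj_ip_on[of X "\<lambda>x. W x z" "s m", symmetric] complex_mod_cnj
    by (simp add: ip_on_def op_app_def op_adj_def)
  then have "quad_term X \<rho> W = (\<Sum>z\<in>X. \<Sum>m\<in>M. r m * (cmod (op_app X (op_adj W) (s m) z))\<^sup>2)"
    unfolding quad_term_def quad_form_decomp[OF assms] by simp
  also have "\<dots> = (\<Sum>m\<in>M. r m * norm_sq X (op_app X (op_adj W) (s m)))"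
    by (subst sum.swap) (simp add: norm_sq_def sum_distrib_left)
  finally show ?thesis .
qed

definition resolvent_sum :: "'x set \<Rightarrow> 'i set \<Rightarrow> ('i \<Rightarrow> 'x \<Rightarrow> complex) \<Rightarrow> ('i \<Rightarrow> real) \<Rightarrow>
    'j set \<Rightarrow> ('j \<Rightarrow> 'x \<Rightarrow> complex) \<Rightarrow> ('j \<Rightarrow> real) \<Rightarrow> real \<Rightarrow> real" where
  "resolvent_sum X I u p J v q t = (\<Sum>j\<in>J. \<Sum>i\<in>I. (cmod (ip_on X (v j) (u i)))\<^sup>2 * (p i)\<^sup>2 / (q j + t * p i))"

text \<open>The support of the first operator is contained in that of the second.\<close>
definition supp_le :: "'x set \<Rightarrow> 'i set \<Rightarrow> ('i \<Rightarrow> 'x \<Rightarrow> complex) \<Rightarrow> ('i \<Rightarrow> real) \<Rightarrow>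
    'j set \<Rightarrow> ('j \<Rightarrow> 'x \<Rightarrow> complex) \<Rightarrow> ('j \<Rightarrow> real) \<Rightarrow> bool" where
  "supp_le X I u p J v q \<longleftrightarrow> (\<forall>j\<in>J. \<forall>i\<in>I. q j = 0 \<longrightarrow> ip_on X (v j) (u i) = 0 \<or> p i = 0)"

lemma var_fun_expand:
  assumes "psd_eig X I u p \<rho>" "psd_eig X J v q \<sigma>"
  defines "w \<equiv> \<lambda>W j i. ip_on X (v j) (op_app X W (u i))"
  shows "var_fun X \<rho> \<sigma> t W = (\<Sum>j\<in>J. \<Sum>i\<in>I. 2 * p i * Re (cnj (w W j i) * ip_on X (v j) (u i))
            - (q j + t * p i) * (cmod (w W j i))\<^sup>2)"
proof -
  have bu: "onb X I u" "onb X J v" and dr: "psd_decomp X I u p \<rho>" "psd_decomp X J v q \<sigma>"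
    using assms by (auto simp: psd_eig_def)
  have "lin_term X \<rho> W = (\<Sum>i\<in>I. \<Sum>j\<in>J. of_real (p i) * (cnj (w W j i) * ip_on X (v j) (u i)))"
    unfolding lin_term_decomp[OF dr(1)] w_def cnj_ip_on
    by (simp only: parseval[OF bu(2)] sum_distrib_left[symmetric])
  then have 1: "2 * Re (lin_term X \<rho> W) = (\<Sum>j\<in>J. \<Sum>i\<in>I. 2 * p i * Re (cnj (w W j i) * ip_on X (v j) (u i)))"
    by (subst sum.swap) (simp add: sum_distrib_left mult_ac)
  have "cmod (ip_on X (u i) (op_app X (op_adj W) (v j))) = cmod (w W j i)" for i j
    unfolding w_def ip_on_op_app[of X "u i"] op_adj_op_adj by (metis cnj_ip_on complex_mod_cnj)
  then have 2: "quad_term X \<sigma> W = (\<Sum>j\<in>J. \<Sum>i\<in>I. q j * (cmod (w W j i))\<^sup>2)"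
    unfolding quad_term_decomp[OF dr(2)] norm_sq_onb[OF bu(1)] sum_distrib_left by simp
  have 3: "t * quad_term X \<rho> (op_adj W) = (\<Sum>j\<in>J. \<Sum>i\<in>I. t * p i * (cmod (w W j i))\<^sup>2)"
    unfolding quad_term_decomp[OF dr(1)] op_adj_op_adj norm_sq_onb[OF bu(2)] w_def sum_distrib_left
    by (subst sum.swap) (simp add: mult_ac)
  show ?thesis
    unfolding var_fun_def 1 2 3 sum_subtractf[symmetric] by (simp add: algebra_simps)
qed

lemma var_fun_le_resolvent_sum:
  assumes r: "psd_eig X I u p \<rho>" "psd_eig X J v q \<sigma>" and sp: "supp_le X I u p J v q" and t: "t \<ge> 0"
  shows "var_fun X \<rho> \<sigma> t W \<le> resolvent_sum X I u p J v q t"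
  unfolding var_fun_expand[OF r] resolvent_sum_def
proof (intro sum_mono)
  fix j i assume j: "j \<in> J" and i: "i \<in> I"
  define w c A where "w = ip_on X (v j) (op_app X W (u i))" and "c = ip_on X (v j) (u i)" and "A = q j + t * p i"
  have nn: "0 \<le> p i" "0 \<le> q j" using psd_eig_nonneg[OF r(1) i] psd_eig_nonneg[OF r(2) j] .
  then have A0: "A \<ge> 0" using t by (simp add: A_def)
  have "2 * p i * Re (cnj w * c) - A * (cmod w)\<^sup>2 \<le> (cmod c)\<^sup>2 * (p i)\<^sup>2 / A"
  proof (cases "A = 0")
    case True
    then have "q j = 0" using nn t by (simp add: A_def add_nonneg_eq_0_iff)
    then have "c = 0 \<or> p i = 0" using sp i j by (simp add: supp_le_def c_def)
    then show ?thesis using True by auto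
  next
    case False
    then have Ap: "A > 0" using A0 by simp
    have "Re (cnj w * c) \<le> cmod w * cmod c"
      using complex_Re_le_cmod[of "cnj w * c"] by (simp add: norm_mult)
    then have "2 * p i * Re (cnj w * c) \<le> 2 * p i * (cmod w * cmod c)"
      using nn by (intro mult_left_mono) auto
    moreover have "2 * p i * (cmod w * cmod c) - A * (cmod w)\<^sup>2 \<le> (cmod c)\<^sup>2 * (p i)\<^sup>2 / A"
    proof -
      have "0 \<le> (A * cmod w - p i * cmod c)\<^sup>2" by simp
      then have "(2 * p i * (cmod w * cmod c) - A * (cmod w)\<^sup>2) * A \<le> (cmod c)\<^sup>2 * (p i)\<^sup>2"
        by (simp add: power2_eq_square algebra_simps)
      then show ?thesis using Ap by (simp add: pos_le_divide_eq)
    qed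
    ultimately show ?thesis by linarith
  qed
  then show "2 * p i * Re (cnj (ip_on X (v j) (op_app X W (u i))) * ip_on X (v j) (u i))
      - (q j + t * p i) * (cmod (ip_on X (v j) (op_app X W (u i))))\<^sup>2
      \<le> (cmod (ip_on X (v j) (u i)))\<^sup>2 * (p i)\<^sup>2 / (q j + t * p i)"
    by (simp only: w_def c_def A_def)
qed

lemma var_fun_attains_resolvent_sum:
  assumes r: "psd_eig X I u p \<rho>" "psd_eig X J v q \<sigma>"
  shows "\<exists>W. var_fun X \<rho> \<sigma> t W = resolvent_sum X I u p J v q t"
proof -
  have bu: "onb X I u" "onb X J v" using r by (auto simp: psd_eig_def)
  have fin: "finite I" "finite J" using onb_finite bu by blast+
  define a where "a = (\<lambda>j i. complex_of_real (p i / (q j + t * p i)) * ip_on X (v j) (u i))"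
  define W where "W = (\<lambda>x x'. \<Sum>j\<in>J. \<Sum>i\<in>I. a j i * v j x * cnj (u i x'))"
  have w: "ip_on X (v j) (op_app X W (u i)) = a j i" if j: "j \<in> J" and i: "i \<in> I" for i j
  proof -
    have "op_app X W (u i) = (\<lambda>x. \<Sum>j\<in>J. a j i * v j x)"
    proof
      fix x
      have "op_app X W (u i) x = (\<Sum>j\<in>J. \<Sum>x'\<in>X. \<Sum>k\<in>I. a j k * v j x * (cnj (u k x') * u i x'))"
        unfolding op_app_def W_def sum_distrib_right by (subst sum.swap) (simp add: mult_ac)
      also have "\<dots> = (\<Sum>j\<in>J. \<Sum>k\<in>I. a j k * v j x * ip_on X (u k) (u i))"
        unfolding ip_on_def sum_distrib_left by (intro sum.cong refl sum.swap)
      also have "\<dots> = (\<Sum>j\<in>J. \<Sum>k\<in>I. a j k * v j x * (if k = i then 1 else 0))"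
        using bu(1) i by (intro sum.cong refl) (simp add: onb_def orthonormal_def)
      finally show "op_app X W (u i) x = (\<Sum>j\<in>J. a j i * v j x)" using i fin by (simp add: sum_delta_mult)
    qed
    then have "ip_on X (v j) (op_app X W (u i)) = (\<Sum>l\<in>J. a l i * ip_on X (v j) (v l))"
      by (simp add: ip_on_sum_right ip_on_scale_right)
    also have "\<dots> = (\<Sum>l\<in>J. a l i * (if j = l then 1 else 0))"
      using bu(2) j by (intro sum.cong refl) (simp add: onb_def orthonormal_def)
    finally show ?thesis using j fin by (simp add: sum_delta_mult)
  qed
  have "2 * p i * Re (cnj (a j i) * ip_on X (v j) (u i)) - (q j + t * p i) * (cmod (a j i))\<^sup>2
      = (cmod (ip_on X (v j) (u i)))\<^sup>2 * (p i)\<^sup>2 / (q j + t * p i)" for i j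
  proof -
    define c A where "c = ip_on X (v j) (u i)" and "A = q j + t * p i"
    have "cnj (a j i) * c = of_real (p i / A * (cmod c)\<^sup>2)"
      unfolding a_def c_def[symmetric] A_def[symmetric] of_real_mult cmod2 by (simp add: mult_ac)
    then have 1: "Re (cnj (a j i) * c) = p i / A * (cmod c)\<^sup>2" by (metis Re_complex_of_real)
    have 2: "(cmod (a j i))\<^sup>2 = (p i / A)\<^sup>2 * (cmod c)\<^sup>2"
      unfolding a_def c_def[symmetric] A_def[symmetric] norm_mult power_mult_distrib norm_of_real by (simp add: power_divide)
    show ?thesis unfolding c_def[symmetric] A_def[symmetric] 1 2
      by (cases "A = 0") (simp_all add: field_simps power2_eq_square)
  qed
  then have "var_fun X \<rho> \<sigma> t W = resolvent_sum X I u p J v q t"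
    unfolding var_fun_expand[OF r] resolvent_sum_def by (intro sum.cong refl) (simp only: w)
  then show ?thesis by (intro exI[of _ W])
qed

definition kraus_map :: "'x set \<Rightarrow> 'e set \<Rightarrow> ('e \<Rightarrow> 'y \<Rightarrow> 'x \<Rightarrow> complex) \<Rightarrow> 'x qop \<Rightarrow> 'y qop" where
  "kraus_map X E K \<rho> = (\<lambda>y y'. \<Sum>e\<in>E. \<Sum>x\<in>X. \<Sum>x'\<in>X. K e y x * \<rho> x x' * cnj (K e y' x'))"

definition kraus_tp :: "'x set \<Rightarrow> 'y set \<Rightarrow> 'e set \<Rightarrow> ('e \<Rightarrow> 'y \<Rightarrow> 'x \<Rightarrow> complex) \<Rightarrow> bool" where
  "kraus_tp X Y E K \<longleftrightarrow> (\<forall>x\<in>X. \<forall>x'\<in>X. (\<Sum>e\<in>E. \<Sum>y\<in>Y. cnj (K e y x) * K e y x') = (if x = x' then 1 else 0))"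

lemma kraus_ip:
  assumes "kraus_tp X Y E K" "finite X"
  shows "(\<Sum>e\<in>E. ip_on Y (op_app X (K e) f) (op_app X (K e) g)) = ip_on X f g"
proof -
  have "(\<Sum>e\<in>E. ip_on Y (op_app X (K e) f) (op_app X (K e) g))
      = (\<Sum>e\<in>E. \<Sum>y\<in>Y. \<Sum>x\<in>X. \<Sum>x'\<in>X. (cnj (f x) * g x') * (cnj (K e y x) * K e y x'))"
    unfolding ip_on_def op_app_def cnj_sum sum_product by (simp add: mult_ac)
  also have "\<dots> = (\<Sum>e\<in>E. \<Sum>x\<in>X. \<Sum>x'\<in>X. \<Sum>y\<in>Y. (cnj (f x) * g x') * (cnj (K e y x) * K e y x'))"
    by (intro sum.cong[OF refl] sum_rotate)
  also have "\<dots> = (\<Sum>x\<in>X. \<Sum>x'\<in>X. \<Sum>e\<in>E. \<Sum>y\<in>Y. (cnj (f x) * g x') * (cnj (K e y x) * K e y x'))"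
    by (rule sum_rotate)
  also have "\<dots> = (\<Sum>x\<in>X. \<Sum>x'\<in>X. (cnj (f x) * g x') * (if x = x' then 1 else 0))"
    using assms unfolding sum_distrib_left[symmetric] kraus_tp_def by simp
  also have "\<dots> = ip_on X f g" using assms(2) by (simp add: sum_delta_mult ip_on_def)
  finally show ?thesis .
qed

text \<open>The Stinespring operator of a trace-preserving map is an isometry, so its adjoint is a contraction.\<close>
lemma kraus_adj_contraction:
  assumes tp: "kraus_tp X Y E K" and fin: "finite X"
  shows "norm_sq X (\<lambda>x. \<Sum>e\<in>E. op_app Y (op_adj (K e)) (h e) x) \<le> (\<Sum>e\<in>E. norm_sq Y (h e))"
proof -
  define f where "f = (\<lambda>x. \<Sum>e\<in>E. op_app Y (op_adj (K e)) (h e) x)"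
  have amgm: "2 * Re (ip_on Y a b) \<le> norm_sq Y a + norm_sq Y b" for a b :: "'b \<Rightarrow> complex"
  proof -
    have "2 * Re (cnj x * y) \<le> (cmod x)\<^sup>2 + (cmod y)\<^sup>2" for x y
    proof -
      have "0 \<le> (Re x - Re y)\<^sup>2 + (Im x - Im y)\<^sup>2" by simp
      then show ?thesis unfolding cmod_power2 by (simp add: power2_eq_square algebra_simps)
    qed
    then show ?thesis unfolding ip_on_def norm_sq_def Re_sum sum_distrib_left sum.distrib[symmetric] by (intro sum_mono)
  qed
  have "(\<Sum>e\<in>E. norm_sq Y (op_app X (K e) f)) = norm_sq X f"
  proof -
    have "complex_of_real (\<Sum>e\<in>E. norm_sq Y (op_app X (K e) f)) = of_real (norm_sq X f)"
      using kraus_ip[OF tp fin, of f f] by (simp add: ip_on_self)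
    then show ?thesis by (simp only: of_real_eq_iff)
  qed
  moreover have "complex_of_real (norm_sq X f) = (\<Sum>e\<in>E. ip_on Y (op_app X (K e) f) (h e))"
  proof -
    have "complex_of_real (norm_sq X f) = ip_on X f (\<lambda>x. \<Sum>e\<in>E. op_app Y (op_adj (K e)) (h e) x)"
      by (simp add: ip_on_self[symmetric] f_def)
    also have "\<dots> = (\<Sum>e\<in>E. ip_on Y (op_app X (K e) f) (h e))"
      unfolding ip_on_sum_right by (simp add: ip_on_op_app[of X f])
    finally show ?thesis .
  qed
  then have "norm_sq X f = Re (\<Sum>e\<in>E. ip_on Y (op_app X (K e) f) (h e))" by (metis Re_complex_of_real)
  moreover have "2 * Re (\<Sum>e\<in>E. ip_on Y (op_app X (K e) f) (h e)) \<le> (\<Sum>e\<in>E. norm_sq Y (op_app X (K e) f)) + (\<Sum>e\<in>E. norm_sq Y (h e))"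
    unfolding Re_sum sum_distrib_left sum.distrib[symmetric] by (intro sum_mono amgm)
  ultimately have "norm_sq X f \<le> (\<Sum>e\<in>E. norm_sq Y (h e))" by linarith
  then show ?thesis by (simp add: f_def)
qed

lemma kraus_map_decomp:
  assumes "psd_decomp X I u p \<rho>" "finite E"
  shows "psd_decomp Y (I \<times> E) (\<lambda>(i, e). op_app X (K e) (u i)) (\<lambda>(i, e). p i) (kraus_map X E K \<rho>)"
proof -
  have "kraus_map X E K \<rho> y y' = (\<Sum>(i, e)\<in>I \<times> E. of_real (p i) * op_app X (K e) (u i) y * cnj (op_app X (K e) (u i) y'))" for y y'
  proof -
    have "kraus_map X E K \<rho> y y' = (\<Sum>e\<in>E. \<Sum>x\<in>X. \<Sum>x'\<in>X. \<Sum>i\<in>I. of_real (p i) * ((K e y x * u i x) * cnj (K e y' x' * u i x')))"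
      unfolding kraus_map_def
      by (intro sum.cong refl) (simp add: psd_decomp_eq[OF assms(1)] sum_distrib_left sum_distrib_right mult_ac)
    also have "\<dots> = (\<Sum>e\<in>E. \<Sum>i\<in>I. \<Sum>x\<in>X. \<Sum>x'\<in>X. of_real (p i) * ((K e y x * u i x) * cnj (K e y' x' * u i x')))"
      by (intro sum.cong[OF refl] sum_rotate[symmetric])
    also have "\<dots> = (\<Sum>i\<in>I. \<Sum>e\<in>E. \<Sum>x\<in>X. \<Sum>x'\<in>X. of_real (p i) * ((K e y x * u i x) * cnj (K e y' x' * u i x')))"
      by (rule sum.swap)
    also have "\<dots> = (\<Sum>i\<in>I. \<Sum>e\<in>E. of_real (p i) * (op_app X (K e) (u i) y * cnj (op_app X (K e) (u i) y')))"
      unfolding op_app_def cnj_sum sum_product by (simp only: sum_distrib_left)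
    finally show ?thesis by (simp only: sum.cartesian_product mult.assoc)
  qed
  then show ?thesis using assms unfolding psd_decomp_def by (auto simp: case_prod_beta)
qed

definition dual_map :: "'y set \<Rightarrow> 'e set \<Rightarrow> ('e \<Rightarrow> 'y \<Rightarrow> 'x \<Rightarrow> complex) \<Rightarrow> 'y qop \<Rightarrow> 'x qop" where
  "dual_map Y E K W = (\<lambda>x x'. \<Sum>e\<in>E. \<Sum>y\<in>Y. \<Sum>y'\<in>Y. cnj (K e y x) * W y y' * K e y' x')"

lemma op_app_dual_map: "op_app X (dual_map Y E K W) f x = (\<Sum>e\<in>E. op_app Y (op_adj (K e)) (op_app Y W (op_app X (K e) f)) x)"
proof -
  have "op_app X (dual_map Y E K W) f x = (\<Sum>x'\<in>X. \<Sum>e\<in>E. \<Sum>y\<in>Y. \<Sum>y'\<in>Y. cnj (K e y x) * (W y y' * (K e y' x' * f x')))"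
    unfolding op_app_def dual_map_def sum_distrib_right by (simp add: mult_ac)
  also have "\<dots> = (\<Sum>e\<in>E. \<Sum>x'\<in>X. \<Sum>y\<in>Y. \<Sum>y'\<in>Y. cnj (K e y x) * (W y y' * (K e y' x' * f x')))"
    by (rule sum.swap)
  also have "\<dots> = (\<Sum>e\<in>E. \<Sum>y\<in>Y. \<Sum>y'\<in>Y. \<Sum>x'\<in>X. cnj (K e y x) * (W y y' * (K e y' x' * f x')))"
    by (intro sum.cong[OF refl] sum_rotate)
  also have "\<dots> = (\<Sum>e\<in>E. op_app Y (op_adj (K e)) (op_app Y W (op_app X (K e) f)) x)"
    unfolding op_app_def op_adj_def sum_distrib_left ..
  finally show ?thesis .
qed

lemma op_adj_dual_map: "op_adj (dual_map Y E K W) = dual_map Y E K (op_adj W)"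
proof (intro ext)
  fix x x'
  have "op_adj (dual_map Y E K W) x x' = (\<Sum>e\<in>E. \<Sum>y\<in>Y. \<Sum>y'\<in>Y. cnj (K e y' x) * cnj (W y y') * K e y x')"
    unfolding op_adj_def dual_map_def cnj_sum by (simp add: mult_ac)
  also have "\<dots> = dual_map Y E K (op_adj W) x x'"
    unfolding op_adj_def dual_map_def by (intro sum.cong refl sum.swap)
  finally show "op_adj (dual_map Y E K W) x x' = dual_map Y E K (op_adj W) x x'" .
qed

lemma var_fun_kraus_map_le:
  assumes r: "psd_decomp X I u p \<rho>" "psd_decomp X J v q \<sigma>"
    and tp: "kraus_tp X Y E K" and fin: "finite X" "finite E" and t: "t \<ge> 0"
  shows "var_fun Y (kraus_map X E K \<rho>) (kraus_map X E K \<sigma>) t W \<le> var_fun X \<rho> \<sigma> t (dual_map Y E K W)"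
proof -
  have q: "quad_term X \<tau> (dual_map Y E K V) \<le> quad_term Y (kraus_map X E K \<tau>) V"
    if d: "psd_decomp X M s a \<tau>" for \<tau> V and M :: "'m set" and s a
  proof -
    have "quad_term X \<tau> (dual_map Y E K V) = (\<Sum>m\<in>M. a m * norm_sq X (op_app X (dual_map Y E K (op_adj V)) (s m)))"
      unfolding quad_term_decomp[OF d] op_adj_dual_map ..
    also have "\<dots> \<le> (\<Sum>m\<in>M. a m * (\<Sum>e\<in>E. norm_sq Y (op_app Y (op_adj V) (op_app X (K e) (s m)))))"
      unfolding op_app_dual_map
      by (intro sum_mono mult_left_mono kraus_adj_contraction[OF tp fin(1)]) (use d in \<open>auto simp: psd_decomp_def\<close>)
    also have "\<dots> = quad_term Y (kraus_map X E K \<tau>) V"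
      unfolding quad_term_decomp[OF kraus_map_decomp[OF d fin(2)]] by (simp add: sum.cartesian_product sum_distrib_left case_prod_beta)
    finally show ?thesis .
  qed
  have "lin_term Y (kraus_map X E K \<rho>) W = (\<Sum>i\<in>I. \<Sum>e\<in>E. of_real (p i) * ip_on Y (op_app Y W (op_app X (K e) (u i))) (op_app X (K e) (u i)))"
    unfolding lin_term_decomp[OF kraus_map_decomp[OF r(1) fin(2)]] by (simp add: sum.cartesian_product case_prod_beta)
  also have "\<dots> = (\<Sum>i\<in>I. of_real (p i) * ip_on X (op_app X (dual_map Y E K W) (u i)) (u i))"
    unfolding op_app_dual_map ip_on_sum_left sum_distrib_left by (simp add: ip_on_op_app)
  also have "\<dots> = lin_term X \<rho> (dual_map Y E K W)" unfolding lin_term_decomp[OF r(1)] ..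
  finally have l: "lin_term Y (kraus_map X E K \<rho>) W = lin_term X \<rho> (dual_map Y E K W)" .
  have "t * quad_term X \<rho> (op_adj (dual_map Y E K W)) \<le> t * quad_term Y (kraus_map X E K \<rho>) (op_adj W)"
    unfolding op_adj_dual_map by (intro mult_left_mono q[OF r(1)] t)
  then show ?thesis unfolding var_fun_def l using q[OF r(2), of W] by linarith
qed

section \<open>Monotonicity of relative entropy\<close>

text \<open>In nats.  The junk value ln 0 = 0 does no harm because it only occurs with weight 0 when \<open>supp_le\<close> holds.\<close>
definition rel_entropy :: "'x set \<Rightarrow> 'i set \<Rightarrow> ('i \<Rightarrow> 'x \<Rightarrow> complex) \<Rightarrow> ('i \<Rightarrow> real) \<Rightarrow>
    'j set \<Rightarrow> ('j \<Rightarrow> 'x \<Rightarrow> complex) \<Rightarrow> ('j \<Rightarrow> real) \<Rightarrow> real" where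
  "rel_entropy X I u p J v q = (\<Sum>j\<in>J. \<Sum>i\<in>I. (cmod (ip_on X (v j) (u i)))\<^sup>2 * p i * (ln (p i) - ln (q j)))"

text \<open>The antiderivative of \<open>resolvent_sum\<close> in t that vanishes at 0.\<close>
definition log_sum :: "'x set \<Rightarrow> 'i set \<Rightarrow> ('i \<Rightarrow> 'x \<Rightarrow> complex) \<Rightarrow> ('i \<Rightarrow> real) \<Rightarrow>
    'j set \<Rightarrow> ('j \<Rightarrow> 'x \<Rightarrow> complex) \<Rightarrow> ('j \<Rightarrow> real) \<Rightarrow> real \<Rightarrow> real" where
  "log_sum X I u p J v q T = (\<Sum>j\<in>J. \<Sum>i\<in>I. (cmod (ip_on X (v j) (u i)))\<^sup>2 * p i * (ln (q j + T * p i) - ln (q j)))"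

lemma log_sum_deriv:
  assumes r: "psd_eig X I u p \<rho>" "psd_eig X J v q \<sigma>" and sp: "supp_le X I u p J v q" and T: "T \<ge> 0"
  shows "(log_sum X I u p J v q has_real_derivative resolvent_sum X I u p J v q T) (at T)"
  unfolding log_sum_def[abs_def] resolvent_sum_def
proof (intro DERIV_sum)
  fix j i assume j: "j \<in> J" and i: "i \<in> I"
  define c where "c = (cmod (ip_on X (v j) (u i)))\<^sup>2"
  have nn: "0 \<le> p i" "0 \<le> q j" using psd_eig_nonneg[OF r(1) i] psd_eig_nonneg[OF r(2) j] .
  show "((\<lambda>T. (cmod (ip_on X (v j) (u i)))\<^sup>2 * p i * (ln (q j + T * p i) - ln (q j))) has_real_derivative
      (cmod (ip_on X (v j) (u i)))\<^sup>2 * (p i)\<^sup>2 / (q j + T * p i)) (at T)"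
    unfolding c_def[symmetric]
  proof (cases "q j = 0")
    case True
    then have "c * p i = 0" using sp i j by (auto simp: supp_le_def c_def)
    then show "((\<lambda>T. c * p i * (ln (q j + T * p i) - ln (q j))) has_real_derivative
      c * (p i)\<^sup>2 / (q j + T * p i)) (at T)" by (auto simp: power2_eq_square)
  next
    case False
    then have "q j + T * p i > 0" using nn T by (simp add: add_pos_nonneg)
    then show "((\<lambda>T. c * p i * (ln (q j + T * p i) - ln (q j))) has_real_derivative
      c * (p i)\<^sup>2 / (q j + T * p i)) (at T)"
      by (auto intro!: derivative_eq_intros simp: power2_eq_square)
  qed
qed

lemma overlap_sum:
  assumes "onb X I u" "onb X J v" "i \<in> I"
  shows "(\<Sum>j\<in>J. (cmod (ip_on X (v j) (u i)))\<^sup>2) = 1"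
  using norm_sq_onb[OF assms(2), of "u i"] onb_norm_sq[OF assms(1,3)] by simp

lemma log_sum_limit:
  assumes r: "psd_eig X I u p \<rho>" "psd_eig X J v q \<sigma>"
  shows "((\<lambda>T. log_sum X I u p J v q T - (\<Sum>i\<in>I. p i) * ln T) \<longlongrightarrow> rel_entropy X I u p J v q) at_top"
proof -
  have onb: "onb X I u" "onb X J v" using r by (auto simp: psd_eig_def)
  have "(\<Sum>i\<in>I. p i) = (\<Sum>i\<in>I. p i * (\<Sum>j\<in>J. (cmod (ip_on X (v j) (u i)))\<^sup>2))"
    by (intro sum.cong refl) (simp add: overlap_sum[OF onb])
  also have "\<dots> = (\<Sum>j\<in>J. \<Sum>i\<in>I. (cmod (ip_on X (v j) (u i)))\<^sup>2 * p i)"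
    unfolding sum_distrib_left by (subst sum.swap) (simp add: mult.commute)
  finally have S: "(\<Sum>i\<in>I. p i) = (\<Sum>j\<in>J. \<Sum>i\<in>I. (cmod (ip_on X (v j) (u i)))\<^sup>2 * p i)" .
  have "log_sum X I u p J v q T - (\<Sum>i\<in>I. p i) * ln T =
      (\<Sum>j\<in>J. \<Sum>i\<in>I. (cmod (ip_on X (v j) (u i)))\<^sup>2 * p i * (ln (q j + T * p i) - ln T - ln (q j)))" for T
    unfolding log_sum_def S sum_distrib_right sum_subtractf[symmetric]
    by (intro sum.cong refl) (simp add: algebra_simps)
  moreover have "((\<lambda>T. \<Sum>j\<in>J. \<Sum>i\<in>I. (cmod (ip_on X (v j) (u i)))\<^sup>2 * p i * (ln (q j + T * p i) - ln T - ln (q j)))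
      \<longlongrightarrow> rel_entropy X I u p J v q) at_top"
    unfolding rel_entropy_def
  proof (intro tendsto_sum)
    fix j i assume j: "j \<in> J" and i: "i \<in> I"
    define c a b where "c = (cmod (ip_on X (v j) (u i)))\<^sup>2" and "a = p i" and "b = q j"
    have nn: "0 \<le> a" "0 \<le> b" using psd_eig_nonneg[OF r(1) i] psd_eig_nonneg[OF r(2) j] by (simp_all add: a_def b_def)
    have "((\<lambda>T. c * a * (ln (b + T * a) - ln T - ln b)) \<longlongrightarrow> c * a * (ln a - ln b)) at_top"
    proof (cases "a = 0")
      case False
      then have a: "a > 0" using nn by simp
      have "((\<lambda>T. ln (b / T + a)) \<longlongrightarrow> ln (0 + a)) at_top"
        by (intro tendsto_intros tendsto_divide_0[OF tendsto_const] filterlim_at_top_imp_at_infinity filterlim_ident)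
           (use a in auto)
      moreover have "\<forall>\<^sub>F T in at_top. ln (b / T + a) = ln (b + T * a) - ln T"
        using eventually_gt_at_top[of 0]
      proof eventually_elim
        case (elim T)
        have "b + T * a > 0" using nn a elim by (simp add: add_nonneg_pos)
        moreover have "b / T + a = (b + T * a) / T" using elim by (simp add: field_simps)
        ultimately show ?case using elim by (simp add: ln_div)
      qed
      ultimately have "((\<lambda>T. ln (b + T * a) - ln T) \<longlongrightarrow> ln a) at_top"
        by (simp add: filterlim_cong)
      then show ?thesis by (intro tendsto_intros)
    qed simp
    then show "((\<lambda>T. (cmod (ip_on X (v j) (u i)))\<^sup>2 * p i * (ln (q j + T * p i) - ln T - ln (q j)))
      \<longlongrightarrow> (cmod (ip_on X (v j) (u i)))\<^sup>2 * p i * (ln (p i) - ln (q j))) at_top"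
      by (simp only: a_def b_def c_def)
  qed
  ultimately show ?thesis by simp
qed

lemma kraus_map_trace:
  assumes "kraus_tp X Y E K" "finite X"
  shows "(\<Sum>y\<in>Y. kraus_map X E K \<rho> y y) = (\<Sum>x\<in>X. \<rho> x x)"
proof -
  have "(\<Sum>y\<in>Y. kraus_map X E K \<rho> y y) = (\<Sum>e\<in>E. \<Sum>y\<in>Y. \<Sum>x\<in>X. \<Sum>x'\<in>X. \<rho> x x' * (cnj (K e y x') * K e y x))"
    unfolding kraus_map_def by (subst sum.swap) (simp add: mult_ac)
  also have "\<dots> = (\<Sum>e\<in>E. \<Sum>x\<in>X. \<Sum>x'\<in>X. \<Sum>y\<in>Y. \<rho> x x' * (cnj (K e y x') * K e y x))"
    by (intro sum.cong[OF refl] sum_rotate)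
  also have "\<dots> = (\<Sum>x\<in>X. \<Sum>x'\<in>X. \<Sum>e\<in>E. \<Sum>y\<in>Y. \<rho> x x' * (cnj (K e y x') * K e y x))"
    by (rule sum_rotate)
  also have "\<dots> = (\<Sum>x\<in>X. \<Sum>x'\<in>X. \<rho> x x' * (if x' = x then 1 else 0))"
    using assms unfolding sum_distrib_left[symmetric] kraus_tp_def by simp
  also have "\<dots> = (\<Sum>x\<in>X. \<rho> x x)" by (simp add: sum_delta_mult assms(2))
  finally show ?thesis .
qed

lemma rel_entropy_kraus_map_le:
  assumes r: "psd_eig X I u p \<rho>" "psd_eig X J v q \<sigma>" and sp: "supp_le X I u p J v q"
    and r': "psd_eig Y I' u' p' (kraus_map X E K \<rho>)" "psd_eig Y J' v' q' (kraus_map X E K \<sigma>)"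
    and sp': "supp_le Y I' u' p' J' v' q'"
    and tp: "kraus_tp X Y E K" and fin: "finite E"
  shows "rel_entropy Y I' u' p' J' v' q' \<le> rel_entropy X I u p J v q"
proof -
  have finX: "finite X" using r onb_finite by (auto simp: psd_eig_def)
  have dc: "psd_decomp X I u p \<rho>" "psd_decomp X J v q \<sigma>" using r by (auto simp: psd_eig_def)
  define F F' where "F = log_sum X I u p J v q" and "F' = log_sum Y I' u' p' J' v' q'"
  have Q: "resolvent_sum Y I' u' p' J' v' q' t \<le> resolvent_sum X I u p J v q t" if t: "t \<ge> 0" for t
  proof -
    obtain W where W: "var_fun Y (kraus_map X E K \<rho>) (kraus_map X E K \<sigma>) t W = resolvent_sum Y I' u' p' J' v' q' t"
      using var_fun_attains_resolvent_sum[OF r'] by blast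
    show ?thesis
      using var_fun_kraus_map_le[OF dc tp finX fin t, of W] var_fun_le_resolvent_sum[OF r sp t, of "dual_map Y E K W"] W by linarith
  qed
  have F0: "F 0 = 0" "F' 0 = 0" by (simp_all add: F_def F'_def log_sum_def)
  have le: "F' T \<le> F T" if T: "T \<ge> 0" for T
  proof -
    have "F 0 - F' 0 \<le> F T - F' T"
    proof (rule DERIV_nonneg_imp_nondecreasing[OF T])
      fix x assume x: "0 \<le> x" "x \<le> T"
      have "((\<lambda>x. F x - F' x) has_real_derivative resolvent_sum X I u p J v q x - resolvent_sum Y I' u' p' J' v' q' x) (at x)"
        unfolding F_def F'_def by (intro DERIV_diff log_sum_deriv[OF r sp x(1)] log_sum_deriv[OF r' sp' x(1)])
      then show "\<exists>y. ((\<lambda>x. F x - F' x) has_real_derivative y) (at x) \<and> 0 \<le> y"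
        using Q[OF x(1)] by (intro exI conjI) auto
    qed
    then show ?thesis by (simp add: F0)
  qed
  have "complex_of_real (\<Sum>i\<in>I'. p' i) = of_real (\<Sum>i\<in>I. p i)"
    unfolding psd_eig_trace[OF r(1)] psd_eig_trace[OF r'(1)] by (rule kraus_map_trace[OF tp finX])
  then have S: "(\<Sum>i\<in>I'. p' i) = (\<Sum>i\<in>I. p i)" by (simp only: of_real_eq_iff)
  show ?thesis
  proof (rule tendsto_le[OF _ log_sum_limit[OF r] log_sum_limit[OF r']])
    show "\<forall>\<^sub>F T in at_top. log_sum Y I' u' p' J' v' q' T - (\<Sum>i\<in>I'. p' i) * ln T \<le> log_sum X I u p J v q T - (\<Sum>i\<in>I. p i) * ln T"
      using eventually_ge_at_top[of 0]
      by eventually_elim (use le in \<open>simp add: S F_def F'_def\<close>)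
  qed simp
qed

lemma rel_entropy_nonneg:
  assumes r: "psd_eig X I u p \<rho>" "psd_eig X J v q \<sigma>" and sp: "supp_le X I u p J v q"
    and tr: "(\<Sum>x\<in>X. \<rho> x x) = (\<Sum>x\<in>X. \<sigma> x x)"
  shows "0 \<le> rel_entropy X I u p J v q"
proof -
  have onb: "onb X I u" "onb X J v" using r by (auto simp: psd_eig_def)
  have S: "(\<Sum>i\<in>I. p i) = (\<Sum>j\<in>J. q j)"
    using psd_eig_trace[OF r(1)] psd_eig_trace[OF r(2)] tr by (metis of_real_eq_iff)
  have "(\<Sum>j\<in>J. \<Sum>i\<in>I. (cmod (ip_on X (v j) (u i)))\<^sup>2 * (p i - q j)) \<le> rel_entropy X I u p J v q"
    unfolding rel_entropy_def
  proof (intro sum_mono)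
    fix j i assume j: "j \<in> J" and i: "i \<in> I"
    define c a b where "c = (cmod (ip_on X (v j) (u i)))\<^sup>2" and "a = p i" and "b = q j"
    have nn: "0 \<le> a" "0 \<le> b" using psd_eig_nonneg[OF r(1) i] psd_eig_nonneg[OF r(2) j] by (simp_all add: a_def b_def)
    have c0: "c \<ge> 0" by (simp add: c_def)
    have s: "b = 0 \<Longrightarrow> c = 0 \<or> a = 0" using sp i j by (auto simp: supp_le_def a_def b_def c_def)
    have "c * (a - b) \<le> c * a * (ln a - ln b)"
    proof (cases "a = 0 \<or> c = 0")
      case True
      then show ?thesis using c0 nn by auto
    next
      case False
      then have ab: "a > 0" "b > 0" using nn s by force+
      have "ln (b / a) \<le> b / a - 1" using ab by (intro ln_le_minus_one) simp
      then have "a * (ln b - ln a) \<le> a * (b / a - 1)"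
        using ab by (intro mult_left_mono) (simp_all add: ln_div)
      moreover have "a * (b / a - 1) = b - a" using ab by (simp add: right_diff_distrib)
      ultimately have "a - b \<le> a * (ln a - ln b)" by (simp add: algebra_simps)
      then have "c * (a - b) \<le> c * (a * (ln a - ln b))" by (rule mult_left_mono[OF _ c0])
      then show ?thesis by (simp only: mult.assoc)
    qed
    then show "(cmod (ip_on X (v j) (u i)))\<^sup>2 * (p i - q j) \<le> (cmod (ip_on X (v j) (u i)))\<^sup>2 * p i * (ln (p i) - ln (q j))"
      by (simp only: a_def b_def c_def)
  qed
  moreover have "(\<Sum>j\<in>J. \<Sum>i\<in>I. (cmod (ip_on X (v j) (u i)))\<^sup>2 * (p i - q j)) = 0"
  proof -
    have 1: "(\<Sum>j\<in>J. \<Sum>i\<in>I. (cmod (ip_on X (v j) (u i)))\<^sup>2 * p i) = (\<Sum>i\<in>I. p i)"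
      by (subst sum.swap) (simp add: sum_distrib_right[symmetric] overlap_sum[OF onb])
    have "cmod (ip_on X (v j) (u i)) = cmod (ip_on X (u i) (v j))" for i j
      by (metis cnj_ip_on complex_mod_cnj)
    then have 2: "(\<Sum>j\<in>J. \<Sum>i\<in>I. (cmod (ip_on X (v j) (u i)))\<^sup>2 * q j) = (\<Sum>j\<in>J. q j)"
      by (simp add: sum_distrib_right[symmetric] overlap_sum[OF onb(2,1)])
    show ?thesis by (simp add: right_diff_distrib sum_subtractf 1 2 S)
  qed
  ultimately show ?thesis by simp
qed

section \<open>Mutual information as relative entropy\<close>

definition prod_op :: "'z qop \<Rightarrow> 'x qop \<Rightarrow> ('z \<times> 'x) qop" where
  "prod_op \<sigma> \<tau> = (\<lambda>(z, x) (z', x'). \<sigma> z z' * \<tau> x x')"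

definition prod_fam :: "('j \<Rightarrow> 'z \<Rightarrow> complex) \<Rightarrow> ('k \<Rightarrow> 'x \<Rightarrow> complex) \<Rightarrow> 'j \<times> 'k \<Rightarrow> 'z \<times> 'x \<Rightarrow> complex" where
  "prod_fam a b = (\<lambda>(j, k) (z, x). a j z * b k x)"

lemma ip_on_prod: "ip_on (Z \<times> X) (\<lambda>(z, x). f z * g x) (\<lambda>(z, x). f' z * g' x) = ip_on Z f f' * ip_on X g g'"
  unfolding ip_on_def sum_product sum.cartesian_product by (intro sum.cong refl) auto

lemma onb_prod:
  assumes "onb Z J a" "onb X K b"
  shows "onb (Z \<times> X) (J \<times> K) (prod_fam a b)"
proof -
  have fin: "finite Z" "finite J" "finite X" "finite K" using assms onb_finite by blast+
  have on: "\<And>j j'. j \<in> J \<Longrightarrow> j' \<in> J \<Longrightarrow> ip_on Z (a j) (a j') = (if j = j' then 1 else 0)"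
    "\<And>k k'. k \<in> K \<Longrightarrow> k' \<in> K \<Longrightarrow> ip_on X (b k) (b k') = (if k = k' then 1 else 0)"
    using assms unfolding onb_def orthonormal_def by blast+
  have co: "\<And>z z'. z \<in> Z \<Longrightarrow> z' \<in> Z \<Longrightarrow> (\<Sum>j\<in>J. a j z * cnj (a j z')) = (if z = z' then 1 else 0)"
    "\<And>x x'. x \<in> X \<Longrightarrow> x' \<in> X \<Longrightarrow> (\<Sum>k\<in>K. b k x * cnj (b k x')) = (if x = x' then 1 else 0)"
    using assms unfolding onb_def by blast+
  have "(\<Sum>i\<in>J \<times> K. prod_fam a b i (z, x) * cnj (prod_fam a b i (z', x')))
      = (\<Sum>j\<in>J. a j z * cnj (a j z')) * (\<Sum>k\<in>K. b k x * cnj (b k x'))" for z x z' x'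
    unfolding sum_product sum.cartesian_product by (intro sum.cong refl) (auto simp: prod_fam_def)
  then show ?thesis
    using fin unfolding onb_def orthonormal_def by (auto simp: prod_fam_def ip_on_prod on co)
qed

lemma psd_eig_prod:
  assumes "psd_eig Z J a \<alpha> \<sigma>" "psd_eig X K b \<beta> \<tau>"
  shows "psd_eig (Z \<times> X) (J \<times> K) (prod_fam a b) (\<lambda>(j, k). \<alpha> j * \<beta> k) (prod_op \<sigma> \<tau>)"
proof -
  have d: "psd_decomp Z J a \<alpha> \<sigma>" "psd_decomp X K b \<beta> \<tau>" and o: "onb Z J a" "onb X K b"
    using assms unfolding psd_eig_def by blast+
  have fin: "finite J" "finite K" using onb_finite o by blast+
  have "prod_op \<sigma> \<tau> (z, x) (z', x') = (\<Sum>i\<in>J \<times> K. of_real (case i of (j, k) \<Rightarrow> \<alpha> j * \<beta> k) *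
      prod_fam a b i (z, x) * cnj (prod_fam a b i (z', x')))"
    if "z \<in> Z" "x \<in> X" "z' \<in> Z" "x' \<in> X" for z x z' x'
  proof -
    have "prod_op \<sigma> \<tau> (z, x) (z', x') = (\<Sum>j\<in>J. of_real (\<alpha> j) * a j z * cnj (a j z')) * (\<Sum>k\<in>K. of_real (\<beta> k) * b k x * cnj (b k x'))"
      using that by (simp add: prod_op_def psd_decomp_eq[OF d(1)] psd_decomp_eq[OF d(2)])
    also have "\<dots> = (\<Sum>i\<in>J \<times> K. of_real (case i of (j, k) \<Rightarrow> \<alpha> j * \<beta> k) *
      prod_fam a b i (z, x) * cnj (prod_fam a b i (z', x')))"
      unfolding sum_product sum.cartesian_product
      by (intro sum.cong refl) (auto simp: prod_fam_def)
    finally show ?thesis .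
  qed
  moreover have "0 \<le> \<alpha> j * \<beta> k" if "j \<in> J" "k \<in> K" for j k
    using psd_eig_nonneg[OF assms(1)] psd_eig_nonneg[OF assms(2)] that by simp
  ultimately show ?thesis
    using fin unfolding psd_eig_def psd_decomp_def by (auto intro: onb_prod[OF o])
qed

lemma psd_decomp_ptrace_ref:
  assumes "psd_decomp (Z \<times> X) M s r \<rho>" "finite X"
  shows "psd_decomp Z (M \<times> X) (\<lambda>(m, x) z. s m (z, x)) (\<lambda>(m, x). r m) (ptrace_ref X \<rho>)"
proof -
  have "ptrace_ref X \<rho> z z' = (\<Sum>i\<in>M \<times> X. of_real (case i of (m, x) \<Rightarrow> r m) *
     (case i of (m, x) \<Rightarrow> \<lambda>z. s m (z, x)) z * cnj ((case i of (m, x) \<Rightarrow> \<lambda>z. s m (z, x)) z'))"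
    if "z \<in> Z" "z' \<in> Z" for z z'
  proof -
    have "ptrace_ref X \<rho> z z' = (\<Sum>x\<in>X. \<Sum>m\<in>M. of_real (r m) * s m (z, x) * cnj (s m (z', x)))"
      unfolding ptrace_ref_def by (intro sum.cong refl psd_decomp_eq[OF assms(1)]) (use that in auto)
    also have "\<dots> = (\<Sum>m\<in>M. \<Sum>x\<in>X. of_real (r m) * s m (z, x) * cnj (s m (z', x)))"
      by (rule sum.swap)
    finally show ?thesis unfolding sum.cartesian_product by (simp add: case_prod_beta)
  qed
  then show ?thesis using assms unfolding psd_decomp_def by auto
qed

lemma psd_decomp_ptrace_out:
  assumes "psd_decomp (Z \<times> X) M s r \<rho>" "finite Z"
  shows "psd_decomp X (M \<times> Z) (\<lambda>(m, z) x. s m (z, x)) (\<lambda>(m, z). r m) (ptrace_out Z \<rho>)"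
proof -
  have "ptrace_out Z \<rho> x x' = (\<Sum>i\<in>M \<times> Z. of_real (case i of (m, z) \<Rightarrow> r m) *
     (case i of (m, z) \<Rightarrow> \<lambda>x. s m (z, x)) x * cnj ((case i of (m, z) \<Rightarrow> \<lambda>x. s m (z, x)) x'))"
    if "x \<in> X" "x' \<in> X" for x x'
  proof -
    have "ptrace_out Z \<rho> x x' = (\<Sum>z\<in>Z. \<Sum>m\<in>M. of_real (r m) * s m (z, x) * cnj (s m (z, x')))"
      unfolding ptrace_out_def by (intro sum.cong refl psd_decomp_eq[OF assms(1)]) (use that in auto)
    also have "\<dots> = (\<Sum>m\<in>M. \<Sum>z\<in>Z. of_real (r m) * s m (z, x) * cnj (s m (z, x')))"
      by (rule sum.swap)
    finally show ?thesis unfolding sum.cartesian_product by (simp add: case_prod_beta)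
  qed
  then show ?thesis using assms unfolding psd_decomp_def by auto
qed

lemma psd_marginals:
  assumes "finite Z" "finite X" "psd_on (Z \<times> X) \<rho>"
  shows "psd_on Z (ptrace_ref X \<rho>)" "psd_on X (ptrace_out Z \<rho>)"
proof -
  obtain I :: "nat set" and u p where "psd_eig (Z \<times> X) I u p \<rho>"
    using psd_on_spectral[OF _ assms(3)] assms by blast
  then have "psd_decomp (Z \<times> X) I u p \<rho>" by (simp add: psd_eig_def)
  then show "psd_on Z (ptrace_ref X \<rho>)" "psd_on X (ptrace_out Z \<rho>)"
    using psd_decomp_psd_on psd_decomp_ptrace_ref psd_decomp_ptrace_out assms(1,2) by blast+
qed

lemma quad_form_eigenvector:
  assumes "psd_eig X I u p \<rho>" "i \<in> I"
  shows "quad_form X \<rho> (u i) = of_real (p i)"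
proof -
  have d: "psd_decomp X I u p \<rho>" and o: "onb X I u" using assms unfolding psd_eig_def by blast+
  have "(\<Sum>m\<in>I. p m * (cmod (ip_on X (u m) (u i)))\<^sup>2) = (\<Sum>m\<in>I. p m * (if m = i then 1 else 0))"
    using o assms(2) by (intro sum.cong refl) (simp add: onb_def orthonormal_def)
  then show ?thesis unfolding quad_form_decomp[OF d] using assms(2) onb_finite[OF o] by (simp add: sum_delta_mult)
qed

lemma marginal_weights:
  assumes r: "psd_decomp (Z \<times> X) I u p \<rho>" and o: "onb Z J a" "onb X K b"
  shows "\<And>j. (\<Sum>k\<in>K. \<Sum>i\<in>I. (cmod (ip_on (Z \<times> X) (prod_fam a b (j, k)) (u i)))\<^sup>2 * p i) = Re (quad_form Z (ptrace_ref X \<rho>) (a j))"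
    and "\<And>k. (\<Sum>j\<in>J. \<Sum>i\<in>I. (cmod (ip_on (Z \<times> X) (prod_fam a b (j, k)) (u i)))\<^sup>2 * p i) = Re (quad_form X (ptrace_out Z \<rho>) (b k))"
proof -
  have fin: "finite Z" "finite X" using onb_finite o by blast+
  fix j
  have "ip_on (Z \<times> X) (prod_fam a b (j, k)) (u i) = ip_on X (b k) (\<lambda>x. ip_on Z (a j) (\<lambda>z. u i (z, x)))" for k i
  proof -
    have "ip_on (Z \<times> X) (prod_fam a b (j, k)) (u i) = (\<Sum>z\<in>Z. \<Sum>x\<in>X. cnj (a j z) * cnj (b k x) * u i (z, x))"
      unfolding ip_on_def prod_fam_def sum.cartesian_product by (intro sum.cong refl) auto
    also have "\<dots> = (\<Sum>x\<in>X. \<Sum>z\<in>Z. cnj (a j z) * cnj (b k x) * u i (z, x))" by (rule sum.swap)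
    finally show ?thesis unfolding ip_on_def sum_distrib_left by (simp only: mult_ac)
  qed
  then have "(\<Sum>k\<in>K. \<Sum>i\<in>I. (cmod (ip_on (Z \<times> X) (prod_fam a b (j, k)) (u i)))\<^sup>2 * p i)
      = (\<Sum>i\<in>I. \<Sum>k\<in>K. (cmod (ip_on X (b k) (\<lambda>x. ip_on Z (a j) (\<lambda>z. u i (z, x)))))\<^sup>2 * p i)"
    by (subst sum.swap) simp
  also have "\<dots> = (\<Sum>i\<in>I. norm_sq X (\<lambda>x. ip_on Z (a j) (\<lambda>z. u i (z, x))) * p i)"
    unfolding norm_sq_onb[OF o(2)] sum_distrib_right ..
  also have "\<dots> = (\<Sum>i\<in>I. \<Sum>x\<in>X. p i * (cmod (ip_on Z (\<lambda>z. u i (z, x)) (a j)))\<^sup>2)"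
    unfolding norm_sq_def sum_distrib_right cnj_ip_on[of Z "\<lambda>z. u _ (z, _)" "a j", symmetric] complex_mod_cnj
    by (simp add: mult.commute)
  also have "\<dots> = Re (quad_form Z (ptrace_ref X \<rho>) (a j))"
    unfolding quad_form_decomp[OF psd_decomp_ptrace_ref[OF r fin(2)]] sum.cartesian_product by (simp add: case_prod_beta)
  finally show "(\<Sum>k\<in>K. \<Sum>i\<in>I. (cmod (ip_on (Z \<times> X) (prod_fam a b (j, k)) (u i)))\<^sup>2 * p i) = Re (quad_form Z (ptrace_ref X \<rho>) (a j))" .
next
  have fin: "finite Z" "finite X" using onb_finite o by blast+
  fix k
  have "ip_on (Z \<times> X) (prod_fam a b (j, k)) (u i) = ip_on Z (a j) (\<lambda>z. ip_on X (b k) (\<lambda>x. u i (z, x)))" for j i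
  proof -
    have "ip_on (Z \<times> X) (prod_fam a b (j, k)) (u i) = (\<Sum>z\<in>Z. \<Sum>x\<in>X. cnj (a j z) * cnj (b k x) * u i (z, x))"
      unfolding ip_on_def prod_fam_def sum.cartesian_product by (intro sum.cong refl) auto
    then show ?thesis unfolding ip_on_def sum_distrib_left by (simp only: mult_ac)
  qed
  then have "(\<Sum>j\<in>J. \<Sum>i\<in>I. (cmod (ip_on (Z \<times> X) (prod_fam a b (j, k)) (u i)))\<^sup>2 * p i)
      = (\<Sum>i\<in>I. \<Sum>j\<in>J. (cmod (ip_on Z (a j) (\<lambda>z. ip_on X (b k) (\<lambda>x. u i (z, x)))))\<^sup>2 * p i)"
    by (subst sum.swap) simp
  also have "\<dots> = (\<Sum>i\<in>I. norm_sq Z (\<lambda>z. ip_on X (b k) (\<lambda>x. u i (z, x))) * p i)"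
    unfolding norm_sq_onb[OF o(1)] sum_distrib_right ..
  also have "\<dots> = (\<Sum>i\<in>I. \<Sum>z\<in>Z. p i * (cmod (ip_on X (\<lambda>x. u i (z, x)) (b k)))\<^sup>2)"
    unfolding norm_sq_def sum_distrib_right cnj_ip_on[of X "\<lambda>x. u _ (_, x)" "b k", symmetric] complex_mod_cnj
    by (simp add: mult.commute)
  also have "\<dots> = Re (quad_form X (ptrace_out Z \<rho>) (b k))"
    unfolding quad_form_decomp[OF psd_decomp_ptrace_out[OF r fin(1)]] sum.cartesian_product by (simp add: case_prod_beta)
  finally show "(\<Sum>j\<in>J. \<Sum>i\<in>I. (cmod (ip_on (Z \<times> X) (prod_fam a b (j, k)) (u i)))\<^sup>2 * p i) = Re (quad_form X (ptrace_out Z \<rho>) (b k))" .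
qed

lemma mutual_info_eq_rel_entropy:
  assumes r: "psd_eig (Z \<times> X) I u p \<rho>" and a: "psd_eig Z J a \<alpha> (ptrace_ref X \<rho>)" and b: "psd_eig X K b \<beta> (ptrace_out Z \<rho>)"
  shows "supp_le (Z \<times> X) I u p (J \<times> K) (prod_fam a b) (\<lambda>(j, k). \<alpha> j * \<beta> k)"
    and "mutual_info Z X \<rho> = rel_entropy (Z \<times> X) I u p (J \<times> K) (prod_fam a b) (\<lambda>(j, k). \<alpha> j * \<beta> k) / ln 2"
proof -
  have d: "psd_decomp (Z \<times> X) I u p \<rho>" and o: "onb (Z \<times> X) I u" "onb Z J a" "onb X K b"
    using assms unfolding psd_eig_def by blast+
  have fin: "finite I" "finite J" "finite K" using onb_finite o by blast+
  define c where "c = (\<lambda>j k i. (cmod (ip_on (Z \<times> X) (prod_fam a b (j, k)) (u i)))\<^sup>2 * p i)"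
  define m where "m = (\<lambda>j k. \<Sum>i\<in>I. c j k i)"
  have c0: "0 \<le> c j k i" if "i \<in> I" for j k i
    using psd_eig_nonneg[OF r that] by (simp add: c_def)
  then have m0: "0 \<le> m j k" for j k unfolding m_def by (intro sum_nonneg)
  have mJ: "(\<Sum>k\<in>K. m j k) = \<alpha> j" if "j \<in> J" for j
    using marginal_weights(1)[OF d o(2,3), of j] quad_form_eigenvector[OF a that] by (simp add: m_def c_def)
  have mK: "(\<Sum>j\<in>J. m j k) = \<beta> k" if "k \<in> K" for k
    using marginal_weights(2)[OF d o(2,3), of k] quad_form_eigenvector[OF b that] by (simp add: m_def c_def)
  have mz: "m j k = 0 \<or> (\<alpha> j > 0 \<and> \<beta> k > 0)" if "j \<in> J" "k \<in> K" for j k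
  proof -
    have "m j k \<le> \<alpha> j" unfolding mJ[OF that(1), symmetric]
      by (rule member_le_sum) (use that fin m0 in auto)
    moreover have "m j k \<le> \<beta> k" unfolding mK[OF that(2), symmetric]
      by (rule member_le_sum[of j J "\<lambda>j. m j k"]) (use that fin m0 in auto)
    ultimately show ?thesis using m0[of j k] by linarith
  qed
  show "supp_le (Z \<times> X) I u p (J \<times> K) (prod_fam a b) (\<lambda>(j, k). \<alpha> j * \<beta> k)"
    unfolding supp_le_def
  proof (intro ballI impI)
    fix l i assume l: "l \<in> J \<times> K" and i: "i \<in> I" and z: "(case l of (j, k) \<Rightarrow> \<alpha> j * \<beta> k) = 0"
    obtain j k where jk: "l = (j, k)" "j \<in> J" "k \<in> K" using l by auto
    have "m j k = 0" using mz[OF jk(2,3)] z jk(1) by auto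
    then have "c j k i = 0"
      using c0 i fin unfolding m_def by (subst (asm) sum_nonneg_eq_0_iff) auto
    then show "ip_on (Z \<times> X) (prod_fam a b l) (u i) = 0 \<or> p i = 0" by (auto simp: c_def jk)
  qed
  have "rel_entropy (Z \<times> X) I u p (J \<times> K) (prod_fam a b) (\<lambda>(j, k). \<alpha> j * \<beta> k)
      = (\<Sum>l\<in>J \<times> K. \<Sum>i\<in>I. (cmod (ip_on (Z \<times> X) (prod_fam a b l) (u i)))\<^sup>2 * (p i * ln (p i)))
        - (\<Sum>l\<in>J \<times> K. \<Sum>i\<in>I. (cmod (ip_on (Z \<times> X) (prod_fam a b l) (u i)))\<^sup>2 * p i * ln (case l of (j, k) \<Rightarrow> \<alpha> j * \<beta> k))"
    unfolding rel_entropy_def sum_subtractf[symmetric] by (intro sum.cong refl) (simp add: algebra_simps)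
  also have "(\<Sum>l\<in>J \<times> K. \<Sum>i\<in>I. (cmod (ip_on (Z \<times> X) (prod_fam a b l) (u i)))\<^sup>2 * (p i * ln (p i)))
      = (\<Sum>i\<in>I. p i * ln (p i))"
    by (subst sum.swap) (simp add: sum_distrib_right[symmetric] overlap_sum[OF o(1) onb_prod[OF o(2,3)]])
  also have "(\<Sum>l\<in>J \<times> K. \<Sum>i\<in>I. (cmod (ip_on (Z \<times> X) (prod_fam a b l) (u i)))\<^sup>2 * p i * ln (case l of (j, k) \<Rightarrow> \<alpha> j * \<beta> k))
      = (\<Sum>j\<in>J. \<Sum>k\<in>K. m j k * ln (\<alpha> j * \<beta> k))"
    by (simp add: sum.cartesian_product' m_def c_def sum_distrib_right)
  also have "\<dots> = (\<Sum>j\<in>J. \<Sum>k\<in>K. m j k * ln (\<alpha> j) + m j k * ln (\<beta> k))"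
  proof (intro sum.cong refl)
    fix j k assume "j \<in> J" "k \<in> K"
    from mz[OF this] show "m j k * ln (\<alpha> j * \<beta> k) = m j k * ln (\<alpha> j) + m j k * ln (\<beta> k)"
      by (auto simp: ln_mult distrib_left)
  qed
  also have "\<dots> = (\<Sum>j\<in>J. \<alpha> j * ln (\<alpha> j)) + (\<Sum>k\<in>K. \<beta> k * ln (\<beta> k))"
  proof -
    have "(\<Sum>j\<in>J. \<Sum>k\<in>K. m j k * ln (\<alpha> j)) = (\<Sum>j\<in>J. \<alpha> j * ln (\<alpha> j))"
      by (simp add: sum_distrib_right[symmetric] mJ)
    moreover have "(\<Sum>j\<in>J. \<Sum>k\<in>K. m j k * ln (\<beta> k)) = (\<Sum>k\<in>K. \<beta> k * ln (\<beta> k))"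
      by (subst sum.swap) (simp add: sum_distrib_right[symmetric] mK)
    ultimately show ?thesis by (simp add: sum.distrib)
  qed
  finally have R: "rel_entropy (Z \<times> X) I u p (J \<times> K) (prod_fam a b) (\<lambda>(j, k). \<alpha> j * \<beta> k)
     = (\<Sum>i\<in>I. p i * ln (p i)) - ((\<Sum>j\<in>J. \<alpha> j * ln (\<alpha> j)) + (\<Sum>k\<in>K. \<beta> k * ln (\<beta> k)))" .
  have L: "(\<Sum>i\<in>L. - f i * log 2 (f i)) = - (\<Sum>i\<in>L. f i * ln (f i)) / ln 2" for f :: "'m \<Rightarrow> real" and L
    by (simp add: log_def sum_negf sum_divide_distrib)
  show "mutual_info Z X \<rho> = rel_entropy (Z \<times> X) I u p (J \<times> K) (prod_fam a b) (\<lambda>(j, k). \<alpha> j * \<beta> k) / ln 2"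
    unfolding mutual_info_def vn_entropy_spectral[OF psd_eig_spectral[OF r]] vn_entropy_spectral[OF psd_eig_spectral[OF a]]
      vn_entropy_spectral[OF psd_eig_spectral[OF b]] L R
    by (simp add: field_simps)
qed

lemma psd_eig_cong:
  assumes "psd_eig X I u p \<rho>" "\<And>x x'. x \<in> X \<Longrightarrow> x' \<in> X \<Longrightarrow> \<rho>' x x' = \<rho> x x'"
  shows "psd_eig X I u p \<rho>'"
  using assms unfolding psd_eig_def psd_decomp_def by simp

definition local_map :: "'x set \<Rightarrow> 'e set \<Rightarrow> ('e \<Rightarrow> 'y \<Rightarrow> 'x \<Rightarrow> complex) \<Rightarrow> ('z \<times> 'x) qop \<Rightarrow> ('z \<times> 'y) qop" where
  "local_map X E K \<rho> = (\<lambda>(z, y) (z', y'). \<Sum>e\<in>E. \<Sum>x\<in>X. \<Sum>x'\<in>X. K e y x * \<rho> (z, x) (z', x') * cnj (K e y' x'))"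

definition ext_kraus :: "('e \<Rightarrow> 'y \<Rightarrow> 'x \<Rightarrow> complex) \<Rightarrow> 'e \<Rightarrow> 'z \<times> 'y \<Rightarrow> 'z \<times> 'x \<Rightarrow> complex" where
  "ext_kraus K = (\<lambda>e (z, y) (z', x). K e y x * (if z = z' then 1 else 0))"

lemma kraus_tp_ext_kraus:
  assumes "kraus_tp X Y E K" "finite Z"
  shows "kraus_tp (Z \<times> X) (Z \<times> Y) E (ext_kraus K)"
  unfolding kraus_tp_def
proof (intro ballI)
  fix t t' assume "t \<in> Z \<times> X" "t' \<in> Z \<times> X"
  then obtain z x z' x' where t: "t = (z, x)" "t' = (z', x')" "z \<in> Z" "z' \<in> Z" "x \<in> X" "x' \<in> X" by auto
  have "(\<Sum>e\<in>E. \<Sum>y\<in>Z \<times> Y. cnj (ext_kraus K e y t) * ext_kraus K e y t')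
      = (\<Sum>e\<in>E. \<Sum>w\<in>Z. (\<Sum>y\<in>Y. cnj (K e y x) * K e y x' * (if z = z' then 1 else 0)) * (if w = z then 1 else 0))"
    unfolding sum.cartesian_product' t ext_kraus_def sum_distrib_right
    by (intro sum.cong refl) auto
  also have "\<dots> = (\<Sum>e\<in>E. \<Sum>y\<in>Y. cnj (K e y x) * K e y x') * (if z = z' then 1 else 0)"
    unfolding sum_delta_mult[OF assms(2)] using t by (simp add: sum_distrib_right)
  also have "\<dots> = (if t = t' then 1 else 0)"
    using assms(1) t by (simp add: kraus_tp_def)
  finally show "(\<Sum>e\<in>E. \<Sum>y\<in>Z \<times> Y. cnj (ext_kraus K e y t) * ext_kraus K e y t') = (if t = t' then 1 else 0)" .
qed

lemma kraus_map_ext_kraus: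
  assumes "finite Z" "z \<in> Z" "z' \<in> Z"
  shows "kraus_map (Z \<times> X) E (ext_kraus K) \<rho> (z, y) (z', y') = local_map X E K \<rho> (z, y) (z', y')"
proof -
  have "kraus_map (Z \<times> X) E (ext_kraus K) \<rho> (z, y) (z', y')
     = (\<Sum>e\<in>E. \<Sum>w\<in>Z. (\<Sum>x\<in>X. \<Sum>w'\<in>Z. (\<Sum>x'\<in>X. K e y x * \<rho> (w, x) (w', x') * cnj (K e y' x')) * (if w' = z' then 1 else 0)) * (if w = z then 1 else 0))"
    unfolding kraus_map_def sum.cartesian_product' ext_kraus_def sum_distrib_right
    by (intro sum.cong refl) auto
  also have "\<dots> = local_map X E K \<rho> (z, y) (z', y')"
    by (simp add: sum_delta_mult assms local_map_def)
  finally show ?thesis .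
qed

lemma ptrace_ref_local_map:
  assumes "kraus_tp X Y E K" "finite X"
  shows "ptrace_ref Y (local_map X E K \<rho>) z z' = ptrace_ref X \<rho> z z'"
  using kraus_map_trace[OF assms, of "\<lambda>x x'. \<rho> (z, x) (z', x')"]
  by (simp add: ptrace_ref_def local_map_def kraus_map_def)

lemma ptrace_out_local_map: "ptrace_out Z (local_map X E K \<rho>) = kraus_map X E K (ptrace_out Z \<rho>)"
proof (intro ext)
  fix y y'
  have "ptrace_out Z (local_map X E K \<rho>) y y' = (\<Sum>z\<in>Z. \<Sum>e\<in>E. \<Sum>x\<in>X. \<Sum>x'\<in>X. K e y x * \<rho> (z, x) (z, x') * cnj (K e y' x'))"
    by (simp add: ptrace_out_def local_map_def)
  also have "\<dots> = (\<Sum>e\<in>E. \<Sum>z\<in>Z. \<Sum>x\<in>X. \<Sum>x'\<in>X. K e y x * \<rho> (z, x) (z, x') * cnj (K e y' x'))"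
    by (rule sum.swap)
  also have "\<dots> = (\<Sum>e\<in>E. \<Sum>x\<in>X. \<Sum>x'\<in>X. \<Sum>z\<in>Z. K e y x * \<rho> (z, x) (z, x') * cnj (K e y' x'))"
    by (intro sum.cong[OF refl] sum_rotate)
  also have "\<dots> = kraus_map X E K (ptrace_out Z \<rho>) y y'"
    by (simp add: kraus_map_def ptrace_out_def sum_distrib_left sum_distrib_right)
  finally show "ptrace_out Z (local_map X E K \<rho>) y y' = kraus_map X E K (ptrace_out Z \<rho>) y y'" .
qed

lemma local_map_prod_op: "local_map X E K (prod_op \<sigma> \<tau>) = prod_op \<sigma> (kraus_map X E K \<tau>)"
  by (auto simp: fun_eq_iff local_map_def prod_op_def kraus_map_def sum_distrib_left mult_ac)

lemma psd_kraus_map: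
  assumes "finite X" "finite E" "psd_on X \<rho>"
  shows "psd_on Y (kraus_map X E K \<rho>)"
proof -
  obtain I :: "nat set" and u p where "psd_eig X I u p \<rho>" using psd_on_spectral[OF assms(1,3)] by blast
  then have "psd_decomp X I u p \<rho>" by (simp add: psd_eig_def)
  from kraus_map_decomp[OF this assms(2)] show ?thesis by (rule psd_decomp_psd_on)
qed

lemma psd_on_cong:
  assumes "\<And>x x'. x \<in> X \<Longrightarrow> x' \<in> X \<Longrightarrow> \<rho> x x' = \<rho>' x x'"
  shows "psd_on X \<rho> \<longleftrightarrow> psd_on X \<rho>'"
  unfolding psd_on_iff_quad_form by (simp only: quad_form_cong[OF assms refl])

lemma psd_local_map:
  assumes "finite Z" "finite X" "finite E" "psd_on (Z \<times> X) \<rho>"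
  shows "psd_on (Z \<times> Y) (local_map X E K \<rho>)"
proof -
  have "psd_on (Z \<times> Y) (kraus_map (Z \<times> X) E (ext_kraus K) \<rho>)" using assms by (intro psd_kraus_map) auto
  then show ?thesis
    by (subst (asm) psd_on_cong[of _ _ "local_map X E K \<rho>"]) (auto simp: kraus_map_ext_kraus[OF assms(1)])
qed

lemma mutual_info_local_map_le:
  assumes fin: "finite Z" "finite X" "finite Y" "finite E" and tp: "kraus_tp X Y E K" and psd: "psd_on (Z \<times> X) \<rho>"
  shows "mutual_info Z Y (local_map X E K \<rho>) \<le> mutual_info Z X \<rho>"
proof -
  note psd' = psd_local_map[OF fin(1,2,4) psd, of Y K]
  obtain I :: "nat set" and u p where r: "psd_eig (Z \<times> X) I u p \<rho>"
    using psd_on_spectral[OF _ psd] fin by blast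
  obtain J :: "nat set" and a \<alpha> where a: "psd_eig Z J a \<alpha> (ptrace_ref X \<rho>)"
    using psd_on_spectral[OF fin(1) psd_marginals(1)[OF fin(1,2) psd]] by blast
  obtain L :: "nat set" and b \<beta> where b: "psd_eig X L b \<beta> (ptrace_out Z \<rho>)"
    using psd_on_spectral[OF fin(2) psd_marginals(2)[OF fin(1,2) psd]] by blast
  obtain I' :: "nat set" and u' p' where r': "psd_eig (Z \<times> Y) I' u' p' (local_map X E K \<rho>)"
    using psd_on_spectral[OF _ psd'] fin by blast
  obtain L' :: "nat set" and b' \<beta>' where b': "psd_eig Y L' b' \<beta>' (ptrace_out Z (local_map X E K \<rho>))"
    using psd_on_spectral[OF fin(3) psd_marginals(2)[OF fin(1,3) psd']] by blast
  have a': "psd_eig Z J a \<alpha> (ptrace_ref Y (local_map X E K \<rho>))"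
    by (rule psd_eig_cong[OF a]) (rule ptrace_ref_local_map[OF tp fin(2)])
  have "rel_entropy (Z \<times> Y) I' u' p' (J \<times> L') (prod_fam a b') (\<lambda>(j, k). \<alpha> j * \<beta>' k)
      \<le> rel_entropy (Z \<times> X) I u p (J \<times> L) (prod_fam a b) (\<lambda>(j, k). \<alpha> j * \<beta> k)"
  proof (rule rel_entropy_kraus_map_le[OF r psd_eig_prod[OF a b] mutual_info_eq_rel_entropy(1)[OF r a b] _ _
        mutual_info_eq_rel_entropy(1)[OF r' a' b'] kraus_tp_ext_kraus[OF tp fin(1)] fin(4)])
    show "psd_eig (Z \<times> Y) I' u' p' (kraus_map (Z \<times> X) E (ext_kraus K) \<rho>)"
      by (rule psd_eig_cong[OF r']) (auto simp: kraus_map_ext_kraus[OF fin(1)])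
    have "psd_eig (Z \<times> Y) (J \<times> L') (prod_fam a b') (\<lambda>(j, k). \<alpha> j * \<beta>' k) (prod_op (ptrace_ref X \<rho>) (kraus_map X E K (ptrace_out Z \<rho>)))"
      using psd_eig_prod[OF a b'] by (simp only: ptrace_out_local_map)
    then show "psd_eig (Z \<times> Y) (J \<times> L') (prod_fam a b') (\<lambda>(j, k). \<alpha> j * \<beta>' k)
       (kraus_map (Z \<times> X) E (ext_kraus K) (prod_op (ptrace_ref X \<rho>) (ptrace_out Z \<rho>)))"
      by (rule psd_eig_cong) (auto simp: kraus_map_ext_kraus[OF fin(1)] local_map_prod_op)
  qed
  then show ?thesis
    unfolding mutual_info_eq_rel_entropy(2)[OF r a b] mutual_info_eq_rel_entropy(2)[OF r' a' b']
    by (simp add: divide_right_mono)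
qed

lemma mutual_info_nonneg:
  assumes fin: "finite Z" "finite X" and psd: "psd_on (Z \<times> X) \<rho>" and tr: "(\<Sum>t\<in>Z \<times> X. \<rho> t t) = 1"
  shows "0 \<le> mutual_info Z X \<rho>"
proof -
  obtain I :: "nat set" and u p where r: "psd_eig (Z \<times> X) I u p \<rho>"
    using psd_on_spectral[OF _ psd] fin by blast
  obtain J :: "nat set" and a \<alpha> where a: "psd_eig Z J a \<alpha> (ptrace_ref X \<rho>)"
    using psd_on_spectral[OF fin(1) psd_marginals(1)[OF fin psd]] by blast
  obtain L :: "nat set" and b \<beta> where b: "psd_eig X L b \<beta> (ptrace_out Z \<rho>)"
    using psd_on_spectral[OF fin(2) psd_marginals(2)[OF fin psd]] by blast
  have t1: "(\<Sum>z\<in>Z. ptrace_ref X \<rho> z z) = 1"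
    using tr by (simp add: ptrace_ref_def sum.cartesian_product)
  have t2: "(\<Sum>x\<in>X. ptrace_out Z \<rho> x x) = 1"
    unfolding ptrace_out_def by (subst sum.swap) (use tr in \<open>simp add: sum.cartesian_product\<close>)
  have "(\<Sum>t\<in>Z \<times> X. prod_op (ptrace_ref X \<rho>) (ptrace_out Z \<rho>) t t)
      = (\<Sum>z\<in>Z. ptrace_ref X \<rho> z z) * (\<Sum>x\<in>X. ptrace_out Z \<rho> x x)"
    unfolding sum_product sum.cartesian_product by (intro sum.cong refl) (auto simp: prod_op_def)
  then have "0 \<le> rel_entropy (Z \<times> X) I u p (J \<times> L) (prod_fam a b) (\<lambda>(j, k). \<alpha> j * \<beta> k)"
    by (intro rel_entropy_nonneg[OF r psd_eig_prod[OF a b] mutual_info_eq_rel_entropy(1)[OF r a b]]) (simp add: tr t1 t2)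
  then show ?thesis unfolding mutual_info_eq_rel_entropy(2)[OF r a b] by simp
qed

section \<open>Entropy bounds and two channel uses\<close>

lemma onb_relabel:
  assumes "onb X I u" "bij_betw f X X'"
  shows "onb X' I (\<lambda>i y. u i (inv_into X f y))"
proof -
  have inv: "inv_into X f (f x) = x" if "x \<in> X" for x
    using bij_betw_inv_into_left[OF assms(2) that] .
  have ip_on: "ip_on X' (\<lambda>y. u i (inv_into X f y)) (\<lambda>y. u j (inv_into X f y)) = ip_on X (u i) (u j)" for i j
    unfolding ip_on_def by (subst sum.reindex_bij_betw[OF assms(2), symmetric]) (simp add: inv)
  have "finite X'" using bij_betw_finite[OF assms(2)] onb_finite[OF assms(1)] by simp
  moreover have "(\<Sum>i\<in>I. u i (inv_into X f y) * cnj (u i (inv_into X f y'))) = (if y = y' then 1 else 0)"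
    if y: "y \<in> X'" "y' \<in> X'" for y y'
  proof -
    obtain x x' where x: "x \<in> X" "y = f x" "x' \<in> X" "y' = f x'"
      using y assms(2) by (auto simp: bij_betw_def)
    have "f x = f x' \<longleftrightarrow> x = x'"
      using x inj_on_eq_iff[OF bij_betw_imp_inj_on[OF assms(2)]] by blast
    then show ?thesis using assms(1) x by (simp add: inv onb_def)
  qed
  ultimately show ?thesis
    using assms(1) unfolding onb_def orthonormal_def ip_on by blast
qed

lemma psd_eig_relabel:
  assumes "psd_eig X I u p \<rho>" "bij_betw f X X'"
    and eq: "\<And>x x'. x \<in> X \<Longrightarrow> x' \<in> X \<Longrightarrow> \<rho>' (f x) (f x') = \<rho> x x'"
  shows "psd_eig X' I (\<lambda>i y. u i (inv_into X f y)) p \<rho>'"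
proof -
  have d: "psd_decomp X I u p \<rho>" and o: "onb X I u" using assms unfolding psd_eig_def by blast+
  have inv: "inv_into X f (f x) = x" if "x \<in> X" for x
    using bij_betw_inv_into_left[OF assms(2) that] .
  have "\<rho>' y y' = (\<Sum>m\<in>I. of_real (p m) * u m (inv_into X f y) * cnj (u m (inv_into X f y')))"
    if y: "y \<in> X'" "y' \<in> X'" for y y'
  proof -
    obtain x x' where x: "x \<in> X" "y = f x" "x' \<in> X" "y' = f x'"
      using y assms(2) by (auto simp: bij_betw_def)
    show ?thesis unfolding x(2,4) eq[OF x(1,3)] inv[OF x(1)] inv[OF x(3)] by (rule psd_decomp_eq[OF d x(1,3)])
  qed
  then show ?thesis
    using onb_relabel[OF o assms(2)] d unfolding psd_eig_def psd_decomp_def by blast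
qed

lemma vn_entropy_relabel:
  assumes "finite X" "psd_on X \<rho>" "bij_betw f X X'"
    and "\<And>x x'. x \<in> X \<Longrightarrow> x' \<in> X \<Longrightarrow> \<rho>' (f x) (f x') = \<rho> x x'"
  shows "vn_entropy X' \<rho>' = vn_entropy X \<rho>"
proof -
  obtain I :: "nat set" and u p where r: "psd_eig X I u p \<rho>" using psd_on_spectral[OF assms(1,2)] by blast
  show ?thesis
    using vn_entropy_spectral[OF psd_eig_spectral[OF r]] vn_entropy_spectral[OF psd_eig_spectral[OF psd_eig_relabel[OF r assms(3,4)]]] by simp
qed

lemma vn_entropy_cong:
  assumes "finite X" "\<And>x x'. x \<in> X \<Longrightarrow> x' \<in> X \<Longrightarrow> \<rho> x x' = \<rho>' x x'"
  shows "vn_entropy X \<rho> = vn_entropy X \<rho>'"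
proof -
  have "enum_of X i \<in> X" if "i < card X" for i
    using bij_betwE[OF bij_enum_of[OF assms(1)]] that by auto
  then have "mat_of_qop X \<rho> = mat_of_qop X \<rho>'"
    unfolding mat_of_qop_def by (intro eq_matI) (auto simp: assms(2))
  then show ?thesis by (simp add: vn_entropy_def eigenvalues_qop_def)
qed

lemma psd_relabel:
  assumes "psd_on X \<rho>" "bij_betw f X X'" "\<And>x x'. x \<in> X \<Longrightarrow> x' \<in> X \<Longrightarrow> \<rho>' (f x) (f x') = \<rho> x x'"
  shows "psd_on X' \<rho>'"
proof -
  have "quad_form X' \<rho>' v = quad_form X \<rho> (\<lambda>x. v (f x))" for v
    unfolding quad_form_def sum.reindex_bij_betw[OF assms(2), symmetric] by (intro sum.cong refl) (simp add: assms(3))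
  then show ?thesis using assms(1) unfolding psd_on_iff_quad_form by simp
qed

lemma mutual_info_relabel:
  assumes fin: "finite Y" "finite R" and psd: "psd_on (Y \<times> R) \<rho>" and g: "bij_betw g Y Y'" and h: "bij_betw h R R'"
    and eq: "\<And>y y' r r'. y \<in> Y \<Longrightarrow> y' \<in> Y \<Longrightarrow> r \<in> R \<Longrightarrow> r' \<in> R \<Longrightarrow> \<rho>' (g y, h r) (g y', h r') = \<rho> (y, r) (y', r')"
  shows "mutual_info Y' R' \<rho>' = mutual_info Y R \<rho>"
proof -
  note m = psd_marginals[OF fin psd]
  have "vn_entropy R' (ptrace_out Y' \<rho>') = vn_entropy R (ptrace_out Y \<rho>)"
    by (rule vn_entropy_relabel[OF fin(2) m(2) h])
       (simp add: ptrace_out_def sum.reindex_bij_betw[OF g, symmetric] eq)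
  moreover have "vn_entropy Y' (ptrace_ref R' \<rho>') = vn_entropy Y (ptrace_ref R \<rho>)"
    by (rule vn_entropy_relabel[OF fin(1) m(1) g])
       (simp add: ptrace_ref_def sum.reindex_bij_betw[OF h, symmetric] eq)
  moreover have "vn_entropy (Y' \<times> R') \<rho>' = vn_entropy (Y \<times> R) \<rho>"
  proof (rule vn_entropy_relabel[OF _ psd])
    show "bij_betw (map_prod g h) (Y \<times> R) (Y' \<times> R')" by (rule bij_betw_map_prod[OF g h])
  qed (use fin eq in auto)
  ultimately show ?thesis by (simp add: mutual_info_def)
qed

lemma mutual_info_cong:
  assumes fin: "finite Y" "finite R"
    and eq: "\<And>y y' r r'. y \<in> Y \<Longrightarrow> y' \<in> Y \<Longrightarrow> r \<in> R \<Longrightarrow> r' \<in> R \<Longrightarrow> \<rho> (y, r) (y', r') = \<rho>' (y, r) (y', r')"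
  shows "mutual_info Y R \<rho> = mutual_info Y R \<rho>'"
proof -
  have "vn_entropy R (ptrace_out Y \<rho>) = vn_entropy R (ptrace_out Y \<rho>')"
    by (rule vn_entropy_cong[OF fin(2)]) (simp add: ptrace_out_def eq)
  moreover have "vn_entropy Y (ptrace_ref R \<rho>) = vn_entropy Y (ptrace_ref R \<rho>')"
    by (rule vn_entropy_cong[OF fin(1)]) (simp add: ptrace_ref_def eq)
  moreover have "vn_entropy (Y \<times> R) \<rho> = vn_entropy (Y \<times> R) \<rho>'"
    by (rule vn_entropy_cong) (use fin eq in auto)
  ultimately show ?thesis by (simp add: mutual_info_def)
qed

lemma vn_entropy_prod:
  assumes fin: "finite Z" "finite X" and psd: "psd_on Z \<sigma>" "psd_on X \<tau>"
    and tr: "(\<Sum>z\<in>Z. \<sigma> z z) = 1" "(\<Sum>x\<in>X. \<tau> x x) = 1"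
  shows "vn_entropy (Z \<times> X) (prod_op \<sigma> \<tau>) = vn_entropy Z \<sigma> + vn_entropy X \<tau>"
proof -
  obtain J :: "nat set" and a \<alpha> where a: "psd_eig Z J a \<alpha> \<sigma>" using psd_on_spectral[OF fin(1) psd(1)] by blast
  obtain K :: "nat set" and b \<beta> where b: "psd_eig X K b \<beta> \<tau>" using psd_on_spectral[OF fin(2) psd(2)] by blast
  have sa: "(\<Sum>j\<in>J. \<alpha> j) = 1" using psd_eig_trace[OF a] tr(1) by (metis of_real_eq_1_iff)
  have sb: "(\<Sum>k\<in>K. \<beta> k) = 1" using psd_eig_trace[OF b] tr(2) by (metis of_real_eq_1_iff)
  have "vn_entropy (Z \<times> X) (prod_op \<sigma> \<tau>) = (\<Sum>j\<in>J. \<Sum>k\<in>K. - (\<alpha> j * \<beta> k) * log 2 (\<alpha> j * \<beta> k))"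
    unfolding vn_entropy_spectral[OF psd_eig_spectral[OF psd_eig_prod[OF a b]]] by (simp add: sum.cartesian_product')
  also have "\<dots> = (\<Sum>j\<in>J. \<Sum>k\<in>K. (- \<alpha> j * log 2 (\<alpha> j)) * \<beta> k + \<alpha> j * (- \<beta> k * log 2 (\<beta> k)))"
  proof (intro sum.cong refl)
    fix j k assume "j \<in> J" "k \<in> K"
    then have nn: "0 \<le> \<alpha> j" "0 \<le> \<beta> k" using psd_eig_nonneg[OF a] psd_eig_nonneg[OF b] by auto
    show "- (\<alpha> j * \<beta> k) * log 2 (\<alpha> j * \<beta> k) = (- \<alpha> j * log 2 (\<alpha> j)) * \<beta> k + \<alpha> j * (- \<beta> k * log 2 (\<beta> k))"
    proof (cases "\<alpha> j = 0 \<or> \<beta> k = 0")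
      case False
      then have "log 2 (\<alpha> j * \<beta> k) = log 2 (\<alpha> j) + log 2 (\<beta> k)" using nn by (simp add: log_mult)
      then show ?thesis by (simp add: algebra_simps)
    qed auto
  qed
  also have "\<dots> = (\<Sum>j\<in>J. - \<alpha> j * log 2 (\<alpha> j)) * (\<Sum>k\<in>K. \<beta> k) + (\<Sum>j\<in>J. \<alpha> j) * (\<Sum>k\<in>K. - \<beta> k * log 2 (\<beta> k))"
    by (simp only: sum_product sum.distrib)
  finally show ?thesis
    unfolding vn_entropy_spectral[OF psd_eig_spectral[OF a]] vn_entropy_spectral[OF psd_eig_spectral[OF b]] sa sb by simp
qed

lemma trace_marginals:
  shows "(\<Sum>z\<in>Z. ptrace_ref X \<rho> z z) = (\<Sum>t\<in>Z \<times> X. \<rho> t t)"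
    and "(\<Sum>x\<in>X. ptrace_out Z \<rho> x x) = (\<Sum>t\<in>Z \<times> X. \<rho> t t)"
  unfolding ptrace_ref_def ptrace_out_def sum.cartesian_product' by (rule refl, rule sum.swap)

lemma psd_prod_op:
  assumes "finite Z" "finite X" "psd_on Z \<sigma>" "psd_on X \<tau>"
  shows "psd_on (Z \<times> X) (prod_op \<sigma> \<tau>)"
proof -
  obtain J :: "nat set" and a \<alpha> where a: "psd_eig Z J a \<alpha> \<sigma>" using psd_on_spectral[OF assms(1,3)] by blast
  obtain K :: "nat set" and b \<beta> where b: "psd_eig X K b \<beta> \<tau>" using psd_on_spectral[OF assms(2,4)] by blast
  show ?thesis using psd_eig_prod[OF a b] psd_decomp_psd_on unfolding psd_eig_def by blast
qed

lemma mutual_info_prod: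
  assumes fin: "finite Y1" "finite R1" "finite Y2" "finite R2"
    and psd: "psd_on (Y1 \<times> R1) \<rho>1" "psd_on (Y2 \<times> R2) \<rho>2"
    and tr: "(\<Sum>t\<in>Y1 \<times> R1. \<rho>1 t t) = 1" "(\<Sum>t\<in>Y2 \<times> R2. \<rho>2 t t) = 1"
  shows "mutual_info (Y1 \<times> Y2) (R1 \<times> R2)
      (\<lambda>((y1, y2), (r1, r2)) ((y1', y2'), (r1', r2')). \<rho>1 (y1, r1) (y1', r1') * \<rho>2 (y2, r2) (y2', r2'))
      = mutual_info Y1 R1 \<rho>1 + mutual_info Y2 R2 \<rho>2"
proof -
  define \<rho> where "\<rho> = (\<lambda>((y1, y2), (r1, r2)) ((y1', y2'), (r1', r2')). \<rho>1 (y1, r1) (y1', r1') * \<rho>2 (y2, r2) (y2', r2'))"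
  note m1 = psd_marginals[OF fin(1,2) psd(1)] and m2 = psd_marginals[OF fin(3,4) psd(2)]
  have o: "ptrace_out (Y1 \<times> Y2) \<rho> = prod_op (ptrace_out Y1 \<rho>1) (ptrace_out Y2 \<rho>2)"
    by (auto simp: fun_eq_iff ptrace_out_def \<rho>_def prod_op_def sum_product sum.cartesian_product')
  have r: "ptrace_ref (R1 \<times> R2) \<rho> = prod_op (ptrace_ref R1 \<rho>1) (ptrace_ref R2 \<rho>2)"
    by (auto simp: fun_eq_iff ptrace_ref_def \<rho>_def prod_op_def sum_product sum.cartesian_product')
  have "vn_entropy (R1 \<times> R2) (ptrace_out (Y1 \<times> Y2) \<rho>) = vn_entropy R1 (ptrace_out Y1 \<rho>1) + vn_entropy R2 (ptrace_out Y2 \<rho>2)"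
    unfolding o using tr by (intro vn_entropy_prod fin m1 m2) (simp_all add: trace_marginals)
  moreover have "vn_entropy (Y1 \<times> Y2) (ptrace_ref (R1 \<times> R2) \<rho>) = vn_entropy Y1 (ptrace_ref R1 \<rho>1) + vn_entropy Y2 (ptrace_ref R2 \<rho>2)"
    unfolding r using tr by (intro vn_entropy_prod fin m1 m2) (simp_all add: trace_marginals)
  moreover have "vn_entropy ((Y1 \<times> Y2) \<times> (R1 \<times> R2)) \<rho> = vn_entropy ((Y1 \<times> R1) \<times> (Y2 \<times> R2)) (prod_op \<rho>1 \<rho>2)"
  proof (rule vn_entropy_relabel[OF _ psd_prod_op[OF _ _ psd]])
    show "bij_betw (\<lambda>((y1, r1), (y2, r2)). ((y1, y2), (r1, r2))) ((Y1 \<times> R1) \<times> (Y2 \<times> R2)) ((Y1 \<times> Y2) \<times> (R1 \<times> R2))"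
      by (rule bij_betwI[where g = "\<lambda>((y1, y2), (r1, r2)). ((y1, r1), (y2, r2))"]) auto
  qed (use fin in \<open>auto simp: \<rho>_def prod_op_def\<close>)
  moreover have "vn_entropy ((Y1 \<times> R1) \<times> (Y2 \<times> R2)) (prod_op \<rho>1 \<rho>2) = vn_entropy (Y1 \<times> R1) \<rho>1 + vn_entropy (Y2 \<times> R2) \<rho>2"
    by (intro vn_entropy_prod psd tr finite_cartesian_product fin)
  ultimately show ?thesis unfolding \<rho>_def[symmetric] mutual_info_def by simp
qed

lemma op_app_decomp:
  assumes "psd_decomp X M s r \<rho>" "x \<in> X"
  shows "op_app X \<rho> f x = (\<Sum>m\<in>M. of_real (r m) * s m x * ip_on X (s m) f)"
proof -
  have "op_app X \<rho> f x = (\<Sum>x'\<in>X. \<Sum>m\<in>M. of_real (r m) * s m x * (cnj (s m x') * f x'))"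
    unfolding op_app_def
    by (intro sum.cong refl) (simp add: psd_decomp_eq[OF assms(1)] assms(2) sum_distrib_left sum_distrib_right mult_ac)
  also have "\<dots> = (\<Sum>m\<in>M. of_real (r m) * s m x * ip_on X (s m) f)"
    by (subst sum.swap) (simp add: ip_on_def sum_distrib_left)
  finally show ?thesis .
qed

lemma vn_entropy_nonneg:
  assumes "finite X" "psd_on X \<rho>" "(\<Sum>x\<in>X. \<rho> x x) = 1"
  shows "0 \<le> vn_entropy X \<rho>"
proof -
  obtain I :: "nat set" and u p where r: "psd_eig X I u p \<rho>" using psd_on_spectral[OF assms(1,2)] by blast
  have fin: "finite I" using r onb_finite unfolding psd_eig_def by blast
  have s: "(\<Sum>i\<in>I. p i) = 1" using psd_eig_trace[OF r] assms(3) by (metis of_real_eq_1_iff)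
  have "0 \<le> - p i * log 2 (p i)" if i: "i \<in> I" for i
  proof -
    have "0 \<le> p i" using psd_eig_nonneg[OF r i] .
    moreover have "p i \<le> 1" unfolding s[symmetric]
      by (rule member_le_sum) (use i fin psd_eig_nonneg[OF r] in auto)
    ultimately have "log 2 (p i) \<le> 0 \<or> p i = 0" by (auto simp: log_le_zero_cancel_iff)
    then show ?thesis using \<open>0 \<le> p i\<close> by (auto simp: mult_nonneg_nonpos)
  qed
  then show ?thesis unfolding vn_entropy_spectral[OF psd_eig_spectral[OF r]] by (intro sum_nonneg)
qed

text \<open>The vectors \<open>w i\<close> in the proof are the Schmidt partners of the eigenvectors with positive eigenvalue; they are orthonormal in a space of dimension \<open>card M\<close>, so there are at most \<open>card M\<close> of them.\<close>
lemma vn_entropy_le_log_card: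
  assumes fin: "finite X" and d: "psd_decomp X M s r \<rho>" and tr: "(\<Sum>x\<in>X. \<rho> x x) = 1"
  shows "vn_entropy X \<rho> \<le> log 2 (card M)"
proof -
  obtain I :: "nat set" and u p where sp: "psd_eig X I u p \<rho>" using psd_on_spectral[OF fin psd_decomp_psd_on[OF d]] by blast
  have o: "onb X I u" and du: "psd_decomp X I u p \<rho>" using sp unfolding psd_eig_def by blast+
  have finI: "finite I" using onb_finite[OF o] by blast
  have p0: "\<And>i. i \<in> I \<Longrightarrow> 0 \<le> p i" using psd_eig_nonneg[OF sp] .
  have r0: "\<And>m. m \<in> M \<Longrightarrow> 0 \<le> r m" and finM: "finite M" using d unfolding psd_decomp_def by blast+
  have sum1: "(\<Sum>i\<in>I. p i) = 1" using psd_eig_trace[OF sp] tr by (metis of_real_eq_1_iff)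
  define I' where "I' = {i \<in> I. p i > 0}"
  have finI': "finite I'" using finI by (simp add: I'_def)
  have sum1': "(\<Sum>i\<in>I'. p i) = 1"
  proof -
    have "(\<Sum>i\<in>I'. p i) = (\<Sum>i\<in>I. p i)"
      by (rule sum.mono_neutral_left[OF finI]) (use p0 in \<open>auto simp: I'_def not_less antisym\<close>)
    then show ?thesis using sum1 by simp
  qed
  define w where "w = (\<lambda>i m. of_real (sqrt (r m) / sqrt (p i)) * ip_on X (s m) (u i))"
  have on: "orthonormal M I' w"
  proof -
    have "ip_on M (w i) (w j) = (if i = j then 1 else 0)" if ij: "i \<in> I'" "j \<in> I'" for i j
    proof -
      have pp: "p i > 0" "p j > 0" "i \<in> I" "j \<in> I" using ij by (auto simp: I'_def)
      have "ip_on M (w i) (w j) = (\<Sum>m\<in>M. of_real (1 / sqrt (p i) / sqrt (p j)) * (of_real (r m) * (ip_on X (u i) (s m) * ip_on X (s m) (u j))))"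
        unfolding ip_on_def[of M] w_def
      proof (intro sum.cong refl)
        fix m assume "m \<in> M"
        then have "complex_of_real (sqrt (r m)) * of_real (sqrt (r m)) = of_real (r m)"
          using r0 by (simp only: of_real_mult[symmetric] real_sqrt_mult_self abs_of_nonneg)
        then show "cnj (of_real (sqrt (r m) / sqrt (p i)) * ip_on X (s m) (u i)) * (of_real (sqrt (r m) / sqrt (p j)) * ip_on X (s m) (u j))
          = of_real (1 / sqrt (p i) / sqrt (p j)) * (of_real (r m) * (ip_on X (u i) (s m) * ip_on X (s m) (u j)))"
          by (simp add: cnj_ip_on mult_ac)
      qed
      also have "\<dots> = of_real (1 / sqrt (p i) / sqrt (p j)) * ip_on X (u i) (\<lambda>x. \<Sum>m\<in>M. (of_real (r m) * ip_on X (s m) (u j)) * s m x)"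
        unfolding ip_on_sum_right ip_on_scale_right sum_distrib_left by (simp only: mult_ac)
      also have "ip_on X (u i) (\<lambda>x. \<Sum>m\<in>M. (of_real (r m) * ip_on X (s m) (u j)) * s m x) = ip_on X (u i) (op_app X \<rho> (u j))"
        by (rule ip_on_cong) (simp_all add: op_app_decomp[OF d] mult_ac)
      also have "\<dots> = ip_on X (u i) (\<lambda>x. \<Sum>m\<in>I. (of_real (p m) * ip_on X (u m) (u j)) * u m x)"
        by (rule ip_on_cong) (simp_all add: op_app_decomp[OF du] mult_ac)
      also have "\<dots> = (\<Sum>m\<in>I. of_real (p m) * ip_on X (u m) (u j) * ip_on X (u i) (u m))"
        unfolding ip_on_sum_right ip_on_scale_right ..
      also have "\<dots> = (\<Sum>m\<in>I. of_real (p m) * (if i = j then 1 else 0) * (if m = i then 1 else 0))"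
        using o pp by (intro sum.cong refl) (auto simp: onb_def orthonormal_def)
      also have "\<dots> = of_real (p i) * (if i = j then 1 else 0)"
        using finI pp by (simp add: sum_delta_mult)
      finally have "ip_on M (w i) (w j) = of_real (1 / sqrt (p i) / sqrt (p j)) * (of_real (p i) * (if i = j then 1 else 0))" .
      moreover have "1 / sqrt (p i) / sqrt (p i) * p i = 1" using pp by simp
      then have "complex_of_real (1 / sqrt (p i) / sqrt (p i)) * of_real (p i) = 1"
        by (simp only: of_real_mult[symmetric] of_real_1)
      ultimately show ?thesis
        by (cases "i = j") (simp_all only: simp_thms if_True if_False mult.right_neutral mult_zero_right)
    qed
    then show ?thesis using finM finI' unfolding orthonormal_def by blast
  qed
  have card: "card I' \<le> card M" using orthonormal_card_le[OF on] .
  have "I' \<noteq> {}" using sum1' by auto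
  then have n0: "0 < card I'" using finI' by (simp add: card_gt_0_iff)
  define n where "n = real (card I')"
  have n: "n > 0" using n0 by (simp add: n_def)
  have "(\<Sum>i\<in>I. - p i * ln (p i)) = (\<Sum>i\<in>I'. - p i * ln (p i))"
    by (rule sum.mono_neutral_right[OF finI]) (use p0 in \<open>auto simp: I'_def not_less antisym\<close>)
  also have "\<dots> \<le> (\<Sum>i\<in>I'. p i * ln n + (1 / n - p i))"
  proof (rule sum_mono)
    fix i assume "i \<in> I'"
    then have p: "p i > 0" by (simp add: I'_def)
    have "ln (1 / (n * p i)) \<le> 1 / (n * p i) - 1" using n p by (intro ln_le_minus_one) simp
    then have "- ln n - ln (p i) \<le> 1 / (n * p i) - 1" using n p by (simp add: ln_div ln_mult)
    then have "p i * (- ln n - ln (p i)) \<le> p i * (1 / (n * p i) - 1)" using p by (intro mult_left_mono) auto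
    also have "p i * (1 / (n * p i) - 1) = 1 / n - p i" using p n by (simp add: field_simps)
    finally show "- p i * ln (p i) \<le> p i * ln n + (1 / n - p i)" by (simp add: algebra_simps)
  qed
  also have "\<dots> = ln n"
    using n by (simp add: sum.distrib sum_subtractf sum_distrib_right[symmetric] sum1' n_def)
  also have "\<dots> \<le> ln (card M)" using card n0 by (simp add: n_def)
  finally have le: "(\<Sum>i\<in>I. - p i * ln (p i)) \<le> ln (card M)" .
  have "vn_entropy X \<rho> = (\<Sum>i\<in>I. - p i * ln (p i)) / ln 2"
    unfolding vn_entropy_spectral[OF psd_eig_spectral[OF sp]] by (simp add: log_def sum_divide_distrib)
  also have "\<dots> \<le> ln (card M) / ln 2" using le by (intro divide_right_mono) auto
  finally show ?thesis by (simp add: log_def)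
qed

lemma mutual_info_le:
  assumes fin: "finite Y" "finite R" and psd: "psd_on (Y \<times> R) \<rho>" and tr: "(\<Sum>t\<in>Y \<times> R. \<rho> t t) = 1"
    and d: "psd_decomp R M s r (ptrace_out Y \<rho>)"
  shows "mutual_info Y R \<rho> \<le> log 2 (card M) + log 2 (card Y)"
proof -
  note m = psd_marginals[OF fin psd]
  obtain I :: "nat set" and u p where sp: "psd_eig Y I u p (ptrace_ref R \<rho>)" using psd_on_spectral[OF fin(1) m(1)] by blast
  have o: "onb Y I u" and du: "psd_decomp Y I u p (ptrace_ref R \<rho>)" using sp unfolding psd_eig_def by blast+
  have "vn_entropy Y (ptrace_ref R \<rho>) \<le> log 2 (card Y)"
    using vn_entropy_le_log_card[OF fin(1) du] onb_card[OF o] tr by (simp add: trace_marginals)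
  moreover have "vn_entropy R (ptrace_out Y \<rho>) \<le> log 2 (card M)"
    using vn_entropy_le_log_card[OF fin(2) d] tr by (simp add: trace_marginals)
  moreover have "0 \<le> vn_entropy (Y \<times> R) \<rho>" using vn_entropy_nonneg[OF _ psd tr] fin by simp
  ultimately show ?thesis unfolding mutual_info_def by linarith
qed

text \<open>I(Y1Y2;R) = I(Y1;R) + I(Y2;RY1) - I(Y1;Y2), and the last term is nonnegative.\<close>
lemma mutual_info_chain:
  assumes fin: "finite Y1" "finite Y2" "finite R" and psd: "psd_on ((Y1 \<times> Y2) \<times> R) \<rho>"
    and tr: "(\<Sum>t\<in>(Y1 \<times> Y2) \<times> R. \<rho> t t) = 1"
  shows "mutual_info (Y1 \<times> Y2) R \<rho>
    \<le> mutual_info Y1 R (\<lambda>(y1, r) (y1', r'). \<Sum>y2\<in>Y2. \<rho> ((y1, y2), r) ((y1', y2), r'))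
      + mutual_info Y2 (R \<times> Y1) (\<lambda>(y2, r, y1) (y2', r', y1'). \<rho> ((y1, y2), r) ((y1', y2'), r'))"
proof -
  define \<mu> where "\<mu> = (\<lambda>(y1, r) (y1', r'). \<Sum>y2\<in>Y2. \<rho> ((y1, y2), r) ((y1', y2), r'))"
  define \<nu> where "\<nu> = (\<lambda>(y2, r, y1) (y2', r', y1'). \<rho> ((y1, y2), r) ((y1', y2'), r'))"
  define \<beta> where "\<beta> = ptrace_ref R \<rho>"
  have f12: "finite (Y1 \<times> Y2)" using fin by simp
  have psd_\<beta>: "psd_on (Y1 \<times> Y2) \<beta>" unfolding \<beta>_def by (rule psd_marginals(1)[OF f12 fin(3) psd])
  have bij: "bij_betw (\<lambda>((y1, y2), r). (y2, r, y1)) ((Y1 \<times> Y2) \<times> R) (Y2 \<times> R \<times> Y1)"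
    by (rule bij_betwI[where g = "\<lambda>(y2, r, y1). ((y1, y2), r)"]) auto
  have \<nu>: "vn_entropy (Y2 \<times> R \<times> Y1) \<nu> = vn_entropy ((Y1 \<times> Y2) \<times> R) \<rho>"
    by (rule vn_entropy_relabel[OF _ psd bij]) (use fin in \<open>auto simp: \<nu>_def\<close>)
  have psd_\<nu>: "psd_on (Y2 \<times> R \<times> Y1) \<nu>"
    by (rule psd_relabel[OF psd bij]) (auto simp: \<nu>_def)
  have psd_o: "psd_on (R \<times> Y1) (ptrace_out Y2 \<nu>)"
    by (rule psd_marginals(2)[OF _ _ psd_\<nu>]) (use fin in auto)
  have \<mu>: "vn_entropy (Y1 \<times> R) \<mu> = vn_entropy (R \<times> Y1) (ptrace_out Y2 \<nu>)"
  proof (rule vn_entropy_relabel[OF _ psd_o])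
    show "bij_betw prod.swap (R \<times> Y1) (Y1 \<times> R)" by (rule bij_betwI[where g = prod.swap]) auto
  qed (use fin in \<open>auto simp: ptrace_out_def \<nu>_def \<mu>_def\<close>)
  have "ptrace_out (Y1 \<times> Y2) \<rho> = ptrace_out Y1 \<mu>"
    by (auto simp: fun_eq_iff ptrace_out_def \<mu>_def sum.cartesian_product')
  moreover have "ptrace_ref R \<mu> = ptrace_ref Y2 \<beta>"
    by (auto simp: fun_eq_iff ptrace_ref_def \<mu>_def \<beta>_def intro: sum.swap)
  moreover have "ptrace_ref (R \<times> Y1) \<nu> = ptrace_out Y1 \<beta>"
    by (auto simp: fun_eq_iff ptrace_ref_def ptrace_out_def \<nu>_def \<beta>_def sum.cartesian_product' intro: sum.swap)
  moreover have "0 \<le> mutual_info Y1 Y2 \<beta>"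
    by (rule mutual_info_nonneg[OF fin(1,2) psd_\<beta>]) (simp add: \<beta>_def trace_marginals tr)
  ultimately show ?thesis
    unfolding mutual_info_def \<mu>_def[symmetric] \<nu>_def[symmetric] \<beta>_def[symmetric] \<mu> \<nu> by simp
qed

definition pure_output :: "'x set \<Rightarrow> ('x \<Rightarrow> 'x \<Rightarrow> 'y qop) \<Rightarrow> ('x \<times> 'r \<Rightarrow> complex) \<Rightarrow> ('y \<times> 'r) qop" where
  "pure_output X J \<psi> = apply_map_ref X J (\<lambda>(x, r) (x', r'). \<psi> (x, r) * cnj (\<psi> (x', r')))"

lemma pure_output_eq: "pure_output X J \<psi> (y, r) (y', r') = (\<Sum>x\<in>X. \<Sum>x'\<in>X. \<psi> (x, r) * cnj (\<psi> (x', r')) * J x x' y y')"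
  by (simp add: pure_output_def apply_map_ref_def)

definition is_kraus :: "'x set \<Rightarrow> 'y set \<Rightarrow> ('x \<Rightarrow> 'x \<Rightarrow> 'y qop) \<Rightarrow> 'e set \<Rightarrow> ('e \<Rightarrow> 'y \<Rightarrow> 'x \<Rightarrow> complex) \<Rightarrow> bool" where
  "is_kraus X Y J E K \<longleftrightarrow> finite E \<and>
     (\<forall>x\<in>X. \<forall>x'\<in>X. \<forall>y\<in>Y. \<forall>y'\<in>Y. J x x' y y' = (\<Sum>e\<in>E. K e y x * cnj (K e y' x')))"

lemma is_kraus_eq: "is_kraus X Y J E K \<Longrightarrow> x \<in> X \<Longrightarrow> x' \<in> X \<Longrightarrow> y \<in> Y \<Longrightarrow> y' \<in> Y \<Longrightarrow>
    J x x' y y' = (\<Sum>e\<in>E. K e y x * cnj (K e y' x'))"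
  unfolding is_kraus_def by blast

lemma kraus_tpI:
  assumes k: "is_kraus X Y J E K" and tp: "trace_preserving X Y J"
  shows "kraus_tp X Y E K"
  unfolding kraus_tp_def
proof (intro ballI)
  fix x x' assume x: "x \<in> X" "x' \<in> X"
  have "(\<Sum>e\<in>E. \<Sum>y\<in>Y. cnj (K e y x) * K e y x') = (\<Sum>y\<in>Y. J x' x y y)"
    by (subst sum.swap) (simp add: is_kraus_eq[OF k] x mult.commute)
  also have "\<dots> = (if x = x' then 1 else 0)" using tp x by (auto simp: trace_preserving_def)
  finally show "(\<Sum>e\<in>E. \<Sum>y\<in>Y. cnj (K e y x) * K e y x') = (if x = x' then 1 else 0)" .
qed

lemma pure_output_decomp:
  assumes k: "is_kraus X Y J E K"
  shows "psd_decomp (Y \<times> R) E (\<lambda>e (y, r). \<Sum>x\<in>X. K e y x * \<psi> (x, r)) (\<lambda>_. 1) (pure_output X J \<psi>)"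
proof -
  have "pure_output X J \<psi> (y, r) (y', r') = (\<Sum>e\<in>E. (\<Sum>x\<in>X. K e y x * \<psi> (x, r)) * cnj (\<Sum>x\<in>X. K e y' x * \<psi> (x, r')))"
    if y: "y \<in> Y" "y' \<in> Y" for y y' r r'
  proof -
    have "pure_output X J \<psi> (y, r) (y', r') = (\<Sum>x\<in>X. \<Sum>x'\<in>X. \<Sum>e\<in>E. (K e y x * \<psi> (x, r)) * (cnj (K e y' x') * cnj (\<psi> (x', r'))))"
      unfolding pure_output_eq by (intro sum.cong refl) (simp add: is_kraus_eq[OF k] y sum_distrib_left mult_ac)
    also have "\<dots> = (\<Sum>e\<in>E. \<Sum>x\<in>X. \<Sum>x'\<in>X. (K e y x * \<psi> (x, r)) * (cnj (K e y' x') * cnj (\<psi> (x', r'))))"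
      by (rule sum_rotate[symmetric])
    finally show ?thesis unfolding cnj_sum sum_product by simp
  qed
  then show ?thesis using k unfolding psd_decomp_def is_kraus_def by auto
qed

lemma pure_output_psd: "is_kraus X Y J E K \<Longrightarrow> psd_on (Y \<times> R) (pure_output X J \<psi>)"
  by (rule psd_decomp_psd_on[OF pure_output_decomp])

lemma ptrace_out_pure_output:
  assumes tp: "trace_preserving X Y J" and fin: "finite X"
  shows "ptrace_out Y (pure_output X J \<psi>) r r' = (\<Sum>x\<in>X. \<psi> (x, r) * cnj (\<psi> (x, r')))"
proof -
  have "ptrace_out Y (pure_output X J \<psi>) r r' = (\<Sum>x\<in>X. \<Sum>y\<in>Y. \<Sum>x'\<in>X. \<psi> (x, r) * cnj (\<psi> (x', r')) * J x x' y y)"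
    unfolding ptrace_out_def pure_output_eq by (rule sum.swap)
  also have "\<dots> = (\<Sum>x\<in>X. \<Sum>x'\<in>X. \<Sum>y\<in>Y. \<psi> (x, r) * cnj (\<psi> (x', r')) * J x x' y y)"
    by (intro sum.cong refl sum.swap)
  also have "\<dots> = (\<Sum>x\<in>X. \<Sum>x'\<in>X. \<psi> (x, r) * cnj (\<psi> (x', r')) * (if x = x' then 1 else 0))"
    using tp by (simp add: sum_distrib_left[symmetric] trace_preserving_def)
  finally show ?thesis by (simp add: sum_delta_mult fin)
qed

lemma pure_output_trace:
  assumes "trace_preserving X Y J" "finite X"
  shows "(\<Sum>t\<in>Y \<times> R. pure_output X J \<psi> t t) = of_real (\<Sum>x\<in>X. \<Sum>r\<in>R. (cmod (\<psi> (x, r)))\<^sup>2)"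
proof -
  have "(\<Sum>t\<in>Y \<times> R. pure_output X J \<psi> t t) = (\<Sum>r\<in>R. \<Sum>x\<in>X. \<psi> (x, r) * cnj (\<psi> (x, r)))"
    unfolding trace_marginals(2)[symmetric] ptrace_out_pure_output[OF assms] ..
  also have "\<dots> = (\<Sum>x\<in>X. \<Sum>r\<in>R. of_real ((cmod (\<psi> (x, r)))\<^sup>2))"
    unfolding cmod2 by (subst sum.swap) (simp add: mult.commute)
  finally show ?thesis by simp
qed

lemma mutual_info_pure_output_le:
  assumes k: "is_kraus X Y J E K" and tp: "trace_preserving X Y J" and fin: "finite X" "finite Y" "finite R"
    and n: "(\<Sum>x\<in>X. \<Sum>r\<in>R. (cmod (\<psi> (x, r)))\<^sup>2) = 1"
  shows "mutual_info Y R (pure_output X J \<psi>) \<le> log 2 (card X) + log 2 (card Y)"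
proof (rule mutual_info_le[OF fin(2,3) pure_output_psd[OF k]])
  show "(\<Sum>t\<in>Y \<times> R. pure_output X J \<psi> t t) = 1" using pure_output_trace[OF tp fin(1), where R = R and \<psi> = \<psi>] n by simp
  show "psd_decomp R X (\<lambda>x r. \<psi> (x, r)) (\<lambda>_. 1) (ptrace_out Y (pure_output X J \<psi>))"
    unfolding psd_decomp_def using fin(1) by (simp add: ptrace_out_pure_output[OF tp fin(1)])
qed

definition tensor_map :: "('x1 \<Rightarrow> 'x1 \<Rightarrow> 'y1 qop) \<Rightarrow> ('x2 \<Rightarrow> 'x2 \<Rightarrow> 'y2 qop) \<Rightarrow>
    'x1 \<times> 'x2 \<Rightarrow> 'x1 \<times> 'x2 \<Rightarrow> ('y1 \<times> 'y2) qop" where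
  "tensor_map J1 J2 = (\<lambda>(x1, x2) (x1', x2') (y1, y2) (y1', y2'). J1 x1 x1' y1 y1' * J2 x2 x2' y2 y2')"

lemma tensor_map_tp:
  assumes "trace_preserving X1 Y1 J1" "trace_preserving X2 Y2 J2"
  shows "trace_preserving (X1 \<times> X2) (Y1 \<times> Y2) (tensor_map J1 J2)"
  using assms unfolding trace_preserving_def tensor_map_def
  by (auto simp: sum.cartesian_product' sum_product[symmetric])

lemma tensor_map_kraus:
  assumes "is_kraus X1 Y1 J1 E1 K1" "is_kraus X2 Y2 J2 E2 K2"
  shows "is_kraus (X1 \<times> X2) (Y1 \<times> Y2) (tensor_map J1 J2) (E1 \<times> E2) (\<lambda>(e1, e2) (y1, y2) (x1, x2). K1 e1 y1 x1 * K2 e2 y2 x2)"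
  using assms unfolding is_kraus_def tensor_map_def
  by (auto simp: sum.cartesian_product' sum_product mult_ac)

lemma ptrace_kraus_tp:
  assumes "finite R" "finite X"
  shows "kraus_tp (R \<times> X) R X (\<lambda>a r (r', a'). if r = r' \<and> a = a' then 1 else 0)"
  unfolding kraus_tp_def
proof (intro ballI)
  fix t t' assume "t \<in> R \<times> X" "t' \<in> R \<times> X"
  then obtain r a r' a' where t: "t = (r, a)" "t' = (r', a')" "r \<in> R" "a \<in> X" by auto
  have "(\<Sum>e\<in>X. \<Sum>y\<in>R. cnj (case t of (r', a') \<Rightarrow> if y = r' \<and> e = a' then 1 else 0) * (case t' of (r', a') \<Rightarrow> if y = r' \<and> e = a' then 1 else 0))
     = (\<Sum>e\<in>X. (\<Sum>y\<in>R. (if t = t' then 1 else 0) * (if y = r then 1 else 0)) * (if e = a then 1 else (0::complex)))"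
    unfolding sum_distrib_right t by (intro sum.cong refl) auto
  also have "\<dots> = (if t = t' then 1 else 0)" using t by (simp add: sum_delta_mult assms)
  finally show "(\<Sum>e\<in>X. \<Sum>y\<in>R. cnj (case t of (r', a') \<Rightarrow> if y = r' \<and> e = a' then 1 else 0) * (case t' of (r', a') \<Rightarrow> if y = r' \<and> e = a' then 1 else 0))
     = (if t = t' then 1 else (0::complex))" .
qed

text \<open>Each channel use is fed the marginal input; its purifying reference also contains the inputs of the other use.  The two terms of \<open>mutual_info_chain\<close> arise from these by tracing out \<open>X2\<close> and by applying \<open>J1\<close> to \<open>X1\<close>.\<close>
lemma mutual_info_tensor_map_le:
  fixes \<psi> :: "('x1 \<times> 'x2) \<times> 'r \<Rightarrow> complex"
  assumes k1: "is_kraus X1 Y1 J1 E1 K1" and tp1: "trace_preserving X1 Y1 J1"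
    and k2: "is_kraus X2 Y2 J2 E2 K2" and tp2: "trace_preserving X2 Y2 J2"
    and fin: "finite X1" "finite Y1" "finite X2" "finite Y2" "finite R"
    and n: "(\<Sum>x\<in>X1 \<times> X2. \<Sum>r\<in>R. (cmod (\<psi> (x, r)))\<^sup>2) = 1"
  shows "mutual_info (Y1 \<times> Y2) R (pure_output (X1 \<times> X2) (tensor_map J1 J2) \<psi>)
    \<le> mutual_info Y1 (R \<times> X2) (pure_output X1 J1 (\<lambda>(x1, r, x2). \<psi> ((x1, x2), r)))
     + mutual_info Y2 (R \<times> X1) (pure_output X2 J2 (\<lambda>(x2, r, x1). \<psi> ((x1, x2), r)))"
proof -
  define \<rho> where "\<rho> = pure_output (X1 \<times> X2) (tensor_map J1 J2) \<psi>"
  define \<rho>1 where "\<rho>1 = pure_output X1 J1 (\<lambda>(x1, r, x2). \<psi> ((x1, x2), r))"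
  define \<rho>2 where "\<rho>2 = pure_output X2 J2 (\<lambda>(x2, r, x1). \<psi> ((x1, x2), r))"
  have fX: "finite (X1 \<times> X2)" using fin by simp
  have tr: "(\<Sum>t\<in>(Y1 \<times> Y2) \<times> R. \<rho> t t) = 1"
    unfolding \<rho>_def pure_output_trace[OF tensor_map_tp[OF tp1 tp2] fX] n by simp
  have psd: "psd_on ((Y1 \<times> Y2) \<times> R) \<rho>"
    unfolding \<rho>_def by (rule pure_output_psd[OF tensor_map_kraus[OF k1 k2]])
  have \<rho>eq: "\<rho> ((y1, y2), r) ((y1', y2'), r') = (\<Sum>x1\<in>X1. \<Sum>x1'\<in>X1. \<Sum>x2\<in>X2. \<Sum>x2'\<in>X2.
      \<psi> ((x1, x2), r) * cnj (\<psi> ((x1', x2'), r')) * J1 x1 x1' y1 y1' * J2 x2 x2' y2 y2')" for y1 y2 y1' y2' r r'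
  proof -
    have "\<rho> ((y1, y2), r) ((y1', y2'), r') = (\<Sum>x1\<in>X1. \<Sum>x2\<in>X2. \<Sum>x1'\<in>X1. \<Sum>x2'\<in>X2.
      \<psi> ((x1, x2), r) * cnj (\<psi> ((x1', x2'), r')) * J1 x1 x1' y1 y1' * J2 x2 x2' y2 y2')"
      unfolding \<rho>_def pure_output_eq sum.cartesian_product' tensor_map_def by (simp add: mult_ac)
    also have "\<dots> = (\<Sum>x1\<in>X1. \<Sum>x1'\<in>X1. \<Sum>x2\<in>X2. \<Sum>x2'\<in>X2.
      \<psi> ((x1, x2), r) * cnj (\<psi> ((x1', x2'), r')) * J1 x1 x1' y1 y1' * J2 x2 x2' y2 y2')"
      by (intro sum.cong refl sum.swap)
    finally show ?thesis .
  qed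
  have "mutual_info Y1 R (\<lambda>(y1, r) (y1', r'). \<Sum>y2\<in>Y2. \<rho> ((y1, y2), r) ((y1', y2), r'))
      = mutual_info Y1 R (local_map (R \<times> X2) X2 (\<lambda>a r (r', a'). if r = r' \<and> a = a' then 1 else 0) \<rho>1)"
  proof (rule mutual_info_cong[OF fin(2,5)])
    fix y y' r r' assume y: "y \<in> Y1" "y' \<in> Y1" and r: "r \<in> R" "r' \<in> R"
    have "(\<Sum>y2\<in>Y2. \<rho> ((y, y2), r) ((y', y2), r'))
      = (\<Sum>x1\<in>X1. \<Sum>x1'\<in>X1. \<Sum>y2\<in>Y2. \<Sum>x2\<in>X2. \<Sum>x2'\<in>X2. \<psi> ((x1, x2), r) * cnj (\<psi> ((x1', x2'), r')) * J1 x1 x1' y y' * J2 x2 x2' y2 y2)"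
      unfolding \<rho>eq by (rule sum_rotate)
    also have "\<dots> = (\<Sum>x1\<in>X1. \<Sum>x1'\<in>X1. \<Sum>x2\<in>X2. \<Sum>x2'\<in>X2. \<Sum>y2\<in>Y2. \<psi> ((x1, x2), r) * cnj (\<psi> ((x1', x2'), r')) * J1 x1 x1' y y' * J2 x2 x2' y2 y2)"
      by (intro sum.cong[OF refl] sum_rotate)
    also have "\<dots> = (\<Sum>x1\<in>X1. \<Sum>x1'\<in>X1. \<Sum>x2\<in>X2. \<Sum>x2'\<in>X2. \<psi> ((x1, x2), r) * cnj (\<psi> ((x1', x2'), r')) * J1 x1 x1' y y' * (if x2 = x2' then 1 else 0))"
      using tp2 by (simp add: sum_distrib_left[symmetric] trace_preserving_def)
    also have "\<dots> = (\<Sum>x1\<in>X1. \<Sum>x1'\<in>X1. \<Sum>x2\<in>X2. \<psi> ((x1, x2), r) * cnj (\<psi> ((x1', x2), r')) * J1 x1 x1' y y')"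
      by (simp add: sum_delta_mult fin)
    also have "\<dots> = (\<Sum>x1\<in>X1. \<Sum>x2\<in>X2. \<Sum>x1'\<in>X1. \<psi> ((x1, x2), r) * cnj (\<psi> ((x1', x2), r')) * J1 x1 x1' y y')"
      by (intro sum.cong refl sum.swap)
    also have "\<dots> = (\<Sum>a\<in>X2. \<rho>1 (y, r, a) (y', r', a))"
      unfolding \<rho>1_def pure_output_eq prod.case by (rule sum.swap)
    also have "\<dots> = local_map (R \<times> X2) X2 (\<lambda>a r (r', a'). if r = r' \<and> a = a' then 1 else 0) \<rho>1 (y, r) (y', r')"
    proof -
      have "local_map (R \<times> X2) X2 (\<lambda>a r (r', a'). if r = r' \<and> a = a' then 1 else 0) \<rho>1 (y, r) (y', r')
        = (\<Sum>a\<in>X2. \<Sum>s\<in>R. (\<Sum>b\<in>X2. (\<Sum>s'\<in>R. (\<Sum>b'\<in>X2. \<rho>1 (y, s, b) (y', s', b') * (if b' = a then 1 else 0)) * (if s' = r' then 1 else 0)) * (if b = a then 1 else 0)) * (if s = r then 1 else 0))"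
        unfolding local_map_def sum.cartesian_product' prod.case sum_distrib_right
        by (intro sum.cong refl) auto
      also have "\<dots> = (\<Sum>a\<in>X2. \<rho>1 (y, r, a) (y', r', a))"
        by (intro sum.cong refl) (simp add: sum_delta_mult fin r)
      finally show ?thesis ..
    qed
    finally show "(case (y, r) of (y1, r) \<Rightarrow> \<lambda>(y1', r'). \<Sum>y2\<in>Y2. \<rho> ((y1, y2), r) ((y1', y2), r')) (y', r')
      = local_map (R \<times> X2) X2 (\<lambda>a r (r', a'). if r = r' \<and> a = a' then 1 else 0) \<rho>1 (y, r) (y', r')" by simp
  qed
  also have "\<dots> \<le> mutual_info Y1 (R \<times> X2) \<rho>1"
    by (rule mutual_info_local_map_le[OF fin(2) _ fin(5,3) ptrace_kraus_tp[OF fin(5,3)]])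
       (use fin pure_output_psd[OF k1] in \<open>auto simp: \<rho>1_def\<close>)
  finally have 1: "mutual_info Y1 R (\<lambda>(y1, r) (y1', r'). \<Sum>y2\<in>Y2. \<rho> ((y1, y2), r) ((y1', y2), r')) \<le> mutual_info Y1 (R \<times> X2) \<rho>1" .
  have fE: "finite E1" using k1 by (simp add: is_kraus_def)
  have "mutual_info Y2 (R \<times> Y1) (\<lambda>(y2, r, y1) (y2', r', y1'). \<rho> ((y1, y2), r) ((y1', y2'), r'))
      = mutual_info Y2 (R \<times> Y1) (local_map (R \<times> X1) E1 (ext_kraus K1) \<rho>2)"
  proof (rule mutual_info_cong[OF fin(4)])
    show "finite (R \<times> Y1)" using fin by simp
    fix y2 y2' t t' assume y: "y2 \<in> Y2" "y2' \<in> Y2" and "t \<in> R \<times> Y1" "t' \<in> R \<times> Y1"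
    then obtain r y1 r' y1' where t: "t = (r, y1)" "t' = (r', y1')" "r \<in> R" "r' \<in> R" "y1 \<in> Y1" "y1' \<in> Y1" by auto
    have "local_map (R \<times> X1) E1 (ext_kraus K1) \<rho>2 (y2, r, y1) (y2', r', y1')
       = (\<Sum>e\<in>E1. \<Sum>s\<in>R. (\<Sum>x\<in>X1. \<Sum>s'\<in>R. (\<Sum>x'\<in>X1. K1 e y1 x * \<rho>2 (y2, s, x) (y2', s', x') * cnj (K1 e y1' x')) * (if s' = r' then 1 else 0)) * (if s = r then 1 else 0))"
      unfolding local_map_def ext_kraus_def sum.cartesian_product' prod.case sum_distrib_right
      by (intro sum.cong refl) auto
    also have "\<dots> = (\<Sum>e\<in>E1. \<Sum>x\<in>X1. \<Sum>x'\<in>X1. K1 e y1 x * \<rho>2 (y2, r, x) (y2', r', x') * cnj (K1 e y1' x'))"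
      by (simp add: sum_delta_mult fin t)
    also have "\<dots> = (\<Sum>x\<in>X1. \<Sum>x'\<in>X1. \<Sum>e\<in>E1. K1 e y1 x * \<rho>2 (y2, r, x) (y2', r', x') * cnj (K1 e y1' x'))"
      by (rule sum_rotate)
    also have "\<dots> = (\<Sum>x\<in>X1. \<Sum>x'\<in>X1. \<rho>2 (y2, r, x) (y2', r', x') * J1 x x' y1 y1')"
      by (intro sum.cong refl) (simp add: is_kraus_eq[OF k1] t sum_distrib_left mult_ac)
    also have "\<dots> = \<rho> ((y1, y2), r) ((y1', y2'), r')"
      unfolding \<rho>eq \<rho>2_def pure_output_eq prod.case by (simp add: sum_distrib_left sum_distrib_right mult_ac)
    finally show "(case (y2, t) of (y2, r, y1) \<Rightarrow> \<lambda>(y2', r', y1'). \<rho> ((y1, y2), r) ((y1', y2'), r')) (y2', t')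
       = local_map (R \<times> X1) E1 (ext_kraus K1) \<rho>2 (y2, t) (y2', t')" by (simp add: t)
  qed
  also have "\<dots> \<le> mutual_info Y2 (R \<times> X1) \<rho>2"
    by (rule mutual_info_local_map_le[OF fin(4) _ _ fE kraus_tp_ext_kraus[OF kraus_tpI[OF k1 tp1] fin(5)]])
       (use fin pure_output_psd[OF k2] in \<open>auto simp: \<rho>2_def\<close>)
  finally have 2: "mutual_info Y2 (R \<times> Y1) (\<lambda>(y2, r, y1) (y2', r', y1'). \<rho> ((y1, y2), r) ((y1', y2'), r')) \<le> mutual_info Y2 (R \<times> X1) \<rho>2" .
  show ?thesis
    using mutual_info_chain[OF fin(2,4,5) psd tr] 1 2 unfolding \<rho>_def \<rho>1_def \<rho>2_def by linarith
qed

section \<open>Multiple-access channels\<close>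

lemma pure_decomp: "psd_decomp X {()} (\<lambda>_. \<psi>) (\<lambda>_. 1) (\<lambda>x x'. \<psi> x * cnj (\<psi> x'))"
  by (simp add: psd_decomp_def)

definition kraus_rep :: "'x set \<Rightarrow> 'y set \<Rightarrow> ('x \<Rightarrow> 'x \<Rightarrow> 'y qop) \<Rightarrow> bool" where
  "kraus_rep X Y J \<longleftrightarrow> (\<exists>(E :: nat set) K. is_kraus X Y J E K)"

lemma kraus_repI:
  assumes "is_kraus X Y J E K"
  shows "kraus_rep X Y J"
proof -
  have "finite E" using assms by (simp add: is_kraus_def)
  then obtain h where h: "bij_betw h {0..<card E} E" using ex_bij_betw_nat_finite by blast
  have "is_kraus X Y J {0..<card E} (\<lambda>i. K (h i))"
    using assms unfolding is_kraus_def
    by (simp add: sum.reindex_bij_betw[OF h, of "\<lambda>e. K e _ _ * cnj (K e _ _)"])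
  then show ?thesis unfolding kraus_rep_def by blast
qed

text \<open>Applying the map to half of an unnormalised maximally entangled state gives the Choi operator \<open>C\<close>, whose rescaled eigenvectors are the Kraus operators.\<close>
lemma cp_kraus:
  assumes cp: "completely_positive X Y J" and fin: "finite X" "finite Y"
  shows "kraus_rep X Y J"
proof -
  obtain h where h: "bij_betw h X {0..<card X}" using ex_bij_betw_finite_nat[OF fin(1)] by blast
  define R where "R = {0..<card X}"
  define \<sigma> where "\<sigma> = (\<lambda>t t'. (case t of (x, r) \<Rightarrow> (if r = h x then 1 else (0 :: complex))) *
       cnj (case t' of (x, r) \<Rightarrow> (if r = h x then 1 else 0)))"
  have "psd_on (X \<times> R) \<sigma>" unfolding \<sigma>_def by (rule psd_decomp_psd_on[OF pure_decomp])
  then have psd: "psd_on (Y \<times> R) (apply_map_ref X J \<sigma>)"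
    using cp unfolding completely_positive_def R_def by blast
  have hinj: "h x = h x' \<longleftrightarrow> x = x'" if "x \<in> X" "x' \<in> X" for x x'
    using inj_on_eq_iff[OF bij_betw_imp_inj_on[OF h]] that by blast
  define C where "C = (\<lambda>(y, x) (y', x'). J x x' y y')"
  have appl: "apply_map_ref X J \<sigma> (y, h x) (y', h x') = J x x' y y'" if x: "x \<in> X" "x' \<in> X" for x x' y y'
  proof -
    have "apply_map_ref X J \<sigma> (y, h x) (y', h x')
      = (\<Sum>a\<in>X. (\<Sum>a'\<in>X. J a a' y y' * (if a' = x' then 1 else 0)) * (if a = x then 1 else 0))"
      unfolding apply_map_ref_def \<sigma>_def prod.case sum_distrib_right
      using hinj x by (intro sum.cong refl) auto
    then show ?thesis using x by (simp add: sum_delta_mult fin)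
  qed
  have inv: "inv_into X h (h x) = x" if "x \<in> X" for x using bij_betw_inv_into_left[OF h that] .
  have "psd_on (Y \<times> X) C"
  proof (rule psd_relabel[OF psd])
    show "bij_betw (map_prod id (inv_into X h)) (Y \<times> R) (Y \<times> X)"
      unfolding R_def by (rule bij_betw_map_prod[OF bij_betw_id bij_betw_inv_into[OF h]])
    fix t t' assume "t \<in> Y \<times> R" "t' \<in> Y \<times> R"
    then obtain y x y' x' where t: "t = (y, h x)" "t' = (y', h x')" "x \<in> X" "x' \<in> X"
      using h unfolding R_def bij_betw_def by (smt (verit, ccfv_threshold) SigmaE imageE)
    then show "C (map_prod id (inv_into X h) t) (map_prod id (inv_into X h) t') = apply_map_ref X J \<sigma> t t'"
      by (simp add: C_def appl inv)
  qed
  then obtain I :: "nat set" and u p where r: "psd_eig (Y \<times> X) I u p C"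
    using psd_on_spectral[of "Y \<times> X"] fin by blast
  have d: "psd_decomp (Y \<times> X) I u p C" and o: "onb (Y \<times> X) I u" using r unfolding psd_eig_def by blast+
  have "J x x' y y' = (\<Sum>i\<in>I. (of_real (sqrt (p i)) * u i (y, x)) * cnj (of_real (sqrt (p i)) * u i (y', x')))"
    if "x \<in> X" "x' \<in> X" "y \<in> Y" "y' \<in> Y" for x x' y y'
  proof -
    have "J x x' y y' = C (y, x) (y', x')" by (simp add: C_def)
    also have "\<dots> = (\<Sum>i\<in>I. of_real (p i) * u i (y, x) * cnj (u i (y', x')))"
      by (rule psd_decomp_eq[OF d]) (use that in auto)
    also have "\<dots> = (\<Sum>i\<in>I. (of_real (sqrt (p i)) * u i (y, x)) * cnj (of_real (sqrt (p i)) * u i (y', x')))"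
    proof (intro sum.cong refl)
      fix i assume "i \<in> I"
      then have "complex_of_real (p i) = of_real (sqrt (p i)) * of_real (sqrt (p i))"
        using psd_eig_nonneg[OF r] by (simp only: of_real_mult[symmetric] real_sqrt_mult_self abs_of_nonneg)
      then show "of_real (p i) * u i (y, x) * cnj (u i (y', x'))
          = (of_real (sqrt (p i)) * u i (y, x)) * cnj (of_real (sqrt (p i)) * u i (y', x'))"
        by (simp only: complex_cnj_mult complex_cnj_complex_of_real mult_ac)
    qed
    finally show ?thesis .
  qed
  then have "is_kraus X Y J I (\<lambda>i y x. of_real (sqrt (p i)) * u i (y, x))"
    using onb_finite[OF o] unfolding is_kraus_def by blast
  then show ?thesis by (rule kraus_repI)
qed

lemma kraus_rep_relabel:
  assumes "kraus_rep X Y J" and f: "bij_betw f X X'" and g: "bij_betw g Y Y'"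
    and eq: "\<And>x x' y y'. x \<in> X \<Longrightarrow> x' \<in> X \<Longrightarrow> y \<in> Y \<Longrightarrow> y' \<in> Y \<Longrightarrow> J' (f x) (f x') (g y) (g y') = J x x' y y'"
  shows "kraus_rep X' Y' J'"
proof -
  obtain E :: "nat set" and K where k: "is_kraus X Y J E K" using assms(1) unfolding kraus_rep_def by blast
  have fi: "inv_into X f x \<in> X" "f (inv_into X f x) = x" if "x \<in> X'" for x
    using bij_betwE[OF bij_betw_inv_into[OF f]] bij_betw_inv_into_right[OF f that] that by auto
  have gi: "inv_into Y g y \<in> Y" "g (inv_into Y g y) = y" if "y \<in> Y'" for y
    using bij_betwE[OF bij_betw_inv_into[OF g]] bij_betw_inv_into_right[OF g that] that by auto
  have "J' x x' y y' = (\<Sum>e\<in>E. K e (inv_into Y g y) (inv_into X f x) * cnj (K e (inv_into Y g y') (inv_into X f x')))"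
    if "x \<in> X'" "x' \<in> X'" "y \<in> Y'" "y' \<in> Y'" for x x' y y'
    using eq[OF fi(1)[OF that(1)] fi(1)[OF that(2)] gi(1)[OF that(3)] gi(1)[OF that(4)]]
      is_kraus_eq[OF k fi(1)[OF that(1)] fi(1)[OF that(2)] gi(1)[OF that(3)] gi(1)[OF that(4)]]
    by (simp add: fi gi that)
  then have "is_kraus X' Y' J' E (\<lambda>e y x. K e (inv_into Y g y) (inv_into X f x))"
    using k unfolding is_kraus_def by blast
  then show ?thesis by (rule kraus_repI)
qed

lemma trace_preserving_relabel:
  assumes tp: "trace_preserving X Y J" and f: "bij_betw f X X'" and g: "bij_betw g Y Y'"
    and eq: "\<And>x x' y y'. x \<in> X \<Longrightarrow> x' \<in> X \<Longrightarrow> y \<in> Y \<Longrightarrow> y' \<in> Y \<Longrightarrow> J' (f x) (f x') (g y) (g y') = J x x' y y'"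
  shows "trace_preserving X' Y' J'"
  unfolding trace_preserving_def
proof (intro ballI)
  fix x x' assume "x \<in> X'" "x' \<in> X'"
  then obtain a a' where a: "a \<in> X" "a' \<in> X" "x = f a" "x' = f a'" using f by (auto simp: bij_betw_def)
  have "(\<Sum>y\<in>Y'. J' x x' y y) = (\<Sum>y\<in>Y. J a a' y y)"
    unfolding a(3,4) sum.reindex_bij_betw[OF g, symmetric] by (intro sum.cong refl) (simp add: eq a)
  also have "\<dots> = (if a = a' then 1 else 0)" using tp a by (simp add: trace_preserving_def)
  also have "\<dots> = (if x = x' then 1 else 0)"
    using a inj_on_eq_iff[OF bij_betw_imp_inj_on[OF f], of a a'] by simp
  finally show "(\<Sum>y\<in>Y'. J' x x' y y) = (if x = x' then 1 else 0)" .
qed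

lemma mutual_info_pure_output_relabel:
  assumes k: "kraus_rep X Y J" and fin: "finite Y" "finite R"
    and f: "bij_betw f X X'" and g: "bij_betw g Y Y'" and h: "bij_betw h R R'"
    and J: "\<And>x x' y y'. x \<in> X \<Longrightarrow> x' \<in> X \<Longrightarrow> y \<in> Y \<Longrightarrow> y' \<in> Y \<Longrightarrow> J' (f x) (f x') (g y) (g y') = J x x' y y'"
    and \<psi>: "\<And>x r. x \<in> X \<Longrightarrow> r \<in> R \<Longrightarrow> \<psi>' (f x, h r) = \<psi> (x, r)"
  shows "mutual_info Y' R' (pure_output X' J' \<psi>') = mutual_info Y R (pure_output X J \<psi>)"
proof -
  obtain E :: "nat set" and K where k: "is_kraus X Y J E K" using k unfolding kraus_rep_def by blast
  show ?thesis
  proof (rule mutual_info_relabel[OF fin pure_output_psd[OF k] g h])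
    fix y y' r r' assume "y \<in> Y" "y' \<in> Y" "r \<in> R" "r' \<in> R"
    then show "pure_output X' J' \<psi>' (g y, h r) (g y', h r') = pure_output X J \<psi> (y, r) (y', r')"
      unfolding pure_output_eq sum.reindex_bij_betw[OF f, symmetric] by (intro sum.cong refl) (simp add: J \<psi>)
  qed
qed

lemma mutual_info_pure_output_tensor:
  assumes k: "kraus_rep X1 Y1 J1" "kraus_rep X2 Y2 J2"
    and tp: "trace_preserving X1 Y1 J1" "trace_preserving X2 Y2 J2"
    and fin: "finite X1" "finite Y1" "finite R1" "finite X2" "finite Y2" "finite R2"
    and n: "(\<Sum>x\<in>X1. \<Sum>r\<in>R1. (cmod (\<psi>1 (x, r)))\<^sup>2) = 1" "(\<Sum>x\<in>X2. \<Sum>r\<in>R2. (cmod (\<psi>2 (x, r)))\<^sup>2) = 1"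
  shows "mutual_info (Y1 \<times> Y2) (R1 \<times> R2) (pure_output (X1 \<times> X2) (tensor_map J1 J2) (\<lambda>((x1, x2), (r1, r2)). \<psi>1 (x1, r1) * \<psi>2 (x2, r2)))
    = mutual_info Y1 R1 (pure_output X1 J1 \<psi>1) + mutual_info Y2 R2 (pure_output X2 J2 \<psi>2)"
proof -
  obtain E1 :: "nat set" and K1 where k1: "is_kraus X1 Y1 J1 E1 K1" using k(1) unfolding kraus_rep_def by blast
  obtain E2 :: "nat set" and K2 where k2: "is_kraus X2 Y2 J2 E2 K2" using k(2) unfolding kraus_rep_def by blast
  have "pure_output (X1 \<times> X2) (tensor_map J1 J2) (\<lambda>((x1, x2), (r1, r2)). \<psi>1 (x1, r1) * \<psi>2 (x2, r2)) ((y1, y2), (r1, r2)) ((y1', y2'), (r1', r2'))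
    = pure_output X1 J1 \<psi>1 (y1, r1) (y1', r1') * pure_output X2 J2 \<psi>2 (y2, r2) (y2', r2')" for y1 y2 r1 r2 y1' y2' r1' r2'
  proof -
    have "pure_output (X1 \<times> X2) (tensor_map J1 J2) (\<lambda>((x1, x2), (r1, r2)). \<psi>1 (x1, r1) * \<psi>2 (x2, r2)) ((y1, y2), (r1, r2)) ((y1', y2'), (r1', r2'))
      = (\<Sum>x1\<in>X1. \<Sum>x2\<in>X2. \<Sum>x1'\<in>X1. \<Sum>x2'\<in>X2. (\<psi>1 (x1, r1) * cnj (\<psi>1 (x1', r1')) * J1 x1 x1' y1 y1') * (\<psi>2 (x2, r2) * cnj (\<psi>2 (x2', r2')) * J2 x2 x2' y2 y2'))"
      unfolding pure_output_eq sum.cartesian_product' tensor_map_def by (simp add: mult_ac)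
    also have "\<dots> = (\<Sum>x1\<in>X1. \<Sum>x1'\<in>X1. \<Sum>x2\<in>X2. \<Sum>x2'\<in>X2. (\<psi>1 (x1, r1) * cnj (\<psi>1 (x1', r1')) * J1 x1 x1' y1 y1') * (\<psi>2 (x2, r2) * cnj (\<psi>2 (x2', r2')) * J2 x2 x2' y2 y2'))"
      by (intro sum.cong refl sum.swap)
    also have "\<dots> = (\<Sum>x1\<in>X1. \<Sum>x1'\<in>X1. (\<psi>1 (x1, r1) * cnj (\<psi>1 (x1', r1')) * J1 x1 x1' y1 y1') * pure_output X2 J2 \<psi>2 (y2, r2) (y2', r2'))"
      unfolding pure_output_eq by (simp only: sum_distrib_left)
    finally show ?thesis unfolding pure_output_eq[of X1] by (simp only: sum_distrib_right)
  qed
  then have "pure_output (X1 \<times> X2) (tensor_map J1 J2) (\<lambda>((x1, x2), (r1, r2)). \<psi>1 (x1, r1) * \<psi>2 (x2, r2))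
    = (\<lambda>((y1, y2), (r1, r2)) ((y1', y2'), (r1', r2')). pure_output X1 J1 \<psi>1 (y1, r1) (y1', r1') * pure_output X2 J2 \<psi>2 (y2, r2) (y2', r2'))"
    by (auto simp: fun_eq_iff)
  moreover have "(\<Sum>t\<in>Y1 \<times> R1. pure_output X1 J1 \<psi>1 t t) = 1" "(\<Sum>t\<in>Y2 \<times> R2. pure_output X2 J2 \<psi>2 t t) = 1"
    using pure_output_trace[OF tp(1) fin(1), where R = R1 and \<psi> = \<psi>1] pure_output_trace[OF tp(2) fin(4), where R = R2 and \<psi> = \<psi>2] n by simp_all
  ultimately show ?thesis
    using mutual_info_prod[OF fin(2,3,5,6) pure_output_psd[OF k1] pure_output_psd[OF k2]] by simp
qed

definition finite_mac :: "nat \<Rightarrow> (nat \<Rightarrow> 'a set) \<Rightarrow> 'b set \<Rightarrow> ((nat \<Rightarrow> 'a) \<Rightarrow> (nat \<Rightarrow> 'a) \<Rightarrow> 'b qop) \<Rightarrow> bool" where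
  "finite_mac s Ak Bs J \<longleftrightarrow> (\<forall>k<s. finite (Ak k) \<and> Ak k \<noteq> {}) \<and> finite Bs \<and>
     kraus_rep (PiE {..<s} Ak) Bs J \<and> trace_preserving (PiE {..<s} Ak) Bs J"

definition amplitude :: "nat \<Rightarrow> (nat \<Rightarrow> 'a \<times> 'q \<Rightarrow> complex) \<Rightarrow> (nat \<Rightarrow> 'a) \<times> (nat \<Rightarrow> 'q) \<Rightarrow> complex" where
  "amplitude s \<phi> = (\<lambda>(x, r). \<Prod>k<s. \<phi> k (x k, r k))"

definition normalized_input :: "nat \<Rightarrow> (nat \<Rightarrow> 'a set) \<Rightarrow> (nat \<Rightarrow> 'q set) \<Rightarrow> (nat \<Rightarrow> 'a \<times> 'q \<Rightarrow> complex) \<Rightarrow> bool" where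
  "normalized_input s Ak Q \<phi> \<longleftrightarrow> (\<forall>k<s. finite (Q k) \<and> (\<Sum>a\<in>Ak k. \<Sum>r\<in>Q k. (cmod (\<phi> k (a, r)))\<^sup>2) = 1)"

lemma sum_PiE_prod:
  fixes F :: "nat \<Rightarrow> 'a \<Rightarrow> 'c :: comm_semiring_1"
  assumes "\<And>k. k < s \<Longrightarrow> finite (A k)"
  shows "(\<Sum>x\<in>PiE {..<s} A. \<Prod>k<s. F k (x k)) = (\<Prod>k<s. \<Sum>a\<in>A k. F k a)"
  using assms by (intro prod_sum_PiE[symmetric]) auto

lemma bij_betw_PiE_comp:
  assumes "\<And>k. k \<in> S \<Longrightarrow> bij_betw (F k) (A k) (B k)"
  shows "bij_betw (\<lambda>x. \<lambda>k\<in>S. F k (x k)) (PiE S A) (PiE S B)"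
proof (rule bij_betwI[where g = "\<lambda>y. \<lambda>k\<in>S. inv_into (A k) (F k) (y k)"])
  show "(\<lambda>x. \<lambda>k\<in>S. F k (x k)) \<in> PiE S A \<rightarrow> PiE S B"
    using bij_betwE[OF assms] by (auto simp: PiE_def)
  show "(\<lambda>y. \<lambda>k\<in>S. inv_into (A k) (F k) (y k)) \<in> PiE S B \<rightarrow> PiE S A"
    using bij_betwE[OF bij_betw_inv_into[OF assms]] by (auto simp: PiE_def)
next
  fix x assume x: "x \<in> PiE S A"
  show "(\<lambda>k\<in>S. inv_into (A k) (F k) ((\<lambda>k\<in>S. F k (x k)) k)) = x"
  proof
    fix k show "(\<lambda>k\<in>S. inv_into (A k) (F k) ((\<lambda>k\<in>S. F k (x k)) k)) k = x k"
      using x bij_betw_inv_into_left[OF assms, of k "x k"] by (cases "k \<in> S") (auto simp: PiE_def extensional_def)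
  qed
next
  fix y assume y: "y \<in> PiE S B"
  show "(\<lambda>k\<in>S. F k ((\<lambda>k\<in>S. inv_into (A k) (F k) (y k)) k)) = y"
  proof
    fix k show "(\<lambda>k\<in>S. F k ((\<lambda>k\<in>S. inv_into (A k) (F k) (y k)) k)) k = y k"
      using y bij_betw_inv_into_right[OF assms, of k "y k"] by (cases "k \<in> S") (auto simp: PiE_def extensional_def)
  qed
qed

definition pair_fun :: "nat \<Rightarrow> (nat \<Rightarrow> 'a) \<times> (nat \<Rightarrow> 'b) \<Rightarrow> nat \<Rightarrow> 'a \<times> 'b" where
  "pair_fun s = (\<lambda>(x, a). \<lambda>k\<in>{..<s}. (x k, a k))"

lemma bij_betw_pair_fun: "bij_betw (pair_fun s) (PiE {..<s} A \<times> PiE {..<s} B) (PiE {..<s} (\<lambda>k. A k \<times> B k))"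
  unfolding pair_fun_def
proof (rule bij_betwI[where g = "\<lambda>z. (\<lambda>k\<in>{..<s}. fst (z k), \<lambda>k\<in>{..<s}. snd (z k))"])
qed (auto simp: PiE_def Pi_def extensional_def fun_eq_iff restrict_def split: if_splits)

lemma bij_betw_snoc: "bij_betw (\<lambda>(x, a). x(n := a)) (PiE {..<n} (\<lambda>_. A) \<times> A) (PiE {..<Suc n} (\<lambda>_. A))"
  by (rule bij_betwI[where g = "\<lambda>z. (restrict z {..<n}, z n)"])
     (auto simp: PiE_def Pi_def extensional_def fun_eq_iff restrict_def less_Suc_eq split: if_splits)

lemma amplitude_norm:
  assumes "normalized_input s Ak Q \<phi>" "\<And>k. k < s \<Longrightarrow> finite (Ak k)"
  shows "(\<Sum>x\<in>PiE {..<s} Ak. \<Sum>r\<in>PiE {..<s} Q. (cmod (amplitude s \<phi> (x, r)))\<^sup>2) = 1"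
proof -
  have fQ: "\<And>k. k < s \<Longrightarrow> finite (Q k)" using assms(1) by (simp add: normalized_input_def)
  have "(\<Sum>x\<in>PiE {..<s} Ak. \<Sum>r\<in>PiE {..<s} Q. (cmod (amplitude s \<phi> (x, r)))\<^sup>2)
     = (\<Sum>x\<in>PiE {..<s} Ak. \<Sum>r\<in>PiE {..<s} Q. \<Prod>k<s. (cmod (\<phi> k (x k, r k)))\<^sup>2)"
    by (simp add: amplitude_def prod_norm[symmetric] prod_power_distrib)
  also have "\<dots> = (\<Sum>x\<in>PiE {..<s} Ak. \<Prod>k<s. \<Sum>r\<in>Q k. (cmod (\<phi> k (x k, r)))\<^sup>2)"
    by (intro sum.cong refl sum_PiE_prod fQ)
  also have "\<dots> = (\<Prod>k<s. \<Sum>a\<in>Ak k. \<Sum>r\<in>Q k. (cmod (\<phi> k (a, r)))\<^sup>2)"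
    by (rule sum_PiE_prod[OF assms(2)])
  also have "\<dots> = 1" using assms(1) by (simp add: normalized_input_def)
  finally show ?thesis .
qed

lemma C_tilde_eq_mutual_info: "C_tilde_EU s Ak Bs J R \<phi> = mutual_info Bs (PiE {..<s} R) (pure_output (PiE {..<s} Ak) J (amplitude s \<phi>))"
  by (simp add: C_tilde_EU_def output_state_def pure_output_def product_state_def amplitude_def)

lemma admissible_iff_normalized: "admissible_input s Ak R \<phi> \<longleftrightarrow> normalized_input s Ak R \<phi>"
  by (simp add: admissible_input_def normalized_input_def)

lemma finite_macD:
  assumes "finite_mac s Ak Bs J"
  shows "\<And>k. k < s \<Longrightarrow> finite (Ak k)" "\<And>k. k < s \<Longrightarrow> Ak k \<noteq> {}" "finite Bs" "finite (PiE {..<s} Ak)"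
    "kraus_rep (PiE {..<s} Ak) Bs J" "trace_preserving (PiE {..<s} Ak) Bs J"
  using assms by (auto simp: finite_mac_def intro!: finite_PiE)

lemma normalized_input_finite: "normalized_input s Ak Q \<phi> \<Longrightarrow> finite (PiE {..<s} Q)"
  by (auto simp: normalized_input_def intro!: finite_PiE)

lemma mutual_info_le_C1_nat:
  fixes R :: "nat \<Rightarrow> nat set"
  assumes mac: "finite_mac s Ak Bs J" and normalized_input: "normalized_input s Ak R \<phi>"
  shows "mutual_info Bs (PiE {..<s} R) (pure_output (PiE {..<s} Ak) J (amplitude s \<phi>)) \<le> C1_EU s Ak Bs J"
proof -
  obtain E :: "nat set" and K where k: "is_kraus (PiE {..<s} Ak) Bs J E K"
    using finite_macD(5)[OF mac] unfolding kraus_rep_def by blast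
  have bd: "C_tilde_EU s Ak Bs J R \<phi> \<le> log 2 (card (PiE {..<s} Ak)) + log 2 (card Bs)"
    if "normalized_input s Ak R \<phi>" for R \<phi>
    unfolding C_tilde_eq_mutual_info
    by (rule mutual_info_pure_output_le[OF k finite_macD(6,4,3)[OF mac] normalized_input_finite[OF that] amplitude_norm[OF that finite_macD(1)[OF mac]]])
  have "(case (R, \<phi>) of (R, \<phi>) \<Rightarrow> C_tilde_EU s Ak Bs J R \<phi>) \<le> C1_EU s Ak Bs J"
    unfolding C1_EU_def
  proof (rule cSUP_upper)
    show "bdd_above ((\<lambda>(R, \<phi>). C_tilde_EU s Ak Bs J R \<phi>) ` {(R, \<phi>). admissible_input s Ak R \<phi>})"
      using bd by (intro bdd_aboveI[of _ "log 2 (card (PiE {..<s} Ak)) + log 2 (card Bs)"]) (auto simp: admissible_iff_normalized)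
  qed (use normalized_input in \<open>simp add: admissible_iff_normalized\<close>)
  then show ?thesis by (simp add: C_tilde_eq_mutual_info)
qed

lemma mutual_info_le_C1:
  assumes mac: "finite_mac s Ak Bs J" and normalized_input: "normalized_input s Ak Q \<phi>"
  shows "mutual_info Bs (PiE {..<s} Q) (pure_output (PiE {..<s} Ak) J (amplitude s \<phi>)) \<le> C1_EU s Ak Bs J"
proof -
  have "\<forall>k. \<exists>e. k < s \<longrightarrow> bij_betw e (Q k) {0..<card (Q k)}"
    using normalized_input ex_bij_betw_finite_nat unfolding normalized_input_def by metis
  then obtain e where e: "\<And>k. k < s \<Longrightarrow> bij_betw (e k) (Q k) {0..<card (Q k)}" by metis
  define R where "R = (\<lambda>k. {0..<card (Q k)})"
  define \<phi>' where "\<phi>' = (\<lambda>k (a, m). \<phi> k (a, inv_into (Q k) (e k) m))"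
  have inv: "inv_into (Q k) (e k) (e k r) = r" if "k < s" "r \<in> Q k" for k r
    using bij_betw_inv_into_left[OF e] that by blast
  have "normalized_input s Ak R \<phi>'"
    unfolding normalized_input_def
  proof (intro allI impI conjI)
    fix k assume k: "k < s"
    show "finite (R k)" by (simp add: R_def)
    have "(\<Sum>a\<in>Ak k. \<Sum>r\<in>R k. (cmod (\<phi>' k (a, r)))\<^sup>2) = (\<Sum>a\<in>Ak k. \<Sum>r\<in>Q k. (cmod (\<phi> k (a, r)))\<^sup>2)"
      unfolding R_def sum.reindex_bij_betw[OF e[OF k], symmetric]
      by (intro sum.cong refl) (simp add: \<phi>'_def inv[OF k])
    then show "(\<Sum>a\<in>Ak k. \<Sum>r\<in>R k. (cmod (\<phi>' k (a, r)))\<^sup>2) = 1"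
      using normalized_input k by (simp add: normalized_input_def)
  qed
  then have "mutual_info Bs (PiE {..<s} R) (pure_output (PiE {..<s} Ak) J (amplitude s \<phi>')) \<le> C1_EU s Ak Bs J"
    by (rule mutual_info_le_C1_nat[OF mac])
  also have "mutual_info Bs (PiE {..<s} R) (pure_output (PiE {..<s} Ak) J (amplitude s \<phi>'))
      = mutual_info Bs (PiE {..<s} Q) (pure_output (PiE {..<s} Ak) J (amplitude s \<phi>))"
  proof (rule mutual_info_pure_output_relabel[OF finite_macD(5,3)[OF mac] normalized_input_finite[OF normalized_input] bij_betw_id bij_betw_id])
    show "bij_betw (\<lambda>x. \<lambda>k\<in>{..<s}. e k (x k)) (PiE {..<s} Q) (PiE {..<s} R)"
      by (rule bij_betw_PiE_comp) (use e in \<open>simp add: R_def\<close>)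
    fix x r assume "r \<in> PiE {..<s} Q"
    then show "amplitude s \<phi>' (id x, \<lambda>k\<in>{..<s}. e k (r k)) = amplitude s \<phi> (x, r)"
      unfolding amplitude_def \<phi>'_def by (auto simp: inv PiE_def Pi_def intro!: prod.cong)
  qed simp
  finally show ?thesis .
qed

lemma is_MAC_finite_mac: "is_MAC s Ak Bs J \<Longrightarrow> finite_mac s Ak Bs J"
  unfolding is_MAC_def finite_mac_def cptp_def by (auto intro!: cp_kraus finite_PiE)

abbreviation append_use :: "nat \<Rightarrow> nat \<Rightarrow> (nat \<Rightarrow> nat \<Rightarrow> 'a) \<times> (nat \<Rightarrow> 'a) \<Rightarrow> nat \<Rightarrow> nat \<Rightarrow> 'a" where
  "append_use s n \<equiv> \<lambda>(x, a). \<lambda>k\<in>{..<s}. (x k)(n := a k)"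

lemma bij_append_use:
  "bij_betw (append_use s n) (PiE {..<s} (Ak_pow Ak n) \<times> PiE {..<s} Ak) (PiE {..<s} (Ak_pow Ak (Suc n)))"
proof -
  have "bij_betw ((\<lambda>z. \<lambda>k\<in>{..<s}. (\<lambda>(x, a). x(n := a)) (z k)) \<circ> pair_fun s)
      (PiE {..<s} (Ak_pow Ak n) \<times> PiE {..<s} Ak) (PiE {..<s} (Ak_pow Ak (Suc n)))"
    by (rule bij_betw_trans[OF bij_betw_pair_fun bij_betw_PiE_comp])
       (unfold Ak_pow_def, rule bij_betw_snoc)
  also have "(\<lambda>z. \<lambda>k\<in>{..<s}. (\<lambda>(x, a). x(n := a)) (z k)) \<circ> pair_fun s = append_use s n"
    by (auto simp: fun_eq_iff pair_fun_def)
  finally show ?thesis .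
qed

lemma bij_snoc_Bs: "bij_betw (\<lambda>(y, b). y(n := b)) (Bs_pow Bs n \<times> Bs) (Bs_pow Bs (Suc n))"
  unfolding Bs_pow_def by (rule bij_betw_snoc)

lemma J_pow_Suc:
  assumes "t \<in> X \<times> PiE {..<s} Ak" "t' \<in> X \<times> PiE {..<s} Ak"
  shows "J_pow s J (Suc n) (append_use s n t) (append_use s n t') ((\<lambda>(y, b). y(n := b)) v) ((\<lambda>(y, b). y(n := b)) v')
     = tensor_map (J_pow s J n) J t t' v v'"
proof -
  obtain x a x' a' y b y' b' where t: "t = (x, a)" "t' = (x', a')" "v = (y, b)" "v' = (y', b')"
    by (metis prod.exhaust)
  have r: "restrict a {..<s} = a" "restrict a' {..<s} = a'"
    using assms by (auto simp: t PiE_def extensional_restrict)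
  have st: "(\<lambda>k\<in>{..<s}. append_use s n (x, a) k i) = (if i = n then restrict a {..<s} else (\<lambda>k\<in>{..<s}. x k i))" for x :: "nat \<Rightarrow> nat \<Rightarrow> 'a" and a i
    by (auto simp: fun_eq_iff)
  have "J_pow s J (Suc n) (append_use s n t) (append_use s n t') ((\<lambda>(y, b). y(n := b)) v) ((\<lambda>(y, b). y(n := b)) v')
    = (\<Prod>i<Suc n. J (if i = n then restrict a {..<s} else (\<lambda>k\<in>{..<s}. x k i)) (if i = n then restrict a' {..<s} else (\<lambda>k\<in>{..<s}. x' k i))
         ((y(n := b)) i) ((y'(n := b')) i))"
    unfolding J_pow_def t st by simp
  also have "\<dots> = tensor_map (J_pow s J n) J t t' v v'"
    by (simp add: r tensor_map_def t J_pow_def)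
  finally show ?thesis .
qed

lemma finite_mac_pow:
  assumes mac: "finite_mac s Ak Bs J"
  shows "finite_mac s (Ak_pow Ak n) (Bs_pow Bs n) (J_pow s J n)"
proof -
  note m = finite_macD[OF mac]
  have fin: "finite (Ak_pow Ak n k) \<and> Ak_pow Ak n k \<noteq> {}" if "k < s" for k n
    using m(1,2)[OF that] by (simp add: Ak_pow_def PiE_eq_empty_iff finite_PiE)
  have finB: "finite (Bs_pow Bs n)" for n using m(3) by (simp add: Bs_pow_def finite_PiE)
  have "kraus_rep (PiE {..<s} (Ak_pow Ak n)) (Bs_pow Bs n) (J_pow s J n) \<and>
     trace_preserving (PiE {..<s} (Ak_pow Ak n)) (Bs_pow Bs n) (J_pow s J n)"
  proof (induction n)
    case 0
    have "is_kraus (PiE {..<s} (Ak_pow Ak 0)) (Bs_pow Bs 0) (J_pow s J 0) {()} (\<lambda>_ _ _. 1)"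
      by (simp add: is_kraus_def J_pow_def)
    moreover have "trace_preserving (PiE {..<s} (Ak_pow Ak 0)) (Bs_pow Bs 0) (J_pow s J 0)"
      unfolding trace_preserving_def
    proof (intro ballI)
      fix x x' assume x: "x \<in> PiE {..<s} (Ak_pow Ak 0)" "x' \<in> PiE {..<s} (Ak_pow Ak 0)"
      have "x = x'"
      proof (rule PiE_ext[OF x])
        fix k assume "k \<in> {..<s}"
        from PiE_mem[OF x(1) this] PiE_mem[OF x(2) this] show "x k = x' k" by (simp add: Ak_pow_def)
      qed
      then show "(\<Sum>y\<in>Bs_pow Bs 0. J_pow s J 0 x x' y y) = (if x = x' then 1 else 0)"
        by (simp add: Bs_pow_def J_pow_def)
    qed
    ultimately show ?case by (intro conjI kraus_repI)
  next
    case (Suc n)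
    obtain E1 :: "nat set" and K1 where k1: "is_kraus (PiE {..<s} (Ak_pow Ak n)) (Bs_pow Bs n) (J_pow s J n) E1 K1"
      using conjunct1[OF Suc] unfolding kraus_rep_def by blast
    obtain E2 :: "nat set" and K2 where k2: "is_kraus (PiE {..<s} Ak) Bs J E2 K2"
      using m(5) unfolding kraus_rep_def by blast
    have J: "J_pow s J (Suc n) (append_use s n x) (append_use s n x') ((\<lambda>(y, b). y(n := b)) y) ((\<lambda>(y, b). y(n := b)) y')
        = tensor_map (J_pow s J n) J x x' y y'"
      if "x \<in> PiE {..<s} (Ak_pow Ak n) \<times> PiE {..<s} Ak" "x' \<in> PiE {..<s} (Ak_pow Ak n) \<times> PiE {..<s} Ak"
      for x x' y y'
      using that by (rule J_pow_Suc)
    show ?case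
    proof
      show "kraus_rep (PiE {..<s} (Ak_pow Ak (Suc n))) (Bs_pow Bs (Suc n)) (J_pow s J (Suc n))"
        by (rule kraus_rep_relabel[OF kraus_repI[OF tensor_map_kraus[OF k1 k2]] bij_append_use bij_snoc_Bs]) (rule J)
      show "trace_preserving (PiE {..<s} (Ak_pow Ak (Suc n))) (Bs_pow Bs (Suc n)) (J_pow s J (Suc n))"
        by (rule trace_preserving_relabel[OF tensor_map_tp[OF conjunct2[OF Suc] m(6)] bij_append_use bij_snoc_Bs]) (rule J)
    qed
  qed
  then show ?thesis unfolding finite_mac_def using fin finB by (intro conjI allI impI) simp_all
qed

lemma C1_le:
  assumes mac: "finite_mac s Ak Bs J"
    and le: "\<And>(R :: nat \<Rightarrow> nat set) \<phi>. normalized_input s Ak R \<phi> \<Longrightarrow>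
      mutual_info Bs (PiE {..<s} R) (pure_output (PiE {..<s} Ak) J (amplitude s \<phi>)) \<le> c"
  shows "C1_EU s Ak Bs J \<le> c"
  unfolding C1_EU_def
proof (rule cSUP_least)
  have "\<forall>k. \<exists>a. k < s \<longrightarrow> a \<in> Ak k" using finite_macD(2)[OF mac] by blast
  then obtain a where a: "\<And>k. k < s \<Longrightarrow> a k \<in> Ak k" by metis
  have "normalized_input s Ak (\<lambda>_. {0 :: nat}) (\<lambda>k (b, r). if b = a k then 1 else 0)"
    unfolding normalized_input_def
  proof (intro allI impI conjI)
    fix k assume k: "k < s"
    have "(\<Sum>b\<in>Ak k. \<Sum>r\<in>{0 :: nat}. (cmod (case (b, r) of (b, r) \<Rightarrow> if b = a k then 1 else 0))\<^sup>2) = (\<Sum>b\<in>Ak k. if b = a k then 1 else 0)"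
      by (intro sum.cong refl) simp
    then show "(\<Sum>b\<in>Ak k. \<Sum>r\<in>{0 :: nat}. (cmod (case (b, r) of (b, r) \<Rightarrow> if b = a k then 1 else 0))\<^sup>2) = 1"
      using a[OF k] finite_macD(1)[OF mac k] by simp
  qed simp
  then show "{(R :: nat \<Rightarrow> nat set, \<phi>). admissible_input s Ak R \<phi>} \<noteq> {}" unfolding admissible_iff_normalized by blast
qed (use le in \<open>auto simp: C_tilde_eq_mutual_info admissible_iff_normalized\<close>)

lemma C1_pow_Suc_le:
  assumes mac: "finite_mac s Ak Bs J"
  shows "C1_EU s (Ak_pow Ak (Suc n)) (Bs_pow Bs (Suc n)) (J_pow s J (Suc n))
    \<le> C1_EU s (Ak_pow Ak n) (Bs_pow Bs n) (J_pow s J n) + C1_EU s Ak Bs J"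
proof (rule C1_le[OF finite_mac_pow[OF mac]])
  fix R :: "nat \<Rightarrow> nat set" and \<phi> assume normalized_input: "normalized_input s (Ak_pow Ak (Suc n)) R \<phi>"
  note mn = finite_macD[OF finite_mac_pow[OF mac, of n]] and m = finite_macD[OF mac]
  define X1 X2 Y1 where "X1 = PiE {..<s} (Ak_pow Ak n)" and "X2 = PiE {..<s} Ak" and "Y1 = Bs_pow Bs n"
  define P where "P = PiE {..<s} R"
  obtain E1 :: "nat set" and K1 where k1: "is_kraus X1 Y1 (J_pow s J n) E1 K1"
    using mn(5) unfolding kraus_rep_def X1_def Y1_def by blast
  obtain E2 :: "nat set" and K2 where k2: "is_kraus X2 Bs J E2 K2"
    using m(5) unfolding kraus_rep_def X2_def by blast
  have fin: "finite X1" "finite Y1" "finite X2" "finite Bs" "finite P"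
    using mn(3,4) m(3,4) normalized_input_finite[OF normalized_input] by (simp_all add: X1_def X2_def Y1_def P_def)
  have tp: "trace_preserving X1 Y1 (J_pow s J n)" "trace_preserving X2 Bs J"
    using mn(6) m(6) by (simp_all add: X1_def X2_def Y1_def)
  have fA: "finite (Ak_pow Ak (Suc n) k)" if "k < s" for k
    using finite_macD(1)[OF finite_mac_pow[OF mac]] that .
  define \<psi> where "\<psi> = (\<lambda>(t, r). amplitude s \<phi> (append_use s n t, r))"
  have bij: "bij_betw (append_use s n) (X1 \<times> X2) (PiE {..<s} (Ak_pow Ak (Suc n)))"
    unfolding X1_def X2_def by (rule bij_append_use)
  have norm: "(\<Sum>x\<in>X1 \<times> X2. \<Sum>r\<in>P. (cmod (\<psi> (x, r)))\<^sup>2) = 1"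
    using amplitude_norm[OF normalized_input fA] unfolding sum.reindex_bij_betw[OF bij, symmetric] by (simp add: \<psi>_def P_def)
  have nk: "(\<Sum>x\<in>Ak_pow Ak n k. \<Sum>a\<in>Ak k. \<Sum>r\<in>R k. (cmod (\<phi> k (x(n := a), r)))\<^sup>2) = 1" if k: "k < s" for k
  proof -
    have "(\<Sum>x\<in>Ak_pow Ak n k. \<Sum>a\<in>Ak k. \<Sum>r\<in>R k. (cmod (\<phi> k (x(n := a), r)))\<^sup>2)
       = (\<Sum>z\<in>Ak_pow Ak (Suc n) k. \<Sum>r\<in>R k. (cmod (\<phi> k (z, r)))\<^sup>2)"
      unfolding Ak_pow_def sum.reindex_bij_betw[OF bij_betw_snoc, symmetric] sum.cartesian_product' by simp
    then show ?thesis using normalized_input k by (simp add: normalized_input_def)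
  qed
  have fR: "\<And>k. k < s \<Longrightarrow> finite (R k)" using normalized_input by (simp add: normalized_input_def)
  have "mutual_info (Bs_pow Bs (Suc n)) (PiE {..<s} R) (pure_output (PiE {..<s} (Ak_pow Ak (Suc n))) (J_pow s J (Suc n)) (amplitude s \<phi>))
      = mutual_info (Y1 \<times> Bs) P (pure_output (X1 \<times> X2) (tensor_map (J_pow s J n) J) \<psi>)"
  proof (rule mutual_info_pure_output_relabel[OF kraus_repI[OF tensor_map_kraus[OF k1 k2]] _ _ bij])
    show "bij_betw (\<lambda>(y, b). y(n := b)) (Y1 \<times> Bs) (Bs_pow Bs (Suc n))" unfolding Y1_def by (rule bij_snoc_Bs)
    show "bij_betw id P (PiE {..<s} R)" by (simp add: P_def)
  next
    fix x x' y y' assume "x \<in> X1 \<times> X2" "x' \<in> X1 \<times> X2"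
    then show "J_pow s J (Suc n) (append_use s n x) (append_use s n x') ((\<lambda>(y, b). y(n := b)) y) ((\<lambda>(y, b). y(n := b)) y')
      = tensor_map (J_pow s J n) J x x' y y'" unfolding X2_def by (rule J_pow_Suc)
  qed (use fin in \<open>auto simp: \<psi>_def\<close>)
  also have "\<dots> \<le> mutual_info Y1 (P \<times> X2) (pure_output X1 (J_pow s J n) (\<lambda>(x1, r, x2). \<psi> ((x1, x2), r)))
      + mutual_info Bs (P \<times> X1) (pure_output X2 J (\<lambda>(x2, r, x1). \<psi> ((x1, x2), r)))"
    by (rule mutual_info_tensor_map_le[OF k1 tp(1) k2 tp(2) fin norm])
  also have "mutual_info Y1 (P \<times> X2) (pure_output X1 (J_pow s J n) (\<lambda>(x1, r, x2). \<psi> ((x1, x2), r)))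
      \<le> C1_EU s (Ak_pow Ak n) (Bs_pow Bs n) (J_pow s J n)"
  proof -
    define \<phi>1 where "\<phi>1 = (\<lambda>k (x, r, a). \<phi> k (x(n := a), r))"
    have "normalized_input s (Ak_pow Ak n) (\<lambda>k. R k \<times> Ak k) \<phi>1"
      unfolding normalized_input_def
    proof (intro allI impI conjI)
      fix k assume k: "k < s"
      show "finite (R k \<times> Ak k)" using fR[OF k] m(1)[OF k] by simp
      have "(\<Sum>x\<in>Ak_pow Ak n k. \<Sum>r\<in>R k \<times> Ak k. (cmod (\<phi>1 k (x, r)))\<^sup>2)
        = (\<Sum>x\<in>Ak_pow Ak n k. \<Sum>a\<in>Ak k. \<Sum>r\<in>R k. (cmod (\<phi> k (x(n := a), r)))\<^sup>2)"
        unfolding sum.cartesian_product' \<phi>1_def prod.case by (intro sum.cong refl sum.swap)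
      then show "(\<Sum>x\<in>Ak_pow Ak n k. \<Sum>r\<in>R k \<times> Ak k. (cmod (\<phi>1 k (x, r)))\<^sup>2) = 1" using nk[OF k] by simp
    qed
    from mutual_info_le_C1[OF finite_mac_pow[OF mac] this]
    have "mutual_info Y1 (PiE {..<s} (\<lambda>k. R k \<times> Ak k)) (pure_output X1 (J_pow s J n) (amplitude s \<phi>1))
       \<le> C1_EU s (Ak_pow Ak n) (Bs_pow Bs n) (J_pow s J n)" unfolding Y1_def X1_def .
    moreover have "mutual_info Y1 (PiE {..<s} (\<lambda>k. R k \<times> Ak k)) (pure_output X1 (J_pow s J n) (amplitude s \<phi>1))
      = mutual_info Y1 (P \<times> X2) (pure_output X1 (J_pow s J n) (\<lambda>(x1, r, x2). \<psi> ((x1, x2), r)))"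
    proof (rule mutual_info_pure_output_relabel[OF kraus_repI[OF k1] fin(2) _ bij_betw_id bij_betw_id])
      show "bij_betw (pair_fun s) (P \<times> X2) (PiE {..<s} (\<lambda>k. R k \<times> Ak k))"
        unfolding P_def X2_def by (rule bij_betw_pair_fun)
    qed (use fin in \<open>auto simp: \<psi>_def amplitude_def \<phi>1_def pair_fun_def intro!: prod.cong\<close>)
    ultimately show ?thesis by simp
  qed
  also have "mutual_info Bs (P \<times> X1) (pure_output X2 J (\<lambda>(x2, r, x1). \<psi> ((x1, x2), r))) \<le> C1_EU s Ak Bs J"
  proof -
    define \<phi>2 where "\<phi>2 = (\<lambda>k (a, r, x). \<phi> k (x(n := a), r))"
    have "normalized_input s Ak (\<lambda>k. R k \<times> Ak_pow Ak n k) \<phi>2"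
      unfolding normalized_input_def
    proof (intro allI impI conjI)
      fix k assume k: "k < s"
      show "finite (R k \<times> Ak_pow Ak n k)" using fR[OF k] mn(1)[OF k] by simp
      have "(\<Sum>a\<in>Ak k. \<Sum>r\<in>R k \<times> Ak_pow Ak n k. (cmod (\<phi>2 k (a, r)))\<^sup>2)
        = (\<Sum>a\<in>Ak k. \<Sum>x\<in>Ak_pow Ak n k. \<Sum>r\<in>R k. (cmod (\<phi> k (x(n := a), r)))\<^sup>2)"
        unfolding sum.cartesian_product' \<phi>2_def prod.case by (intro sum.cong refl sum.swap)
      also have "\<dots> = (\<Sum>x\<in>Ak_pow Ak n k. \<Sum>a\<in>Ak k. \<Sum>r\<in>R k. (cmod (\<phi> k (x(n := a), r)))\<^sup>2)"
        by (rule sum.swap)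
      finally show "(\<Sum>a\<in>Ak k. \<Sum>r\<in>R k \<times> Ak_pow Ak n k. (cmod (\<phi>2 k (a, r)))\<^sup>2) = 1" using nk[OF k] by simp
    qed
    from mutual_info_le_C1[OF mac this]
    have "mutual_info Bs (PiE {..<s} (\<lambda>k. R k \<times> Ak_pow Ak n k)) (pure_output X2 J (amplitude s \<phi>2)) \<le> C1_EU s Ak Bs J"
      unfolding X2_def .
    moreover have "mutual_info Bs (PiE {..<s} (\<lambda>k. R k \<times> Ak_pow Ak n k)) (pure_output X2 J (amplitude s \<phi>2))
      = mutual_info Bs (P \<times> X1) (pure_output X2 J (\<lambda>(x2, r, x1). \<psi> ((x1, x2), r)))"
    proof (rule mutual_info_pure_output_relabel[OF kraus_repI[OF k2] fin(4) _ bij_betw_id bij_betw_id])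
      show "bij_betw (pair_fun s) (P \<times> X1) (PiE {..<s} (\<lambda>k. R k \<times> Ak_pow Ak n k))"
        unfolding P_def X1_def by (rule bij_betw_pair_fun)
    qed (use fin in \<open>auto simp: \<psi>_def amplitude_def \<phi>2_def pair_fun_def intro!: prod.cong\<close>)
    ultimately show ?thesis by simp
  qed
  finally show "mutual_info (Bs_pow Bs (Suc n)) (PiE {..<s} R) (pure_output (PiE {..<s} (Ak_pow Ak (Suc n))) (J_pow s J (Suc n)) (amplitude s \<phi>))
     \<le> C1_EU s (Ak_pow Ak n) (Bs_pow Bs n) (J_pow s J n) + C1_EU s Ak Bs J" by simp
qed

lemma C1_pow_Suc_ge:
  assumes mac: "finite_mac s Ak Bs J"
  shows "C1_EU s (Ak_pow Ak n) (Bs_pow Bs n) (J_pow s J n) + C1_EU s Ak Bs J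
    \<le> C1_EU s (Ak_pow Ak (Suc n)) (Bs_pow Bs (Suc n)) (J_pow s J (Suc n))"
proof -
  define c where "c = C1_EU s (Ak_pow Ak (Suc n)) (Bs_pow Bs (Suc n)) (J_pow s J (Suc n))"
  note mn = finite_macD[OF finite_mac_pow[OF mac, of n]] and m = finite_macD[OF mac]
  define X1 X2 Y1 where "X1 = PiE {..<s} (Ak_pow Ak n)" and "X2 = PiE {..<s} Ak" and "Y1 = Bs_pow Bs n"
  have fin: "finite X1" "finite Y1" "finite X2" "finite Bs"
    using mn(3,4) m(3,4) by (simp_all add: X1_def X2_def Y1_def)
  have tp: "trace_preserving X1 Y1 (J_pow s J n)" "trace_preserving X2 Bs J"
    using mn(6) m(6) by (simp_all add: X1_def X2_def Y1_def)
  have kr: "kraus_rep X1 Y1 (J_pow s J n)" "kraus_rep X2 Bs J"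
    using mn(5) m(5) by (simp_all add: X1_def X2_def Y1_def)
  have kt: "kraus_rep (X1 \<times> X2) (Y1 \<times> Bs) (tensor_map (J_pow s J n) J)"
  proof -
    obtain E1 :: "nat set" and K1 where k1: "is_kraus X1 Y1 (J_pow s J n) E1 K1" using kr(1) unfolding kraus_rep_def by blast
    obtain E2 :: "nat set" and K2 where k2: "is_kraus X2 Bs J E2 K2" using kr(2) unfolding kraus_rep_def by blast
    show ?thesis by (rule kraus_repI[OF tensor_map_kraus[OF k1 k2]])
  qed
  have main: "mutual_info Y1 (PiE {..<s} R1) (pure_output X1 (J_pow s J n) (amplitude s \<phi>1))
      + mutual_info Bs (PiE {..<s} R2) (pure_output X2 J (amplitude s \<phi>2)) \<le> c"
    if normalized_input: "normalized_input s (Ak_pow Ak n) R1 \<phi>1" "normalized_input s Ak R2 \<phi>2" for R1 R2 :: "nat \<Rightarrow> nat set" and \<phi>1 \<phi>2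
  proof -
    have fR: "finite (PiE {..<s} R1)" "finite (PiE {..<s} R2)" using normalized_input_finite normalized_input by blast+
    have n1: "(\<Sum>x\<in>X1. \<Sum>r\<in>PiE {..<s} R1. (cmod (amplitude s \<phi>1 (x, r)))\<^sup>2) = 1"
      unfolding X1_def by (rule amplitude_norm[OF normalized_input(1) mn(1)])
    have n2: "(\<Sum>x\<in>X2. \<Sum>r\<in>PiE {..<s} R2. (cmod (amplitude s \<phi>2 (x, r)))\<^sup>2) = 1"
      unfolding X2_def by (rule amplitude_norm[OF normalized_input(2) m(1)])
    define \<phi> where "\<phi> = (\<lambda>k (z, r1, r2). \<phi>1 k (restrict z {..<n}, r1) * \<phi>2 k (z n, r2))"
    have rs: "restrict x {..<n} = x" if "x \<in> Ak_pow Ak n k" for x k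
      using that by (simp add: Ak_pow_def PiE_restrict)
    have adm': "normalized_input s (Ak_pow Ak (Suc n)) (\<lambda>k. R1 k \<times> R2 k) \<phi>"
      unfolding normalized_input_def
    proof (intro allI impI conjI)
      fix k assume k: "k < s"
      show "finite (R1 k \<times> R2 k)" using normalized_input k by (simp add: normalized_input_def)
      have "(\<Sum>z\<in>Ak_pow Ak (Suc n) k. \<Sum>r\<in>R1 k \<times> R2 k. (cmod (\<phi> k (z, r)))\<^sup>2)
        = (\<Sum>x\<in>Ak_pow Ak n k. \<Sum>a\<in>Ak k. \<Sum>r1\<in>R1 k. \<Sum>r2\<in>R2 k. (cmod (\<phi> k (x(n := a), r1, r2)))\<^sup>2)"
        unfolding Ak_pow_def sum.reindex_bij_betw[OF bij_betw_snoc, symmetric] sum.cartesian_product' by simp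
      also have "\<dots> = (\<Sum>x\<in>Ak_pow Ak n k. \<Sum>a\<in>Ak k. \<Sum>r1\<in>R1 k. \<Sum>r2\<in>R2 k. (cmod (\<phi>1 k (x, r1)))\<^sup>2 * (cmod (\<phi>2 k (a, r2)))\<^sup>2)"
        by (intro sum.cong refl) (simp add: \<phi>_def rs[of _ k] norm_mult power_mult_distrib)
      also have "\<dots> = (\<Sum>x\<in>Ak_pow Ak n k. \<Sum>r1\<in>R1 k. (cmod (\<phi>1 k (x, r1)))\<^sup>2) * (\<Sum>a\<in>Ak k. \<Sum>r2\<in>R2 k. (cmod (\<phi>2 k (a, r2)))\<^sup>2)"
        by (simp only: sum_product)
      finally show "(\<Sum>z\<in>Ak_pow Ak (Suc n) k. \<Sum>r\<in>R1 k \<times> R2 k. (cmod (\<phi> k (z, r)))\<^sup>2) = 1"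
        using normalized_input k by (simp add: normalized_input_def)
    qed
    have "mutual_info (Bs_pow Bs (Suc n)) (PiE {..<s} (\<lambda>k. R1 k \<times> R2 k)) (pure_output (PiE {..<s} (Ak_pow Ak (Suc n))) (J_pow s J (Suc n)) (amplitude s \<phi>))
      = mutual_info (Y1 \<times> Bs) (PiE {..<s} R1 \<times> PiE {..<s} R2)
         (pure_output (X1 \<times> X2) (tensor_map (J_pow s J n) J) (\<lambda>((x1, x2), (r1, r2)). amplitude s \<phi>1 (x1, r1) * amplitude s \<phi>2 (x2, r2)))"
    proof (rule mutual_info_pure_output_relabel[OF kt])
      show "bij_betw (append_use s n) (X1 \<times> X2) (PiE {..<s} (Ak_pow Ak (Suc n)))"
        unfolding X1_def X2_def by (rule bij_append_use)
      show "bij_betw (\<lambda>(y, b). y(n := b)) (Y1 \<times> Bs) (Bs_pow Bs (Suc n))" unfolding Y1_def by (rule bij_snoc_Bs)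
      show "bij_betw (pair_fun s) (PiE {..<s} R1 \<times> PiE {..<s} R2) (PiE {..<s} (\<lambda>k. R1 k \<times> R2 k))"
        by (rule bij_betw_pair_fun)
      show "finite (Y1 \<times> Bs)" "finite (PiE {..<s} R1 \<times> PiE {..<s} R2)" using fin fR by simp_all
    next
      fix x x' y y' assume "x \<in> X1 \<times> X2" "x' \<in> X1 \<times> X2"
      then show "J_pow s J (Suc n) (append_use s n x) (append_use s n x') ((\<lambda>(y, b). y(n := b)) y) ((\<lambda>(y, b). y(n := b)) y')
        = tensor_map (J_pow s J n) J x x' y y'" unfolding X2_def by (rule J_pow_Suc)
    next
      fix t r assume "t \<in> X1 \<times> X2" "r \<in> PiE {..<s} R1 \<times> PiE {..<s} R2"
      then obtain x a r1 r2 where t: "t = (x, a)" "r = (r1, r2)" "x \<in> X1" by auto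
      have rk: "restrict (x k) {..<n} = x k" if "k < s" for k
        using rs[OF PiE_mem[OF t(3)[unfolded X1_def]]] that by simp
      have "amplitude s \<phi> (append_use s n (x, a), pair_fun s (r1, r2)) = (\<Prod>k<s. \<phi>1 k (x k, r1 k) * \<phi>2 k (a k, r2 k))"
        unfolding amplitude_def prod.case by (intro prod.cong refl) (simp add: \<phi>_def pair_fun_def rk)
      then show "amplitude s \<phi> (append_use s n t, pair_fun s r) = (\<lambda>((x1, x2), (r1, r2)). amplitude s \<phi>1 (x1, r1) * amplitude s \<phi>2 (x2, r2)) (t, r)"
        unfolding t by (simp only: amplitude_def prod.case prod.distrib)
    qed
    also have "\<dots> = mutual_info Y1 (PiE {..<s} R1) (pure_output X1 (J_pow s J n) (amplitude s \<phi>1))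
      + mutual_info Bs (PiE {..<s} R2) (pure_output X2 J (amplitude s \<phi>2))"
      by (rule mutual_info_pure_output_tensor[OF kr tp fin(1,2) fR(1) fin(3,4) fR(2) n1 n2])
    finally show ?thesis
      using mutual_info_le_C1[OF finite_mac_pow[OF mac] adm'] unfolding c_def by simp
  qed
  have "C1_EU s (Ak_pow Ak n) (Bs_pow Bs n) (J_pow s J n) \<le> c - C1_EU s Ak Bs J"
  proof (rule C1_le[OF finite_mac_pow[OF mac]])
    fix R1 :: "nat \<Rightarrow> nat set" and \<phi>1 assume adm1: "normalized_input s (Ak_pow Ak n) R1 \<phi>1"
    have "C1_EU s Ak Bs J \<le> c - mutual_info Y1 (PiE {..<s} R1) (pure_output X1 (J_pow s J n) (amplitude s \<phi>1))"
    proof (rule C1_le[OF mac])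
      fix R2 :: "nat \<Rightarrow> nat set" and \<phi>2 assume adm2: "normalized_input s Ak R2 \<phi>2"
      show "mutual_info Bs (PiE {..<s} R2) (pure_output (PiE {..<s} Ak) J (amplitude s \<phi>2))
        \<le> c - mutual_info Y1 (PiE {..<s} R1) (pure_output X1 (J_pow s J n) (amplitude s \<phi>1))"
        using main[OF adm1 adm2] by (simp add: X2_def)
    qed
    then show "mutual_info (Bs_pow Bs n) (PiE {..<s} R1) (pure_output (PiE {..<s} (Ak_pow Ak n)) (J_pow s J n) (amplitude s \<phi>1)) \<le> c - C1_EU s Ak Bs J"
      by (simp add: X1_def Y1_def)
  qed
  then show ?thesis by (simp add: c_def)
qed

theorem theorem1:
  fixes s :: nat and Ak :: "nat \<Rightarrow> 'a set" and Bs :: "'b set"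
    and J :: "(nat \<Rightarrow> 'a) \<Rightarrow> (nat \<Rightarrow> 'a) \<Rightarrow> 'b qop"
  assumes "is_MAC s Ak Bs J"
  shows "((\<lambda>n. C1_EU s (Ak_pow Ak n) (Bs_pow Bs n) (J_pow s J n) / real n)
            \<longlonglongrightarrow> C1_EU s Ak Bs J) \<and>
         C_EU s Ak Bs J = C1_EU s Ak Bs J"
proof -
  have mac: "finite_mac s Ak Bs J" by (rule is_MAC_finite_mac[OF assms])
  define a where "a = (\<lambda>n. C1_EU s (Ak_pow Ak n) (Bs_pow Bs n) (J_pow s J n))"
  define c where "c = C1_EU s Ak Bs J"
  have "a (Suc n) = a n + c" for n
    unfolding a_def c_def by (rule antisym[OF C1_pow_Suc_le[OF mac] C1_pow_Suc_ge[OF mac]])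
  then have a: "a n = a 0 + real n * c" for n
    by (induction n) (simp_all add: algebra_simps)
  have eq: "\<forall>\<^sub>F n in sequentially. a n / real n = a 0 / real n + c"
    using eventually_gt_at_top[of 0]
  proof eventually_elim
    case (elim n)
    then show ?case unfolding a[of n] by (simp add: add_divide_distrib)
  qed
  have "(\<lambda>n. a 0 / real n + c) \<longlonglongrightarrow> 0 + c"
    by (intro tendsto_add tendsto_const lim_const_over_n)
  then have "(\<lambda>n. a n / real n) \<longlonglongrightarrow> c"
    unfolding tendsto_cong[OF eq] by simp
  then show ?thesis unfolding C_EU_def a_def c_def using limI by blast
qed

end
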